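(* Let $\alpha_1,\alpha_2\in(0,1)$, $c>0$, $n\ge1$, and assume that $s\mapsto\Psi(s)^{-1}=s^{(\alpha_2c+\alpha_1s)/(c+s)}$ is a Bernstein function on $(0,\infty)$. Let $1<p<1+2/n$ and $d=2-n(p-1)>0$. Let $0\le\varphi\in X=L^1(\mathbb R^n)\cap L^\infty(\mathbb R^n)$, $\varphi\not\equiv0$, and for $A_\varepsilon>0$ let $T_\varepsilon$ be the maximal existence time of the nonnegative maximal mild solution with initial datum $u_0=A_\varepsilon\varphi$. Then there are $A_{\varepsilon_0},C>0$ such that $$T_\varepsilon\le K^{-1}\!\left(C\,A_\varepsilon^{-2(p-1)/d}\right),\qquad 0<A_\varepsilon\le A_{\varepsilon_0}.$$ Hence $$T_\varepsilon\lesssim A_\varepsilon^{-\frac{1}{\alpha_2\left(\frac1{p-1}-\frac n2\right)}}\qquad(A_\varepsilon\downarrow0).$$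
   Context: $f\lesssim g$ as $A_\varepsilon\downarrow0$ means $f\le C'g$ for some constant $C'$ and all sufficiently small $A_\varepsilon>0$. A Bernstein function is a $C^\infty$ function $F:(0,\infty)\to[0,\infty)$ with $(-1)^{m-1}F^{(m)}\ge0$ for all $m\ge1$. $\Psi(z)=z^{-B(z)}$ with $B(z)=\frac{\alpha_2c+\alpha_1z}{c+z}$ (principal branch), $\psi\in L^1_{\rm loc}(0,\infty)$ is the continuous function on $(0,\infty)$ of exponential order whose Laplace transform is $\Psi$, and $K(t)=\int_0^t\psi(s)\,ds$, which under the Bernstein condition is a strictly increasing continuous bijection of $[0,\infty)$ with inverse $K^{-1}$. The families are $S_{\mathcal A}(t)g=Z(t)*g$, $P_{\mathcal A}(t)g=Y(t)*g$, where, under the Bernstein condition, $Z(t)$ ($t>0$, weakly continuous in $t$) are probability measures and $Y(t)$ (a.e. $t>0$, measurable in $t$) are finite positive measures on $\mathbb R^n$ determined by $$\int_0^\infty e^{-zt}\int_{\mathbb R^n}e^{-ix\cdot\xi}Z(t,dx)\,dt=\frac{\Psi(z)^{-1}}{z(\Psi(z)^{-1}+|\xi|^2)},\qquad\int_0^\infty e^{-zt}\int_{\mathbb R^n}e^{-ix\cdot\xi}Y(t,dx)\,dt=\frac1{\Psi(z)^{-1}+|\xi|^2}\quad(z>0);$$ $S_{\mathcal A}(0)=I$. A mild solution on $[0,T]$ is a function in $C([0,T];L^1(\mathbb R^n))\cap L^\infty((0,T);L^\infty(\mathbb R^n))$ satisfying $$u(t)=S_{\mathcal A}(t)u_0+\int_0^tP_{\mathcal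 A}(t-s)(u(s)_+)^p\,ds$$ in $L^1$ for every $t\in[0,T]$ and in $L^\infty$ for a.e. $t>0$ (this is the mild form of ${}^{S}D_0^{\alpha(t)}u=\Delta u+u^p$, $u(0)=u_0$, with $\alpha(t)=\alpha_2+(\alpha_1-\alpha_2)e^{-ct}$). For each $0\le u_0\in X$ there is a unique nonnegative maximal mild solution $u$ on $[0,T_{\max})$, $0<T_{\max}\le\infty$, i.e. one that is a mild solution on $[0,T]$ for all $T<T_{\max}$ and cannot be extended to a mild solution on a strictly larger interval. *)

theory Defs
  imports "HOL-Probability.Probability"
begin

definition bernstein_function :: "(real \<Rightarrow> real) \<Rightarrow> bool" where
  "bernstein_function F \<longleftrightarrow>
     (\<forall>x>0. F x \<ge> 0) \<and>
     (\<forall>m. \<forall>x>0. (deriv ^^ m) F differentiable at x) \<and>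
     (\<forall>m\<ge>1. \<forall>x>0. (-1) ^ (m - 1) * (deriv ^^ m) F x \<ge> 0)"

definition B :: "real \<Rightarrow> real \<Rightarrow> real \<Rightarrow> complex \<Rightarrow> complex" where
  "B \<alpha>1 \<alpha>2 c z = (of_real (\<alpha>2 * c) + of_real \<alpha>1 * z) / (of_real c + z)"

definition Psi :: "real \<Rightarrow> real \<Rightarrow> real \<Rightarrow> complex \<Rightarrow> complex" where
  "Psi \<alpha>1 \<alpha>2 c z = z powr (- B \<alpha>1 \<alpha>2 c z)"

lemma inverse_Psi_of_real:
  assumes "s > 0"
  shows "inverse (Psi \<alpha>1 \<alpha>2 c (of_real s)) = of_real (s powr ((\<alpha>2 * c + \<alpha>1 * s) / (c + s)))"
proof -
  have "B \<alpha>1 \<alpha>2 c (of_real s) = of_real ((\<alpha>2 * c + \<alpha>1 * s) / (c + s))"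
    by (simp add: B_def)
  then show ?thesis
    using assms by (simp add: Psi_def powr_minus powr_of_real del: of_real_divide)
qed

(* Local integrability is meant up to the left end point 0, as needed for K; the growth bound is
   imposed near infinity only, since psi may be singular at 0. *)
definition kernel_of_Psi :: "real \<Rightarrow> real \<Rightarrow> real \<Rightarrow> (real \<Rightarrow> real) \<Rightarrow> bool" where
  "kernel_of_Psi \<alpha>1 \<alpha>2 c \<psi> \<longleftrightarrow>
     continuous_on {0<..} \<psi> \<and>
     (\<forall>t>0. set_integrable lborel {0<..t} \<psi>) \<and>
     (\<exists>\<sigma>\<ge>0.
        (\<exists>M t0. \<forall>t\<ge>t0. \<bar>\<psi> t\<bar> \<le> M * exp (\<sigma> * t)) \<and>
        (\<forall>z. Re z > \<sigma> \<longrightarrow>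
           has_bochner_integral lborel
             (\<lambda>t. indicator {0<..} t *\<^sub>R (exp (- (z * of_real t)) * of_real (\<psi> t)))
             (Psi \<alpha>1 \<alpha>2 c z)))"

definition K :: "(real \<Rightarrow> real) \<Rightarrow> real \<Rightarrow> real" where
  "K \<psi> t = (LINT s:{0<..t}|lborel. \<psi> s)"

definition fourier_measure :: "(real ^ 'n) measure \<Rightarrow> real ^ 'n \<Rightarrow> complex" where
  "fourier_measure \<mu> \<xi> = (LINT x|\<mu>. cis (- (x \<bullet> \<xi>)))"

definition S_measures :: "real \<Rightarrow> real \<Rightarrow> real \<Rightarrow> (real \<Rightarrow> (real ^ 'n) measure) \<Rightarrow> bool" where
  "S_measures \<alpha>1 \<alpha>2 c Z \<longleftrightarrow>
     (\<forall>t>0. prob_space (Z t) \<and> sets (Z t) = sets borel) \<and>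
     (\<forall>f :: real ^ 'n \<Rightarrow> real. continuous_on UNIV f \<and> bounded (range f) \<longrightarrow>
        continuous_on {0<..} (\<lambda>t. LINT x|Z t. f x)) \<and>
     (\<forall>z>0. \<forall>\<xi>.
        has_bochner_integral lborel
          (\<lambda>t. indicator {0<..} t *\<^sub>R (of_real (exp (- z * t)) * fourier_measure (Z t) \<xi>))
          (inverse (Psi \<alpha>1 \<alpha>2 c (of_real z)) /
             (of_real z * (inverse (Psi \<alpha>1 \<alpha>2 c (of_real z)) + of_real ((norm \<xi>)\<^sup>2)))))"

(* Y t is determined for almost every t only; Y is a representative that consists of finite
   measures for every t > 0 (for instance the zero measure on the exceptional null set). *)
definition P_measures :: "real \<Rightarrow> real \<Rightarrow> real \<Rightarrow> (real \<Rightarrow> (real ^ 'n) measure) \<Rightarrow> bool" where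
  "P_measures \<alpha>1 \<alpha>2 c Y \<longleftrightarrow>
     (\<forall>t>0. finite_measure (Y t) \<and> sets (Y t) = sets borel) \<and>
     (\<forall>E \<in> sets borel. (\<lambda>t. measure (Y t) E) \<in> borel_measurable (restrict_space borel {0<..})) \<and>
     (\<forall>z>0. \<forall>\<xi>.
        has_bochner_integral lborel
          (\<lambda>t. indicator {0<..} t *\<^sub>R (of_real (exp (- z * t)) * fourier_measure (Y t) \<xi>))
          (1 / (inverse (Psi \<alpha>1 \<alpha>2 c (of_real z)) + of_real ((norm \<xi>)\<^sup>2))))"

definition conv :: "(real ^ 'n) measure \<Rightarrow> (real ^ 'n \<Rightarrow> real) \<Rightarrow> real ^ 'n \<Rightarrow> real" where
  "conv \<mu> g x = (LINT y|\<mu>. g (x - y))"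

definition S_op :: "(real \<Rightarrow> (real ^ 'n) measure) \<Rightarrow> real \<Rightarrow> (real ^ 'n \<Rightarrow> real) \<Rightarrow> real ^ 'n \<Rightarrow> real" where
  "S_op Z t g = (if t = 0 then g else conv (Z t) g)"

definition P_op :: "(real \<Rightarrow> (real ^ 'n) measure) \<Rightarrow> real \<Rightarrow> (real ^ 'n \<Rightarrow> real) \<Rightarrow> real ^ 'n \<Rightarrow> real" where
  "P_op Y t g = conv (Y t) g"

(* Elements of L^1 and L^infinity are represented by Borel functions, identified almost everywhere. *)
definition in_Linf :: "(real ^ 'n \<Rightarrow> real) \<Rightarrow> bool" where
  "in_Linf f \<longleftrightarrow> f \<in> borel_measurable lborel \<and> (\<exists>M. AE x in lborel. \<bar>f x\<bar> \<le> M)"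

definition eq_in_L1 :: "(real ^ 'n \<Rightarrow> real) \<Rightarrow> (real ^ 'n \<Rightarrow> real) \<Rightarrow> bool" where
  "eq_in_L1 f g \<longleftrightarrow> integrable lborel f \<and> integrable lborel g \<and> (AE x in lborel. f x = g x)"

definition eq_in_Linf :: "(real ^ 'n \<Rightarrow> real) \<Rightarrow> (real ^ 'n \<Rightarrow> real) \<Rightarrow> bool" where
  "eq_in_Linf f g \<longleftrightarrow> in_Linf f \<and> in_Linf g \<and> (AE x in lborel. f x = g x)"

definition C_L1 :: "real \<Rightarrow> (real \<Rightarrow> real ^ 'n \<Rightarrow> real) \<Rightarrow> bool" where
  "C_L1 T u \<longleftrightarrow>
     (\<forall>t\<in>{0..T}. integrable lborel (u t) \<and>
        ((\<lambda>s. LINT x|lborel. \<bar>u s x - u t x\<bar>) \<longlongrightarrow> 0) (at t within {0..T}))"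

definition Linf_Linf :: "real \<Rightarrow> (real \<Rightarrow> real ^ 'n \<Rightarrow> real) \<Rightarrow> bool" where
  "Linf_Linf T u \<longleftrightarrow>
     (\<exists>M. AE t in lborel. t \<in> {0<..<T} \<longrightarrow> (AE x in lborel. \<bar>u t x\<bar> \<le> M))"

definition duhamel_integrand ::
  "(real \<Rightarrow> (real ^ 'n) measure) \<Rightarrow> real \<Rightarrow> (real \<Rightarrow> real ^ 'n \<Rightarrow> real) \<Rightarrow> real \<Rightarrow> real \<Rightarrow> real ^ 'n \<Rightarrow> real" where
  "duhamel_integrand Y p u t s = P_op Y (t - s) (\<lambda>y. (max 0 (u s y)) powr p)"

(* The integral over s is a Bochner integral in L^1. For a curve s |-> h s in L^1 given by a jointly
   measurable h, Bochner integrability means that h is integrable in (s, x), and the integral is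
   then obtained by integrating over s for almost every x. *)
definition L1_bochner_integrable :: "real set \<Rightarrow> (real \<Rightarrow> real ^ 'n \<Rightarrow> real) \<Rightarrow> bool" where
  "L1_bochner_integrable I h \<longleftrightarrow>
     set_integrable (lborel \<Otimes>\<^sub>M lborel) (I \<times> UNIV) (\<lambda>(s, x). h s x)"

definition L1_bochner_integral :: "real set \<Rightarrow> (real \<Rightarrow> real ^ 'n \<Rightarrow> real) \<Rightarrow> real ^ 'n \<Rightarrow> real" where
  "L1_bochner_integral I h x = (LINT s:I|lborel. h s x)"

definition mild_rhs ::
  "(real \<Rightarrow> (real ^ 'n) measure) \<Rightarrow> (real \<Rightarrow> (real ^ 'n) measure) \<Rightarrow> real \<Rightarrow> (real ^ 'n \<Rightarrow> real) \<Rightarrow>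
   (real \<Rightarrow> real ^ 'n \<Rightarrow> real) \<Rightarrow> real \<Rightarrow> real ^ 'n \<Rightarrow> real" where
  "mild_rhs Z Y p u0 u t x =
     S_op Z t u0 x + L1_bochner_integral {0<..<t} (duhamel_integrand Y p u t) x"

(* A curve in C([0,T]; L^1) always has a representative that is jointly Borel measurable in (t, x);
   the first condition says that u is such a representative. *)
definition mild_solution ::
  "(real \<Rightarrow> (real ^ 'n) measure) \<Rightarrow> (real \<Rightarrow> (real ^ 'n) measure) \<Rightarrow> real \<Rightarrow> (real ^ 'n \<Rightarrow> real) \<Rightarrow>
   real \<Rightarrow> (real \<Rightarrow> real ^ 'n \<Rightarrow> real) \<Rightarrow> bool" where
  "mild_solution Z Y p u0 T u \<longleftrightarrow>
     (\<lambda>(t, x). u t x) \<in> borel_measurable (restrict_space borel {0..T} \<Otimes>\<^sub>M borel) \<and>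
     C_L1 T u \<and> Linf_Linf T u \<and>
     (\<forall>t\<in>{0..T}. L1_bochner_integrable {0<..<t} (duhamel_integrand Y p u t) \<and>
        eq_in_L1 (u t) (mild_rhs Z Y p u0 u t)) \<and>
     (AE t in lborel. t \<in> {0<..T} \<longrightarrow> eq_in_Linf (u t) (mild_rhs Z Y p u0 u t))"

(* An extension to an interval strictly larger than [0, Tmax) gives, by restriction, a mild solution
   on some [0, T] with Tmax <= T. *)
definition nonneg_maximal_mild_solution ::
  "(real \<Rightarrow> (real ^ 'n) measure) \<Rightarrow> (real \<Rightarrow> (real ^ 'n) measure) \<Rightarrow> real \<Rightarrow> (real ^ 'n \<Rightarrow> real) \<Rightarrow>
   ereal \<Rightarrow> (real \<Rightarrow> real ^ 'n \<Rightarrow> real) \<Rightarrow> bool" where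
  "nonneg_maximal_mild_solution Z Y p u0 Tmax u \<longleftrightarrow>
     0 < Tmax \<and>
     (\<forall>T>0. ereal T < Tmax \<longrightarrow> mild_solution Z Y p u0 T u) \<and>
     (\<forall>t\<ge>0. ereal t < Tmax \<longrightarrow> (AE x in lborel. 0 \<le> u t x)) \<and>
     \<not> (\<exists>T v. Tmax \<le> ereal T \<and> mild_solution Z Y p u0 T v \<and>
          (\<forall>t\<ge>0. ereal t < Tmax \<longrightarrow> (AE x in lborel. v t x = u t x)))"

definition lesssim_at_0 :: "(real \<Rightarrow> ereal) \<Rightarrow> (real \<Rightarrow> real) \<Rightarrow> bool" where
  "lesssim_at_0 f g \<longleftrightarrow> (\<exists>C'. eventually (\<lambda>A. f A \<le> ereal (C' * g A)) (at_right 0))"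

end

(*
  Test the equation with the Gaussian q x = exp (- |x|^2 / (2 R^2)). Its negative Laplacian is at most
  (n / R^2) q, so w t = (integral of u t * q) satisfies, by Jensen's inequality, the Volterra inequality
  w >= w 0 + psi * (b w^p - (n / R^2) w) with b = (integral of q)^(1-p). If R^d is a large multiple of
  A^(1-p), the reaction term dominates from the start, w can only grow, and it blows up before
  K t reaches a multiple of R^2.

  Only the following is needed of the solution operators. On the Fourier side the mild formula is
  converted by uniqueness of Laplace transforms into u = u0 + psi * (N - |xi|^2 u); psi >= 0 because it
  is the total mass of Y; and K t is comparable to Psi (1/t) because Psi is the Laplace transform of psi >= 0
  and 1 / Psi is concave, which replaces Tauberian arguments and the scaling of K.
*)
theory Submission
  imports Defs
begin

section \<open>Laplace transforms and convolution\<close>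

text \<open>\<open>Z\<close> and \<open>Y\<close> are given only through their transforms, so
  testing has to happen on the frequency side: the test function must be the Fourier transform of a
  finite measure with finite second moment, and a Gaussian is one that is also positive. The memory
  term is nonlocal in time, so no comparison with an ODE is at hand; instead w is pushed through
  doubling levels on shrinking time windows, for which K(rT) >= c r K(T) with 0 < r <= 1 suffices.

  The powers of R come from scaling. The integral of q is of order R^n, so b is of order R^(n(1-p)).
  With w 0 of order A, reaction beats n/R^2 once R^(-2) is below A^(p-1) R^(n(1-p)), that is, once
  R^d exceeds A^(1-p). The blow-up scale of K is then w(0)^(1-p)/b, of order A^(1-p) R^(n(p-1)),
  which is R^2. Since d > 0, R grows as A decreases; for small A it is at least 1, and the tested
  datum stays above A m with one fixed m.\<close>

definition laplace :: "(real \<Rightarrow> complex) \<Rightarrow> real \<Rightarrow> complex \<Rightarrow> bool" where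
  "laplace f z L \<longleftrightarrow> has_bochner_integral lborel (\<lambda>t. of_real (exp (- z * t)) * f t) L"

text \<open>Integrated over the whole line. The functions it is applied to later vanish for t \<le>
  0, so it is then an integral over (0,t), and \<open>laplace\<close> is the one-sided
  transform.\<close>

definition convolve :: "(real \<Rightarrow> complex) \<Rightarrow> (real \<Rightarrow> complex) \<Rightarrow> real \<Rightarrow> complex" where
  "convolve f g t = (LINT s|lborel. f (t - s) * g s)"

text \<open>Dividing out the exponential weight recovers f. This is the source of measurability in t
  for the total mass and for the Fourier transforms of \<open>Y t\<close>.\<close>

lemma laplace_measurable:
  assumes "laplace f z L"
  shows "f \<in> borel_measurable borel"
proof -
  have "(\<lambda>t. of_real (exp (- z * t)) * f t) \<in> borel_measurable borel"
    using assms unfolding laplace_def by (auto dest: borel_measurable_has_bochner_integral)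
  then have "(\<lambda>t. of_real (exp (z * t)) * (of_real (exp (- z * t)) * f t)) \<in> borel_measurable borel"
    by measurable
  also have "(\<lambda>t. of_real (exp (z * t)) * (of_real (exp (- z * t)) * f t)) = f"
    by (simp add: fun_eq_iff mult.assoc[symmetric] of_real_mult[symmetric] exp_add[symmetric]
        del: of_real_mult)
  finally show ?thesis .
qed

lemma laplace_add: "laplace f z L \<Longrightarrow> laplace g z M \<Longrightarrow> laplace (\<lambda>t. f t + g t) z (L + M)"
  unfolding laplace_def by (auto simp: ring_distribs intro: has_bochner_integral_add)

lemma laplace_diff: "laplace f z L \<Longrightarrow> laplace g z M \<Longrightarrow> laplace (\<lambda>t. f t - g t) z (L - M)"
  unfolding laplace_def by (auto simp: ring_distribs intro: has_bochner_integral_diff)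

lemma laplace_cmult: "laplace f z L \<Longrightarrow> laplace (\<lambda>t. a * f t) z (a * L)"
  unfolding laplace_def
  using has_bochner_integral_mult_right[of a lborel "\<lambda>t. of_real (exp (- z * t)) * f t" L]
  by (simp add: mult_ac)

lemma integrable_convolve_pair:
  fixes F G :: "real \<Rightarrow> complex"
  assumes F: "integrable lborel F" and G: "integrable lborel G"
  shows "integrable (lborel \<Otimes>\<^sub>M lborel) (\<lambda>(s, t). F (t - s) * G s)"
proof -
  have [measurable]: "F \<in> borel_measurable borel" "G \<in> borel_measurable borel"
    using F G by auto
  have shift: "integrable lborel (\<lambda>t. F (t - s))" for s
    using lborel_integrable_real_affine[OF F, of 1 "-s"] by simp
  show ?thesis
  proof (rule lborel_pair.Fubini_integrable)
    have "(LINT t|lborel. norm (F (t - s))) = (LINT t|lborel. norm (F t))" for s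
      using lborel_integral_real_affine[of 1 "\<lambda>t. norm (F t)" "-s"] by simp
    then have "(\<lambda>s. LINT t|lborel. norm (F (t - s) * G s)) = (\<lambda>s. (LINT t|lborel. norm (F t)) * norm (G s))"
      by (auto simp: norm_mult)
    then show "integrable lborel (\<lambda>s. LINT t|lborel. norm (case (s, t) of (s, t) \<Rightarrow> F (t - s) * G s))"
      using G by simp
  qed (use shift in \<open>auto intro!: AE_I2\<close>)
qed

lemma laplace_convolve:
  assumes f: "laplace f z L" and g: "laplace g z M"
  shows "laplace (convolve f g) z (L * M)"
proof -
  define F where "F = (\<lambda>t. of_real (exp (- z * t)) * f t)"
  define G where "G = (\<lambda>t. of_real (exp (- z * t)) * g t)"
  have F: "integrable lborel F" "integral\<^sup>L lborel F = L"
    and G: "integrable lborel G" "integral\<^sup>L lborel G = M"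
    using f g unfolding laplace_def F_def G_def by (auto simp: has_bochner_integral_iff)
  note I = integrable_convolve_pair[OF F(1) G(1)]
  \<comment> \<open>The weight is multiplicative, e^(-z(t-s)) e^(-zs) = e^(-zt), so convolving the
    weighted functions amounts to weighting the convolution.\<close>
  have FG: "F (t - s) * G s = of_real (exp (- z * t)) * (f (t - s) * g s)" for s t
  proof -
    have "exp (- z * (t - s)) * exp (- z * s) = exp (- z * t)"
      by (simp add: exp_add[symmetric] algebra_simps)
    then show ?thesis unfolding F_def G_def
      by (metis (no_types, lifting) mult.assoc mult.left_commute of_real_mult)
  qed
  have eq: "(LINT s|lborel. F (t - s) * G s) = of_real (exp (- z * t)) * convolve f g t" for t
    unfolding convolve_def FG by simp
  have "integrable lborel (\<lambda>t. LINT s|lborel. F (t - s) * G s)"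
    using lborel_pair.integrable_snd[OF I] by simp
  moreover have "(LINT t|lborel. LINT s|lborel. F (t - s) * G s) = L * M"
  proof -
    have "(LINT t|lborel. F (t - s)) = L" for s
      using lborel_integral_real_affine[of 1 F "-s"] F by simp
    then show ?thesis
      using lborel_pair.Fubini_integral[OF I] G by simp
  qed
  ultimately show ?thesis
    unfolding laplace_def eq by (simp add: has_bochner_integral_iff)
qed

section \<open>Injectivity of the Laplace transform\<close>

text \<open>Under x = e^(-t) the transforms at z0 + k become the moments of a function on (0,1].
  Vanishing moments annihilate polynomials, by Weierstrass continuous functions, by dominated
  convergence half-lines, and by a Dynkin argument all Borel sets.\<close>

lemma laplace_unique_zero:
  assumes neg: "\<And>t. t \<le> 0 \<Longrightarrow> f t = 0"
    and lap: "\<And>z. z > \<sigma> \<Longrightarrow> laplace f z 0"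
  shows "AE t in lborel. f t = 0"
proof -
  \<comment> \<open>Strictly beyond \<sigma>, so g is integrable and every z0 + k is
    admissible.\<close>
  define z0 where "z0 = \<sigma> + 1"
  define g where "g = (\<lambda>t. of_real (exp (- z0 * t)) * f t)"
  have mono: "integrable lborel (\<lambda>t. of_real (exp (- t) ^ k) * g t)"
    "(LINT t|lborel. of_real (exp (- t) ^ k) * g t) = 0" for k :: nat
  proof -
    have "(exp (- t) ^ k) * exp (- z0 * t) = exp (- (z0 + real k) * t)" for t
      by (simp add: exp_of_nat_mult[symmetric] exp_add[symmetric] algebra_simps)
    then have eq: "of_real (exp (- t) ^ k) * g t = of_real (exp (- (z0 + real k) * t)) * f t" for t
      unfolding g_def by (metis mult.assoc of_real_mult)
    have "laplace f (z0 + real k) 0" by (rule lap) (simp add: z0_def)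
    then show "integrable lborel (\<lambda>t. of_real (exp (- t) ^ k) * g t)"
    "(LINT t|lborel. of_real (exp (- t) ^ k) * g t) = 0"
      unfolding laplace_def eq by (auto simp: has_bochner_integral_iff)
  qed
  have g: "integrable lborel g" using mono(1)[of 0] by simp
  then have [measurable]: "g \<in> borel_measurable borel" by auto
  have gneg: "t \<le> 0 \<Longrightarrow> g t = 0" for t by (simp add: g_def neg)
  have poly: "integrable lborel (\<lambda>t. of_real (\<Sum>i\<le>n. a i * exp (- t) ^ i) * g t) \<and>
    (LINT t|lborel. of_real (\<Sum>i\<le>n. a i * exp (- t) ^ i) * g t) = 0" for a :: "nat \<Rightarrow> real" and n :: nat
  proof -
    have "has_bochner_integral lborel (\<lambda>t. \<Sum>i\<le>n. of_real (a i) * (of_real (exp (- t) ^ i) * g t)) (\<Sum>i\<le>n. of_real (a i) * 0)"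
      by (intro has_bochner_integral_sum has_bochner_integral_mult_right)
         (use mono in \<open>auto simp: has_bochner_integral_iff\<close>)
    also have "(\<lambda>t. \<Sum>i\<le>n. of_real (a i) * (of_real (exp (- t) ^ i) * g t)) =
       (\<lambda>t. of_real (\<Sum>i\<le>n. a i * exp (- t) ^ i) * g t)"
      by (auto simp: sum_distrib_right mult.assoc fun_eq_iff)
    finally show ?thesis by (auto simp: has_bochner_integral_iff)
  qed
  have cont: "(LINT t|lborel. of_real (\<phi> (exp (- t))) * g t) = 0"
    if \<phi>: "continuous_on UNIV \<phi>" "\<And>x. \<bar>\<phi> x\<bar> \<le> 1" for \<phi> :: "real \<Rightarrow> real"
  proof -
    have [measurable]: "\<phi> \<in> borel_measurable borel" using \<phi> by (simp add: borel_measurable_continuous_onI)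
    have int: "integrable lborel (\<lambda>t. of_real (\<phi> (exp (- t))) * g t)"
      by (rule Bochner_Integration.integrable_bound[OF g])
         (auto simp: norm_mult intro!: AE_I2 mult_left_le_one_le \<phi>(2))
    have "norm (LINT t|lborel. of_real (\<phi> (exp (- t))) * g t) \<le> e * (LINT t|lborel. norm (g t))" if "e > 0" for e
    proof -
      have "continuous_on {0..1} \<phi>" using \<phi>(1) continuous_on_subset by blast
      \<comment> \<open>g lives on t > 0, where e^(-t) lies in (0,1]; uniform approximation on [0,1]
        is therefore enough.\<close>
      then obtain q where q: "real_polynomial_function q" "\<And>x. x \<in> {0..1} \<Longrightarrow> \<bar>\<phi> x - q x\<bar> < e"
        using Stone_Weierstrass_real_polynomial_function[of "{0..1}" \<phi> e] \<open>e > 0\<close> by auto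
      obtain a n where an: "q = (\<lambda>x. \<Sum>i\<le>n. a i * x ^ i)"
        using q(1) real_polynomial_function_iff_sum by auto
      have qi: "integrable lborel (\<lambda>t. of_real (q (exp (- t))) * g t)"
         "(LINT t|lborel. of_real (q (exp (- t))) * g t) = 0"
        using poly[of a n] unfolding an by auto
      have "(LINT t|lborel. of_real (\<phi> (exp (- t))) * g t) =
         (LINT t|lborel. of_real (\<phi> (exp (- t))) * g t - of_real (q (exp (- t))) * g t)"
        using int qi by simp
      also have "norm \<dots> \<le> (LINT t|lborel. e * norm (g t))"
      proof (rule Bochner_Integration.integral_norm_bound_integral)
        fix t
        show "norm (of_real (\<phi> (exp (- t))) * g t - of_real (q (exp (- t))) * g t) \<le> e * norm (g t)"
        proof (cases "t \<le> 0")
          case False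
          then have "\<bar>\<phi> (exp (- t)) - q (exp (- t))\<bar> < e" by (intro q) auto
          then have "norm (of_real (\<phi> (exp (- t)) - q (exp (- t))) * g t) \<le> e * norm (g t)"
            unfolding norm_mult norm_of_real by (intro mult_right_mono) auto
          then show ?thesis by (simp add: algebra_simps)
        qed (simp add: gneg)
      qed (use int qi g in auto)
      finally show ?thesis by simp
    qed
    then have "norm (LINT t|lborel. of_real (\<phi> (exp (- t))) * g t) \<le> 0"
    proof -
      assume *: "\<And>e. e > 0 \<Longrightarrow> norm (LINT t|lborel. of_real (\<phi> (exp (- t))) * g t) \<le> e * (LINT t|lborel. norm (g t))"
      have "((\<lambda>e. e * (LINT t|lborel. norm (g t))) \<longlongrightarrow> 0 * (LINT t|lborel. norm (g t))) (at_right 0)"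
        by (intro tendsto_intros)
      then show ?thesis
        using eventually_mono[OF eventually_at_right_less[of 0] *]
        by (intro tendsto_lowerbound[of _ "0::real" "at_right 0"]) auto
    qed
    then show ?thesis by simp
  qed
  have half: "set_lebesgue_integral lborel {..a} g = 0" for a
  proof (cases "a \<le> 0")
    case True
    then have "(\<lambda>t. indicator {..a} t *\<^sub>R g t) = (\<lambda>t. 0)"
      using gneg by (auto simp: indicator_def fun_eq_iff)
    then show ?thesis unfolding set_lebesgue_integral_def by simp
  next
    case False
    \<comment> \<open>Continuous ramps that equal 1 for x \<ge> e^(-a) and steepen with m; at x =
      e^(-t) they converge to the indicator of t \<le> a.\<close>
    define \<phi> where "\<phi> = (\<lambda>(m::nat) x. max 0 (min 1 (1 + real m * (x - exp (- a)))))"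
    have [measurable]: "\<phi> m \<in> borel_measurable borel" for m unfolding \<phi>_def by measurable
    have 0: "(LINT t|lborel. of_real (\<phi> m (exp (- t))) * g t) = 0" for m
      by (rule cont) (auto simp: \<phi>_def intro!: continuous_intros)
    have "(\<lambda>m. LINT t|lborel. of_real (\<phi> m (exp (- t))) * g t) \<longlonglongrightarrow> (LINT t|lborel. indicator {..a} t *\<^sub>R g t)"
    proof (rule integral_dominated_convergence[where w="\<lambda>t. norm (g t)"])
      show "AE t in lborel. (\<lambda>m. of_real (\<phi> m (exp (- t))) * g t) \<longlonglongrightarrow> indicator {..a} t *\<^sub>R g t"
      proof (intro AE_I2)
        fix t :: real
        have "(\<lambda>m. \<phi> m (exp (- t))) \<longlonglongrightarrow> indicator {..a} t"
        proof (cases "t \<le> a")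
          case True
          then have "\<phi> m (exp (- t)) = 1" for m unfolding \<phi>_def by auto
          then show ?thesis using True by simp
        next
          case False
          then have "exp (- a) - exp (- t) > 0" by simp
          then obtain N where N: "real N * (exp (- a) - exp (- t)) > 1"
            using reals_Archimedean3 by blast
          have "\<phi> m (exp (- t)) = 0" if "m \<ge> N" for m
          proof -
            have "real m * (exp (- a) - exp (- t)) \<ge> real N * (exp (- a) - exp (- t))"
              using that \<open>exp (- a) - exp (- t) > 0\<close> by (intro mult_right_mono) auto
            then have "1 + real m * (exp (- t) - exp (- a)) \<le> 0" using N by (simp add: algebra_simps)
            then show ?thesis unfolding \<phi>_def by (simp add: max_def min_def)
          qed
          then show ?thesis using False by (auto intro!: tendsto_eventually eventually_sequentiallyI)
        qed
        then have "(\<lambda>m. of_real (\<phi> m (exp (- t))) * g t) \<longlonglongrightarrow> of_real (indicator {..a} t) * g t"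
          by (intro tendsto_intros)
        then show "(\<lambda>m. of_real (\<phi> m (exp (- t))) * g t) \<longlonglongrightarrow> indicator {..a} t *\<^sub>R g t"
          by (simp add: scaleR_conv_of_real)
      qed
      show "AE t in lborel. norm (of_real (\<phi> m (exp (- t))) * g t) \<le> norm (g t)" for m
        unfolding norm_mult norm_of_real
        by (intro AE_I2 mult_left_le_one_le) (auto simp: \<phi>_def)
    qed (use g in auto)
    then show ?thesis unfolding set_lebesgue_integral_def 0 by (simp add: LIMSEQ_const_iff)
  qed
  have all: "set_lebesgue_integral lborel A g = 0" if "A \<in> sets lborel" for A
  proof -
    have gset: "set_integrable lborel A g" if "A \<in> sets borel" for A
      using g that unfolding set_integrable_def by (auto intro: integrable_mult_indicator)
    \<comment> \<open>Complements in the Dynkin argument need the integral over the whole line,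
      which is the moment k = 0.\<close>
    have whole: "set_lebesgue_integral lborel UNIV g = 0"
      using mono(2)[of 0] by (simp add: set_lebesgue_integral_def)
    have "A \<in> sigma_sets UNIV (range (\<lambda>a::real. {..a}))"
      using that by (simp add: borel_eq_atMost)
    have "Int_stable (range (\<lambda>a::real. {..a}))" by (auto simp: Int_stable_def)
    moreover have "range (\<lambda>a::real. {..a}) \<subseteq> Pow UNIV" by simp
    ultimately show ?thesis using \<open>A \<in> sigma_sets UNIV (range (\<lambda>a::real. {..a}))\<close>
    proof (induct rule: sigma_sets_induct_disjoint)
      case (basic A)
      then show ?case using half by auto
    next
      case empty
      then show ?case by (simp add: set_lebesgue_integral_def)
    next
      case (compl A)
      then have A: "A \<in> sets borel" by (simp add: borel_eq_atMost)
      have "set_lebesgue_integral lborel (A \<union> (UNIV - A)) g =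
         set_lebesgue_integral lborel A g + set_lebesgue_integral lborel (UNIV - A) g"
        using A by (intro set_integral_Un gset) auto
      then show ?case using compl whole by simp
    next
      case (union A)
      then have A: "A i \<in> sets borel" for i by (auto simp: borel_eq_atMost)
      have "set_lebesgue_integral lborel (\<Union>i. A i) g = (\<Sum>i. set_lebesgue_integral lborel (A i) g)"
        using A union(1) by (intro lebesgue_integral_countable_add gset) (auto simp: disjoint_family_on_def)
      then show ?case using union by simp
    qed
  qed
  have "AE t in lborel. g t = 0"
    using sigma_finite_measure.density_zero[OF sigma_finite_lborel g all] by simp
  then show ?thesis by (auto simp: g_def)
qed

section \<open>The kernel of a Bernstein symbol and a Volterra inequality\<close>

text \<open>The sign of the second derivative makes f concave. Writing z as a convex combination of
  a small e and l z and dropping the nonnegative term with f e gives (z-e)/(lz-e) f(lz) \<le> f(z);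
  then e tends to 0, which replaces a value of f at 0.\<close>

lemma bernstein_function_scale:
  assumes "bernstein_function f" "0 < z" "1 \<le> l"
  shows "f (l * z) \<le> l * f z"
proof (cases "l = 1")
  case False
  then have l: "1 < l" using assms by simp
  have nonneg: "\<And>x. x > 0 \<Longrightarrow> f x \<ge> 0"
    and diff: "\<And>m x. x > 0 \<Longrightarrow> (deriv ^^ m) f differentiable at x"
    and sgn: "\<And>m x. m \<ge> 1 \<Longrightarrow> x > 0 \<Longrightarrow> (-1) ^ (m - 1) * (deriv ^^ m) f x \<ge> 0"
    using assms(1) unfolding bernstein_function_def by auto
  have d1: "(f has_real_derivative deriv f x) (at x)" if "x > 0" for x
    using diff[of x 0] that by (simp add: DERIV_deriv_iff_real_differentiable)
  have d2: "(deriv f has_real_derivative deriv (deriv f) x) (at x)" if "x > 0" for x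
    using diff[of x 1] that by (simp add: DERIV_deriv_iff_real_differentiable)
  have "concave_on {0<..} f"
    by (rule f''_le0_imp_concave[OF _ d1 d2]) (use sgn[of 2] in \<open>auto simp: numeral_2_eq_2\<close>)
  then have conc: "f ((1 - t) * x + t * y) \<ge> (1 - t) * f x + t * f y"
    if "0 \<le> t" "t \<le> 1" "x > 0" "y > 0" for t x y
    using concave_onD[of "{0<..}" f t x y] that by auto
  have "(z - e) / (l * z - e) * f (l * z) \<le> f z" if e: "0 < e" "e < z" for e
  proof -
    define t where "t = (z - e) / (l * z - e)"
    have lz: "l * z > z" using l assms by simp
    have t: "0 \<le> t" "t \<le> 1" using e lz less_trans[OF e(2) lz] unfolding t_def by (auto simp: divide_le_eq_1 zero_le_divide_iff)
    have "(1 - t) * e + t * (l * z) = e + t * (l * z - e)" by (simp add: algebra_simps)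
    also have "\<dots> = z" using e lz by (simp add: t_def less_imp_neq[OF less_trans[OF e(2) lz], symmetric])
    finally have "f z \<ge> (1 - t) * f e + t * f (l * z)"
      using conc[of t e "l * z"] t e lz less_trans[OF assms(2) lz] by simp
    moreover have "(1 - t) * f e \<ge> 0" using t nonneg e by simp
    ultimately show ?thesis unfolding t_def by linarith
  qed
  then have "eventually (\<lambda>e. (z - e) / (l * z - e) * f (l * z) \<le> f z) (at_right 0)"
    by (intro eventually_mono[OF eventually_at_right_real[OF \<open>0 < z\<close>]]) auto
  moreover have "((\<lambda>e. (z - e) / (l * z - e) * f (l * z)) \<longlongrightarrow> (z - 0) / (l * z - 0) * f (l * z)) (at_right 0)"
    using assms l by (intro tendsto_intros) auto
  ultimately have "(z - 0) / (l * z - 0) * f (l * z) \<le> f z"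
    by (intro tendsto_upperbound) auto
  then show ?thesis using l assms by (simp add: field_simps)
qed simp

text \<open>\<open>f_scale\<close> says that f(z)/z is nonincreasing. The instance in view is f =
  1/Psi on the positive axis with \<kappa> the total mass of \<open>Y\<close>; the indicator
  confines the transform to t > 0.\<close>

locale laplace_kernel =
  fixes \<kappa> f :: "real \<Rightarrow> real"
  assumes meas[measurable]: "\<kappa> \<in> borel_measurable borel"
    and nonneg: "0 \<le> \<kappa> t"
    and laplace_\<kappa>: "0 < z \<Longrightarrow> has_bochner_integral lborel (\<lambda>t. exp (- z * t) * (indicator {0<..} t * \<kappa> t)) (1 / f z)"
    and f_pos: "0 < z \<Longrightarrow> 0 < f z"
    and f_scale: "0 < z \<Longrightarrow> 1 \<le> l \<Longrightarrow> f (l * z) \<le> l * f z"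
begin

lemma integrable_exp: "0 < z \<Longrightarrow> integrable lborel (\<lambda>t. exp (- z * t) * (indicator {0<..} t * \<kappa> t))"
  and integral_exp: "0 < z \<Longrightarrow> (LINT t|lborel. exp (- z * t) * (indicator {0<..} t * \<kappa> t)) = 1 / f z"
  using laplace_\<kappa> by (auto simp: has_bochner_integral_iff)

lemma set_integrable_Ioc: "set_integrable lborel {0<..t} \<kappa>"
proof -
  have "integrable lborel (\<lambda>s. exp t * (exp (- 1 * s) * (indicator {0<..} s * \<kappa> s)))"
    by (intro integrable_mult_right integrable_exp) simp
  moreover have "norm (indicator {0<..t} s *\<^sub>R \<kappa> s) \<le> norm (exp t * (exp (- 1 * s) * (indicator {0<..} s * \<kappa> s)))" for s
  proof (cases "s \<in> {0<..t}")
    case True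
    then have "1 * \<kappa> s \<le> exp (t - s) * \<kappa> s" by (intro mult_right_mono nonneg) simp
    then show ?thesis using True nonneg[of s] by (simp add: exp_diff exp_minus field_simps)
  qed simp
  ultimately show ?thesis unfolding set_integrable_def
    by (intro Bochner_Integration.integrable_bound[OF \<open>integrable lborel (\<lambda>s. exp t * (exp (- 1 * s) * (indicator {0<..} s * \<kappa> s)))\<close>])
       (auto intro!: AE_I2)
qed

lemma K_mono: "s \<le> t \<Longrightarrow> K \<kappa> s \<le> K \<kappa> t"
  unfolding K_def set_lebesgue_integral_def
  using set_integrable_Ioc[unfolded set_integrable_def]
  by (intro integral_mono) (auto simp: nonneg indicator_def)

text \<open>On (0,t] one has 1 \<le> e^(1-s/t), so K is at most e times the transform at
  1/t.\<close>

lemma K_upper: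
  assumes "0 < t"
  shows "K \<kappa> t \<le> exp 1 / f (1 / t)"
proof -
  have "K \<kappa> t \<le> (LINT s|lborel. exp 1 * (exp (- (1/t) * s) * (indicator {0<..} s * \<kappa> s)))"
    unfolding K_def set_lebesgue_integral_def
  proof (rule integral_mono)
    fix s
    show "indicator {0<..t} s *\<^sub>R \<kappa> s \<le> exp 1 * (exp (- (1 / t) * s) * (indicator {0<..} s * \<kappa> s))"
    proof (cases "s \<in> {0<..t}")
      case True
      then have "1 * \<kappa> s \<le> exp (1 - s / t) * \<kappa> s" using assms by (intro mult_right_mono nonneg) simp
      then show ?thesis using True by (simp add: exp_diff exp_minus field_simps)
    qed (simp add: nonneg)
  qed (use set_integrable_Ioc integrable_exp[of "1/t"] assms in \<open>auto simp: set_integrable_def\<close>)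
  also have "\<dots> = exp 1 / f (1 / t)" using assms integral_exp[of "1/t"] by simp
  finally show ?thesis .
qed

text \<open>The weight e^(-zs) - e^(-2) e^(-zs/2) is at most 1 and changes sign exactly at s = 4/z =
  t, so it lies below the indicator of (0,t] on s > 0. Its integral against \<kappa> is 1/f(z) -
  e^(-2)/f(z/2). Here 1/f(z/2) \<le> 2/f(z) and e^(-2) \<le> 1/4 leave half of 1/f(z), and f(4/t)
  \<le> 4 f(1/t) gives the 8.\<close>

lemma K_lower:
  assumes "0 < t"
  shows "1 / (8 * f (1 / t)) \<le> K \<kappa> t"
proof -
  define z where "z = 4 / t"
  have z: "0 < z" using assms by (simp add: z_def)
  have i: "integrable lborel (\<lambda>s. exp (- z * s) * (indicator {0<..} s * \<kappa> s))"
    "integrable lborel (\<lambda>s. exp (- (z/2) * s) * (indicator {0<..} s * \<kappa> s))"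
    using integrable_exp[of z] integrable_exp[of "z/2"] z by auto
  have "1 / f z - exp (-2) * (1 / f (z / 2)) =
    (LINT s|lborel. exp (- z * s) * (indicator {0<..} s * \<kappa> s) -
       exp (- 2) * (exp (- (z/2) * s) * (indicator {0<..} s * \<kappa> s)))"
    by (subst Bochner_Integration.integral_diff) (use i integral_exp[of z] integral_exp[of "z/2"] z in auto)
  also have "\<dots> \<le> K \<kappa> t"
    unfolding K_def set_lebesgue_integral_def
  proof (rule integral_mono)
    fix s
    show "exp (- z * s) * (indicator {0<..} s * \<kappa> s) -
       exp (- 2) * (exp (- (z/2) * s) * (indicator {0<..} s * \<kappa> s)) \<le> indicator {0<..t} s *\<^sub>R \<kappa> s"
    proof (cases "0 < s")
      case True
      show ?thesis
      proof (cases "s \<le> t")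
        case True
        have "exp (- z * s) * \<kappa> s \<le> 1 * \<kappa> s"
          using \<open>0 < s\<close> z by (intro mult_right_mono nonneg) auto
        moreover have "0 \<le> exp (- 2) * (exp (- (z/2) * s) * \<kappa> s)" using nonneg by simp
        ultimately have "exp (- z * s) * \<kappa> s - exp (- 2) * (exp (- (z/2) * s) * \<kappa> s) \<le> \<kappa> s"
          by linarith
        then show ?thesis using True \<open>0 < s\<close> by simp
      next
        case False
        have "2 \<le> z / 2 * s" using False assms by (simp add: z_def field_simps)
        then have "exp (- z * s) \<le> exp (- 2 + - (z/2) * s)" by simp
        then have "exp (- z * s) * \<kappa> s \<le> (exp (- 2) * exp (- (z/2) * s)) * \<kappa> s"
          unfolding exp_add by (intro mult_right_mono nonneg)
        then show ?thesis using False \<open>0 < s\<close> by (simp add: mult.assoc)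
      qed
    qed simp
  qed (use i set_integrable_Ioc in \<open>auto simp: set_integrable_def\<close>)
  finally have *: "1 / f z - exp (-2) * (1 / f (z / 2)) \<le> K \<kappa> t" .
  have e: "exp (-2) \<le> (1/4 :: real)"
  proof -
    have "(2::real) \<le> exp 1" using exp_ge_add_one_self[of 1] by simp
    then have "(2::real) * 2 \<le> exp 1 * exp 1" by (intro mult_mono) auto
    then have "(4::real) \<le> exp 2" by (simp add: exp_add[symmetric])
    then show ?thesis by (simp add: exp_minus field_simps)
  qed
  have fz: "0 < f z" "0 < f (z/2)" "0 < f (1/t)" using f_pos z assms by auto
  have "f z \<le> 2 * f (z/2)" using f_scale[of "z/2" 2] z by simp
  then have 1: "1 / f (z/2) \<le> 2 / f z" using fz by (simp add: field_simps)
  have "f z \<le> 4 * f (1/t)" using f_scale[of "1/t" 4] assms by (simp add: z_def)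
  then have 2: "1 / (4 * f (1/t)) \<le> 1 / f z" using fz by (simp add: field_simps)
  have "exp (-2) * (1 / f (z/2)) \<le> 1/4 * (2 / f z)"
    using e 1 fz by (intro mult_mono) auto
  then have "1 / f z / 2 \<le> K \<kappa> t" using * by simp
  then show ?thesis using 2 by simp
qed

text \<open>Linear lower scaling, as for a concave K but with the loss 1/(8e), obtained without any
  monotonicity of \<kappa>: both bounds are chained through f(1/(rt)) \<le> f(1/t)/r.\<close>

lemma K_scale:
  assumes t: "0 < t" and r: "0 < r" "r \<le> 1"
  shows "r / (8 * exp 1) * K \<kappa> t \<le> K \<kappa> (r * t)"
proof -
  have f: "0 < f (1 / t)" "0 < f (1 / (r * t))" using f_pos t r by auto
  have "f (1 / (r * t)) \<le> (1 / r) * f (1 / t)"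
    using f_scale[of "1/t" "1/r"] t r by simp
  then have "r / (8 * f (1 / t)) \<le> 1 / (8 * f (1 / (r * t)))" using f r by (simp add: field_simps)
  also have "\<dots> \<le> K \<kappa> (r * t)" using K_lower t r by simp
  finally have "r / (8 * f (1/t)) \<le> K \<kappa> (r * t)" .
  moreover have "r / (8 * exp 1) * K \<kappa> t \<le> r / (8 * exp 1) * (exp 1 / f (1 / t))"
    using K_upper[OF t] r by (intro mult_left_mono) auto
  ultimately show ?thesis by simp
qed

end

section \<open>Finite-time blow-up under a superlinear Volterra inequality\<close>

text \<open>By continuity a violation would persist on an open interval, which has positive measure.
  It serves to upgrade the Volterra inequality, known for almost every time only, to all times
  including the endpoints.\<close>

lemma AE_lower_bound_continuous:
  fixes w :: "real \<Rightarrow> real"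
  assumes cont: "continuous_on {a..b} w" and "a < b"
    and ae: "AE t in lborel. t \<in> {a<..<b} \<longrightarrow> m \<le> w t"
    and t: "t \<in> {a..b}"
  shows "m \<le> w t"
proof (rule ccontr)
  assume "\<not> m \<le> w t"
  then have less: "w t < m" by simp
  then obtain d where d: "d > 0" "\<And>s. s \<in> {a..b} \<Longrightarrow> dist s t < d \<Longrightarrow> dist (w s) (w t) < m - w t"
    using cont t unfolding continuous_on_iff by (metis diff_gt_0_iff_gt)
  define l where "l = max a (t - d)"
  define r where "r = min b (t + d)"
  have lr: "l < r" using t d \<open>a < b\<close> by (auto simp: l_def r_def)
  have "w s < m" if "s \<in> {l<..<r}" for s
  proof -
    have "dist (w s) (w t) < m - w t"
      using that by (intro d(2)) (auto simp: l_def r_def dist_real_def)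
    then show ?thesis by (auto simp: dist_real_def)
  qed
  moreover have "{l<..<r} \<subseteq> {a<..<b}" by (auto simp: l_def r_def)
  ultimately have "AE s in lborel. s \<notin> {l<..<r}" using ae by (elim eventually_mono) (force simp: not_less)
  then have "emeasure lborel {l<..<r} = 0"
    by (intro AE_iff_measurable[THEN iffD1, of "{l<..<r}" lborel "\<lambda>s. s \<notin> {l<..<r}"]) auto
  then show False using lr by simp
qed

text \<open>On \<open>[T (1 - q^j), T]\<close> with \<open>q = 2 powr (1 - p)\<close> the lower bound is at least \<open>2^j a\<close>: one more step of
  length \<open>(1 - q) q^j T\<close> doubles it as soon as \<open>K T\<close> exceeds the stated bound.\<close>
lemma volterra_blowup:
  fixes \<kappa> w F :: "real \<Rightarrow> real"
  assumes \<kappa>[measurable]: "\<kappa> \<in> borel_measurable borel" and \<kappa>_nonneg: "\<And>t. 0 \<le> \<kappa> t"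
    and \<kappa>_int: "\<And>t. set_integrable lborel {0<..t} \<kappa>"
    and T: "0 < T" and a: "0 < a" and p: "1 < p" and \<beta>: "0 < \<beta>" and c: "0 < c"
    and w: "continuous_on {0..T} w" "a \<le> w 0"
    and F: "continuous_on UNIV F" "\<And>x. a / 2 \<le> x \<Longrightarrow> \<beta> * x powr p \<le> F x"
    and ineq: "AE t in lborel. t \<in> {0<..<T} \<longrightarrow> a + (LINT s:{0<..<t}|lborel. \<kappa> (t - s) * F (w s)) \<le> w t"
    and scale: "\<And>r. 0 < r \<Longrightarrow> r \<le> 1 \<Longrightarrow> c * r * K \<kappa> T \<le> K \<kappa> (r * T)"
  shows "K \<kappa> T < 2 / (c * (1 - 2 powr (1 - p))) * (a powr (1 - p) / \<beta>)"
proof (rule ccontr)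
  assume big: "\<not> ?thesis"
  have Fnonneg: "0 \<le> F x" if "a / 2 \<le> x" for x
    using F(2)[OF that] \<beta> by (smt (verit) mult_nonneg_nonneg powr_ge_zero)
  have [measurable]: "F \<in> borel_measurable borel" using F(1) by (rule borel_measurable_continuous_onI)
  have wind: "(\<lambda>s. indicator {0..T} s *\<^sub>R w s) \<in> borel_measurable borel"
    using borel_measurable_continuous_on_indicator[OF _ w(1)] by simp
  \<comment> \<open>The reflection s to t - s turns K(t - \<tau>) into the weight that the memory at
    time t gives to the window from \<tau> to t.\<close>
  have K_alt: "K \<kappa> (t - \<tau>) = (LINT s|lborel. indicator {\<tau>..<t} s * \<kappa> (t - s))" for t \<tau>
  proof -
    have "(LINT s|lborel. indicator {0<..t - \<tau>} s * \<kappa> s) =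
      (LINT s|lborel. indicator {0<..t - \<tau>} (t - s) * \<kappa> (t - s))"
      using lborel_integral_real_affine[of "-1" "\<lambda>s. indicator {0<..t - \<tau>} s * \<kappa> s" t] by simp
    also have "(\<lambda>s. indicator {0<..t - \<tau>} (t - s) * \<kappa> (t - s)) = (\<lambda>s. indicator {\<tau>..<t} s * \<kappa> (t - s))"
      by (auto simp: indicator_def fun_eq_iff)
    finally show ?thesis by (simp add: K_def set_lebesgue_integral_def)
  qed
  have int_alt: "integrable lborel (\<lambda>s. indicator {\<tau>..<t} s * \<kappa> (t - s))" for t \<tau>
  proof -
    have "integrable lborel (\<lambda>s. indicator {0<..t - \<tau>} (t + (-1) * s) * \<kappa> (t + (-1) * s))"
      using \<kappa>_int[of "t - \<tau>"] by (intro lborel_integrable_real_affine) (auto simp: set_integrable_def)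
    also have "(\<lambda>s. indicator {0<..t - \<tau>} (t + (-1) * s) * \<kappa> (t + (-1) * s)) = (\<lambda>s. indicator {\<tau>..<t} s * \<kappa> (t - s))"
      by (auto simp: indicator_def fun_eq_iff)
    finally show ?thesis .
  qed
  \<comment> \<open>Times before \<tau> contribute a nonnegative amount since w is at least a/2
    there, and on the window F(w s) is at least \<beta> m^p.\<close>
  have lower: "\<beta> * m powr p * K \<kappa> (t - \<tau>) \<le> (LINT s:{0<..<t}|lborel. \<kappa> (t - s) * F (w s))"
    if t: "0 \<le> \<tau>" "\<tau> \<le> t" "t \<le> T" "\<And>s. s \<in> {0<..<t} \<Longrightarrow> a / 2 \<le> w s" "\<And>s. s \<in> {\<tau>..<t} \<Longrightarrow> m \<le> w s"
      and m: "0 \<le> m" for m t \<tau>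
  proof -
    have "compact ((\<lambda>s. F (w s)) ` {0..T})"
      by (intro compact_continuous_image continuous_on_compose2[OF F(1) w(1)]) auto
    then have "bounded ((\<lambda>s. F (w s)) ` {0..T})" by (rule compact_imp_bounded)
    then obtain M where "\<forall>x\<in>(\<lambda>s. F (w s)) ` {0..T}. norm x \<le> M"
      unfolding bounded_iff by blast
    then have M: "\<And>s. s \<in> {0..T} \<Longrightarrow> \<bar>F (w s)\<bar> \<le> M" by auto
    have "\<beta> * m powr p * K \<kappa> (t - \<tau>) = (LINT s|lborel. \<beta> * m powr p * (indicator {\<tau>..<t} s * \<kappa> (t - s)))"
      unfolding K_alt by simp
    also have "\<dots> \<le> (LINT s|lborel. indicator {0<..<t} s *\<^sub>R (\<kappa> (t - s) * F (w s)))"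
    proof (rule integral_mono_AE)
      show "integrable lborel (\<lambda>s. \<beta> * m powr p * (indicator {\<tau>..<t} s * \<kappa> (t - s)))"
        using int_alt by simp
      have "integrable lborel (\<lambda>s. M * (indicator {0..<t} s * \<kappa> (t - s)))" using int_alt by simp
      moreover have "(\<lambda>s. indicator {0<..<t} s *\<^sub>R (\<kappa> (t - s) * F (indicator {0..T} s *\<^sub>R w s))) \<in> borel_measurable borel"
        using wind by measurable
      moreover have "(\<lambda>s. indicator {0<..<t} s *\<^sub>R (\<kappa> (t - s) * F (indicator {0..T} s *\<^sub>R w s))) =
        (\<lambda>s. indicator {0<..<t} s *\<^sub>R (\<kappa> (t - s) * F (w s)))"
        using t by (auto simp: indicator_def fun_eq_iff)
      moreover have "norm (indicator {0<..<t} s *\<^sub>R (\<kappa> (t - s) * F (w s))) \<le> norm (M * (indicator {0..<t} s * \<kappa> (t - s)))" for s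
      proof (cases "s \<in> {0<..<t}")
        case True
        then have "\<kappa> (t - s) * \<bar>F (w s)\<bar> \<le> \<kappa> (t - s) * M"
          using t by (intro mult_left_mono M \<kappa>_nonneg) auto
        moreover have "0 \<le> M" using M[of s] True t by (auto simp: abs_le_iff intro: order_trans[OF abs_ge_zero])
        ultimately show ?thesis using True \<kappa>_nonneg by (simp add: abs_mult mult_ac)
      qed simp
      ultimately show "integrable lborel (\<lambda>s. indicator {0<..<t} s *\<^sub>R (\<kappa> (t - s) * F (w s)))"
        by (intro Bochner_Integration.integrable_bound[OF \<open>integrable lborel (\<lambda>s. M * (indicator {0..<t} s * \<kappa> (t - s)))\<close>])
           (auto intro!: AE_I2)
      \<comment> \<open>For \<tau> = 0 the window contains s = 0, where the a/2 bound is not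
        assumed; one point is negligible.\<close>
      have "AE s in lborel. s \<noteq> (0::real)" by (rule AE_lborel_singleton)
      then show "AE s in lborel. \<beta> * m powr p * (indicator {\<tau>..<t} s * \<kappa> (t - s)) \<le> indicator {0<..<t} s *\<^sub>R (\<kappa> (t - s) * F (w s))"
      proof eventually_elim
        fix s :: real assume "s \<noteq> 0"
        show "\<beta> * m powr p * (indicator {\<tau>..<t} s * \<kappa> (t - s)) \<le> indicator {0<..<t} s *\<^sub>R (\<kappa> (t - s) * F (w s))"
        proof (cases "s \<in> {\<tau>..<t}")
          case True
          then have s: "s \<in> {0<..<t}" using t \<open>s \<noteq> 0\<close> by auto
          have "m powr p \<le> w s powr p" using t(5)[OF True] m p by (intro powr_mono2) auto
          then have "\<beta> * m powr p \<le> F (w s)" using F(2)[OF t(4)[OF s]] \<beta>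
            by (smt (verit) mult_left_mono)
          then have "\<beta> * m powr p * \<kappa> (t - s) \<le> F (w s) * \<kappa> (t - s)" by (intro mult_right_mono \<kappa>_nonneg)
          then show ?thesis using True s by (simp add: mult_ac)
        next
          case False
          then show ?thesis using Fnonneg[OF t(4)] \<kappa>_nonneg by (auto simp: indicator_def)
        qed
      qed
    qed
    finally show ?thesis unfolding set_lebesgue_integral_def .
  qed
  \<comment> \<open>As long as w stays above a/2 the memory integral is nonnegative, so w is in fact
    at least a. This gap between a/2 and a closes the continuity argument in
    \<open>half\<close>.\<close>
  have step1: "a \<le> w s" if t: "0 < t" "t \<le> T" "\<And>s. s \<in> {0<..<t} \<Longrightarrow> a / 2 \<le> w s" "s \<in> {0..t}" for t s
  proof (rule AE_lower_bound_continuous[where w = w and a = 0 and b = t and t = s])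
    show "continuous_on {0..t} w" using w(1) t by (auto intro: continuous_on_subset)
    show "AE s in lborel. s \<in> {0<..<t} \<longrightarrow> a \<le> w s"
      using ineq
    proof eventually_elim
      fix s assume *: "s \<in> {0<..<T} \<longrightarrow> a + (LINT r:{0<..<s}|lborel. \<kappa> (s - r) * F (w r)) \<le> w s"
      show "s \<in> {0<..<t} \<longrightarrow> a \<le> w s"
      proof
        assume s: "s \<in> {0<..<t}"
        \<comment> \<open>An empty window and the level 0 reduce \<open>lower\<close> to
          nonnegativity of the memory integral.\<close>
        have "\<beta> * 0 powr p * K \<kappa> (s - s) \<le> (LINT r:{0<..<s}|lborel. \<kappa> (s - r) * F (w r))"
          using s t by (intro lower) auto
        then show "a \<le> w s" using * s t by auto
      qed
    qed
  qed (use t in auto)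
  \<comment> \<open>At the first time t0 with w \<le> a/2, \<open>step1\<close> applied up to t0
    already forces w t0 \<ge> a.\<close>
  have half: "a / 2 < w t" if "t \<in> {0..T}" for t
  proof (rule ccontr)
    assume "\<not> a / 2 < w t"
    define S where "S = {0..T} \<inter> w -` {..a/2}"
    have "compact S" unfolding S_def
      using continuous_closed_preimage[OF w(1), of "{..a/2}"] by (simp add: compact_eq_bounded_closed bounded_Int)
    moreover have "t \<in> S" using that \<open>\<not> a / 2 < w t\<close> by (auto simp: S_def)
    ultimately obtain t0 where t0: "t0 \<in> S" "\<And>s. s \<in> S \<Longrightarrow> t0 \<le> s"
      using compact_attains_inf[of S] by blast
    have "t0 \<noteq> 0" using t0(1) w(2) a by (auto simp: S_def)
    then have "0 < t0" "t0 \<le> T" using t0 by (auto simp: S_def)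
    moreover have "a / 2 \<le> w s" if "s \<in> {0<..<t0}" for s
      using t0(2)[of s] that \<open>t0 \<le> T\<close> by (force simp: S_def)
    ultimately have "a \<le> w t0" using step1[of t0 t0] by auto
    then show False using t0(1) a by (auto simp: S_def)
  qed
  \<comment> \<open>This ratio solves 2^(jp) q^j = 2^j: the p-th power of the level compensates
    exactly for windows that shrink like q^j. The window lengths (1 - q) q^j T add up to T.\<close>
  define q where "q = (2::real) powr (1 - p)"
  have q: "0 < q" "q < 1" using p by (auto simp: q_def powr_less_one)
  define \<tau> where "\<tau> = (\<lambda>j::nat. T * (1 - q ^ j))"
  have KT: "2 / (c * (1 - q)) * (a powr (1 - p) / \<beta>) \<le> K \<kappa> T" using big by (simp add: q_def)
  have grow: "\<forall>t\<in>{\<tau> j..T}. a * 2 ^ j \<le> w t" for j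
  proof (induction j)
    case 0
    then show ?case using step1[of T] half T by (auto simp: \<tau>_def less_imp_le)
  next
    case (Suc j)
    have \<tau>: "\<tau> (Suc j) - \<tau> j = ((1 - q) * q ^ j) * T" by (simp add: \<tau>_def algebra_simps)
    have qj: "0 < q ^ j" "q ^ j \<le> 1" "0 < q * q ^ j" using q by (auto intro: power_le_one)
    then have \<tau>0: "0 \<le> \<tau> j" "\<tau> j \<le> \<tau> (Suc j)" "\<tau> (Suc j) < T" using \<tau> q T by (auto simp: \<tau>_def)
    have r: "0 < (1 - q) * q ^ j" "(1 - q) * q ^ j \<le> 1" using q qj by (auto intro: mult_le_one)
    \<comment> \<open>Inserting the assumed lower bound of K T, with \<open>scale\<close> for r = (1
      - q) q^j, makes all constants cancel: the gain over one window is at least a 2^(j+1), so the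
      factor 2 in the bound is the doubling factor.\<close>
    have key: "a * 2 ^ Suc j \<le> \<beta> * (a * 2 ^ j) powr p * K \<kappa> (\<tau> (Suc j) - \<tau> j)"
    proof -
      have "q ^ j = 2 powr (real j * (1 - p))" by (simp add: q_def powr_powr powr_realpow[symmetric] mult.commute)
      moreover have "((2::real) ^ j) powr p = 2 powr (real j * p)" by (simp add: powr_powr powr_realpow[symmetric])
      ultimately have "((2::real) ^ j) powr p * q ^ j = 2 ^ j"
        by (simp add: powr_add[symmetric] powr_realpow[symmetric] algebra_simps)
      moreover have "a powr p * a powr (1 - p) = a" using a by (simp add: powr_add[symmetric])
      moreover have "\<beta> * (a * 2 ^ j) powr p * (c * (r * q ^ j) * (2 / (c * r) * (a powr (1 - p) / \<beta>)))
          = 2 * (a powr p * a powr (1 - p)) * ((2 ^ j) powr p * q ^ j)" if "r \<noteq> 0" for r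
        using that a \<beta> c by (simp add: powr_mult)
      ultimately have *: "\<beta> * (a * 2 ^ j) powr p * (c * ((1 - q) * q ^ j) * (2 / (c * (1 - q)) * (a powr (1 - p) / \<beta>))) = a * 2 ^ Suc j"
        using q by simp
      have "c * ((1 - q) * q ^ j) * (2 / (c * (1 - q)) * (a powr (1 - p) / \<beta>)) \<le> c * ((1 - q) * q ^ j) * K \<kappa> T"
        using KT r c by (intro mult_left_mono) auto
      also have "\<dots> \<le> K \<kappa> (\<tau> (Suc j) - \<tau> j)" unfolding \<tau> by (rule scale[OF r])
      finally have "\<beta> * (a * 2 ^ j) powr p * (c * ((1 - q) * q ^ j) * (2 / (c * (1 - q)) * (a powr (1 - p) / \<beta>)))
        \<le> \<beta> * (a * 2 ^ j) powr p * K \<kappa> (\<tau> (Suc j) - \<tau> j)"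
        using \<beta> by (intro mult_left_mono) auto
      then show ?thesis unfolding * .
    qed
    show ?case
    proof
      fix t assume t: "t \<in> {\<tau> (Suc j)..T}"
      show "a * 2 ^ Suc j \<le> w t"
      proof (rule AE_lower_bound_continuous[where w = w, OF _ \<open>\<tau> (Suc j) < T\<close> _ t])
        show "continuous_on {\<tau> (Suc j)..T} w" using w(1) \<tau>0 by (auto intro: continuous_on_subset)
        show "AE t in lborel. t \<in> {\<tau> (Suc j)<..<T} \<longrightarrow> a * 2 ^ Suc j \<le> w t"
          using ineq
        proof eventually_elim
          fix t assume *: "t \<in> {0<..<T} \<longrightarrow> a + (LINT s:{0<..<t}|lborel. \<kappa> (t - s) * F (w s)) \<le> w t"
          show "t \<in> {\<tau> (Suc j)<..<T} \<longrightarrow> a * 2 ^ Suc j \<le> w t"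
          proof
            assume t: "t \<in> {\<tau> (Suc j)<..<T}"
            \<comment> \<open>Beyond \<open>\<tau> (Suc j)\<close> the window from
              \<open>\<tau> j\<close> to t, where the level a 2^j is known, is at least one step
              long.\<close>
            have "K \<kappa> (\<tau> (Suc j) - \<tau> j) \<le> K \<kappa> (t - \<tau> j)"
              unfolding K_def set_lebesgue_integral_def
              using \<kappa>_int t by (intro integral_mono) (auto simp: set_integrable_def indicator_def \<kappa>_nonneg)
            then have "a * 2 ^ Suc j \<le> \<beta> * (a * 2 ^ j) powr p * K \<kappa> (t - \<tau> j)"
              using key \<beta> by (smt (verit) mult_left_mono mult_nonneg_nonneg powr_ge_zero)
            also have "\<dots> \<le> (LINT s:{0<..<t}|lborel. \<kappa> (t - s) * F (w s))"
              using t \<tau>0 Suc.IH a half by (intro lower) (auto intro: less_imp_le)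
            also have "\<dots> \<le> w t" using * t \<tau>0 a by auto
            finally show "a * 2 ^ Suc j \<le> w t" .
          qed
        qed
      qed
    qed
  qed
  \<comment> \<open>The endpoint T belongs to every window, so the finite number w T would exceed
    all levels.\<close>
  have "a * 2 ^ j \<le> w T" for j
  proof -
    have "0 \<le> q ^ j" using q by simp
    then have "\<tau> j \<le> T" using T by (simp add: \<tau>_def mult_le_cancel_left1 algebra_simps)
    then show ?thesis using grow[of j] by auto
  qed
  moreover obtain j where "w T / a < 2 ^ j" using real_arch_pow[of 2 "w T / a"] by auto
  ultimately show False using a by (smt (verit) divide_less_eq mult.commute)
qed

section \<open>Gaussian measures\<close>

lemma borel_measurable_cis [measurable]: "cis \<in> borel_measurable borel"
  by (intro borel_measurable_continuous_onI continuous_intros)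

text \<open>Boundary term for the primitive differentiated next. With y = x^2/2 its modulus is at
  most (1 + |t|)(1 + 2y) e^(-y).\<close>

lemma gaussian_decay:
  fixes t :: real
  assumes F: "F = at_top \<or> F = at_bot"
  shows "((\<lambda>x::real. (of_real x + \<i> * of_real t) * (of_real (exp (- x\<^sup>2 / 2)) * cis (t * x))) \<longlongrightarrow> 0) F"
proof (rule Lim_null_comparison)
  have sq: "filterlim (\<lambda>x::real. x\<^sup>2 / 2) at_top F"
  proof -
    have "filterlim (\<lambda>x::real. x\<^sup>2) at_top F"
      using F by (auto intro: filterlim_pow_at_top filterlim_ident filterlim_pow_at_bot_even)
    then have "filterlim (\<lambda>x::real. (1/2) * x\<^sup>2) at_top F"
      by (intro filterlim_tendsto_pos_mult_at_top[OF tendsto_const]) auto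
    then show ?thesis by simp
  qed
  have "((\<lambda>y::real. (1 + \<bar>t\<bar>) * (1 * (y ^ 0 / exp y) + 2 * (y ^ 1 / exp y))) \<longlongrightarrow> (1 + \<bar>t\<bar>) * (1 * 0 + 2 * 0)) at_top"
    by (intro tendsto_intros tendsto_power_div_exp_0)
  from filterlim_compose[OF this sq]
  show "((\<lambda>x. (1 + \<bar>t\<bar>) * (1 * ((x\<^sup>2 / 2) ^ 0 / exp (x\<^sup>2 / 2)) + 2 * ((x\<^sup>2 / 2) ^ 1 / exp (x\<^sup>2 / 2)))) \<longlongrightarrow> 0) F"
    by simp
  show "\<forall>\<^sub>F x in F. norm ((of_real x + \<i> * of_real t) * (of_real (exp (- x\<^sup>2 / 2)) * cis (t * x)))
    \<le> (1 + \<bar>t\<bar>) * (1 * ((x\<^sup>2 / 2) ^ 0 / exp (x\<^sup>2 / 2)) + 2 * ((x\<^sup>2 / 2) ^ 1 / exp (x\<^sup>2 / 2)))"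
  proof (intro always_eventually allI)
    fix x :: real
    have "norm (of_real x + \<i> * of_real t) \<le> \<bar>x\<bar> + \<bar>t\<bar>"
      by (rule order_trans[OF norm_triangle_ineq]) (simp add: norm_mult)
    also have "\<dots> \<le> (1 + \<bar>t\<bar>) * (1 + x\<^sup>2)"
    proof -
      have "0 \<le> (\<bar>x\<bar> - 1)\<^sup>2" by simp
      then have "2 * \<bar>x\<bar> \<le> 1 + x\<^sup>2" by (simp add: power2_eq_square algebra_simps)
        then have "\<bar>x\<bar> \<le> 1 + x\<^sup>2" by linarith
      moreover have "\<bar>t\<bar> * 1 \<le> \<bar>t\<bar> * (1 + x\<^sup>2)" by (intro mult_left_mono) auto
      ultimately have "\<bar>x\<bar> + \<bar>t\<bar> * 1 \<le> (1 + x\<^sup>2) + \<bar>t\<bar> * (1 + x\<^sup>2)" by (rule add_mono)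
      then show ?thesis by (simp only: distrib_right mult_1_left mult_1_right)
    qed
    finally have "norm (of_real x + \<i> * of_real t) * exp (- x\<^sup>2 / 2) \<le> (1 + \<bar>t\<bar>) * (1 + x\<^sup>2) * exp (- x\<^sup>2 / 2)"
      by (intro mult_right_mono) auto
    also have "\<dots> = (1 + \<bar>t\<bar>) * (1 * ((x\<^sup>2 / 2) ^ 0 / exp (x\<^sup>2 / 2)) + 2 * ((x\<^sup>2 / 2) ^ 1 / exp (x\<^sup>2 / 2)))"
      by (simp add: exp_minus field_simps)
    finally show "norm ((of_real x + \<i> * of_real t) * (of_real (exp (- x\<^sup>2 / 2)) * cis (t * x)))
    \<le> (1 + \<bar>t\<bar>) * (1 * ((x\<^sup>2 / 2) ^ 0 / exp (x\<^sup>2 / 2)) + 2 * ((x\<^sup>2 / 2) ^ 1 / exp (x\<^sup>2 / 2)))"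
      by (simp add: norm_mult)
  qed
qed

text \<open>Since (x + it)(it - x) = -t^2 - x^2, the factor x + it removes the mixed term from the
  derivative and leaves a real polynomial.\<close>

lemma has_vector_derivative_gaussian_cis:
  "((\<lambda>x. (of_real x + \<i> * of_real t) * (of_real (exp (- x\<^sup>2 / 2)) * cis (t * x))) has_vector_derivative
     of_real (1 - t\<^sup>2 - x\<^sup>2) * (of_real (exp (- x\<^sup>2 / 2)) * cis (t * x))) (at x)"
proof -
  have "((\<lambda>x. Re ((of_real x + \<i> * of_real t) * (of_real (exp (- x\<^sup>2 / 2)) * cis (t * x)))) has_field_derivative
      Re (of_real (1 - t\<^sup>2 - x\<^sup>2) * (of_real (exp (- x\<^sup>2 / 2)) * cis (t * x)))) (at x)"
    by (auto intro!: derivative_eq_intros simp: power2_eq_square algebra_simps)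
  moreover have "((\<lambda>x. Im ((of_real x + \<i> * of_real t) * (of_real (exp (- x\<^sup>2 / 2)) * cis (t * x)))) has_field_derivative
      Im (of_real (1 - t\<^sup>2 - x\<^sup>2) * (of_real (exp (- x\<^sup>2 / 2)) * cis (t * x)))) (at x)"
    by (auto intro!: derivative_eq_intros simp: power2_eq_square algebra_simps)
  ultimately show ?thesis
    by (simp add: has_vector_derivative_complex_iff del: Re_divide Im_divide)
qed


lemma prob_space_std_normal: "prob_space std_normal_distribution"
  by (rule prob_space_normal_density) simp

lemma integrable_std_normal_power2: "integrable std_normal_distribution (\<lambda>x. x\<^sup>2)"
  by (rule integrable_std_normal_distribution_moment)

lemma integral_std_normal_cis: "(LINT x|std_normal_distribution. cis (t * x)) = of_real (exp (- t\<^sup>2 / 2))"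
  using char_std_normal_distribution by (auto simp: fun_eq_iff char_def cis_conv_exp)

text \<open>Minus the second derivative of the characteristic function. The integral of (1 - t^2 -
  x^2) cis(tx) vanishes by the fundamental theorem of calculus, which avoids differentiating under
  the integral.\<close>

lemma integral_std_normal_power2_cis:
  "(LINT x|std_normal_distribution. of_real (x\<^sup>2) * cis (t * x)) = of_real ((1 - t\<^sup>2) * exp (- t\<^sup>2 / 2))"
proof -
  interpret prob_space std_normal_distribution by (rule prob_space_std_normal)
  let ?E = "\<lambda>x. of_real (exp (- x\<^sup>2 / 2)) * cis (t * x)"
  have i1: "integrable std_normal_distribution (\<lambda>x. cis (t * x))"
    by (rule integrable_const_bound[of _ 1]) auto
  have i2: "integrable std_normal_distribution (\<lambda>x. of_real (x\<^sup>2) * cis (t * x))"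
    by (rule Bochner_Integration.integrable_bound[OF integrable_std_normal_power2]) (auto simp: norm_mult norm_power)
  have i: "integrable std_normal_distribution (\<lambda>x. of_real (1 - t\<^sup>2 - x\<^sup>2) * cis (t * x))"
    using Bochner_Integration.integrable_diff[OF integrable_mult_right[of "of_real (1 - t\<^sup>2)", OF i1] i2]
    by (simp add: algebra_simps)
  have dens: "std_normal_density x *\<^sub>R (of_real (1 - t\<^sup>2 - x\<^sup>2) * cis (t * x)) =
     of_real (1 / sqrt (2 * pi)) * (of_real (1 - t\<^sup>2 - x\<^sup>2) * ?E x)" for x
    by (simp add: std_normal_density_def scaleR_conv_of_real mult_ac)
  have "integrable lborel (\<lambda>x. std_normal_density x *\<^sub>R (of_real (1 - t\<^sup>2 - x\<^sup>2) * cis (t * x)))"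
    using i by (subst (asm) integrable_density) auto
  then have "integrable lborel (\<lambda>x. of_real (sqrt (2 * pi)) * (std_normal_density x *\<^sub>R (of_real (1 - t\<^sup>2 - x\<^sup>2) * cis (t * x))))"
    by (rule integrable_mult_right)
  then have int: "integrable lborel (\<lambda>x. of_real (1 - t\<^sup>2 - x\<^sup>2) * ?E x)"
    unfolding dens by (simp add: mult.assoc[symmetric] of_real_mult[symmetric] del: of_real_mult)
  have "(LBINT x=-\<infinity>..\<infinity>. of_real (1 - t\<^sup>2 - x\<^sup>2) * ?E x) = 0 - 0"
  proof (rule interval_integral_FTC_integrable[where F="\<lambda>x. (of_real x + \<i> * of_real t) * ?E x"])
    show "(((\<lambda>x. (of_real x + \<i> * of_real t) * ?E x) \<circ> real_of_ereal) \<longlongrightarrow> 0) (at_right (-\<infinity>))"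
      unfolding ereal_tendsto_simps by (rule gaussian_decay) simp
    show "(((\<lambda>x. (of_real x + \<i> * of_real t) * ?E x) \<circ> real_of_ereal) \<longlongrightarrow> 0) (at_left \<infinity>)"
      unfolding ereal_tendsto_simps by (rule gaussian_decay) simp
    show "set_integrable lborel (einterval (-\<infinity>) \<infinity>) (\<lambda>x. of_real (1 - t\<^sup>2 - x\<^sup>2) * ?E x)"
      using int by (simp add: set_integrable_def)
    have "continuous_on UNIV (\<lambda>x. of_real (1 - t\<^sup>2 - x\<^sup>2) * ?E x)"
      by (intro continuous_intros) auto
    then show "isCont (\<lambda>x. of_real (1 - t\<^sup>2 - x\<^sup>2) * ?E x) x" for x
      by (simp add: continuous_on_eq_continuous_at)
  qed (use has_vector_derivative_gaussian_cis in auto)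
  then have "(LINT x|lborel. of_real (1 - t\<^sup>2 - x\<^sup>2) * ?E x) = 0"
    by (simp add: interval_lebesgue_integral_def set_lebesgue_integral_def)
  then have "(LINT x|std_normal_distribution. of_real (1 - t\<^sup>2 - x\<^sup>2) * cis (t * x)) = 0"
    by (subst integral_density) (auto simp: dens simp del: of_real_diff)
  also have "(\<lambda>x. of_real (1 - t\<^sup>2 - x\<^sup>2) * cis (t * x)) = (\<lambda>x. of_real (1 - t\<^sup>2) * cis (t * x) - of_real (x\<^sup>2) * cis (t * x))"
    by (simp add: algebra_simps fun_eq_iff)
  finally show ?thesis using i1 i2 integral_std_normal_cis by (simp del: of_real_diff of_real_power)
qed

section \<open>The Gaussian in n dimensions and its Laplacian\<close>

text \<open>A measure on the frequency side: its Fourier transform is the test function.\<close>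
definition gauss :: "real \<Rightarrow> 'a::euclidean_space measure" where
  "gauss \<sigma> = distr (\<Pi>\<^sub>M b\<in>Basis. std_normal_distribution) borel (\<lambda>f. \<Sum>b\<in>Basis. (\<sigma> * f b) *\<^sub>R b)"

lemma measurable_gauss_map [measurable]:
  "(\<lambda>f. \<Sum>b\<in>Basis. (\<sigma> * f b) *\<^sub>R b) \<in> borel_measurable (\<Pi>\<^sub>M b\<in>(Basis::'a::euclidean_space set). std_normal_distribution)"
  by measurable

lemma sets_gauss [simp, measurable_cong]: "sets (gauss \<sigma>) = sets borel"
  by (simp add: gauss_def)

lemma prob_space_gauss: "prob_space (gauss \<sigma> :: 'a::euclidean_space measure)"
proof -
  interpret product_prob_space "\<lambda>b::'a. std_normal_distribution" Basis
    using prob_space_std_normal by (simp add: product_prob_space_def product_prob_space_axioms_def product_sigma_finite_def prob_space_imp_sigma_finite)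
  show ?thesis unfolding gauss_def by (intro prob_space_distr) simp
qed

lemma norm_power2_Basis: "(norm (\<Sum>b\<in>Basis. g b *\<^sub>R b :: 'a::euclidean_space))\<^sup>2 = (\<Sum>b\<in>Basis. (g b)\<^sup>2)"
proof -
  show ?thesis
    unfolding power2_norm_eq_inner by (subst euclidean_inner) (simp add: power2_eq_square)
qed

lemma cis_inner_Basis:
  "cis (- (x \<bullet> (\<Sum>b\<in>Basis. (\<sigma> * f b) *\<^sub>R b :: 'a::euclidean_space))) = (\<Prod>b\<in>Basis. cis (- (\<sigma> * (x \<bullet> b)) * f b))"
proof -
  have cs: "cis (sum g A) = (\<Prod>a\<in>A. cis (g a))" if "finite A" for g and A :: "'a set"
    using that by (induction A) (auto simp: cis_mult[symmetric])
  show ?thesis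
    by (simp add: inner_sum_right sum_negf[symmetric] cs mult_ac)
qed

lemma exp_norm_Basis: "(\<Prod>b\<in>Basis. exp (- (\<sigma> * (x \<bullet> b))\<^sup>2 / 2)) = exp (- (\<sigma> * norm (x :: 'a::euclidean_space))\<^sup>2 / 2)"
proof -
  have "(norm x)\<^sup>2 = (\<Sum>b\<in>Basis. (x \<bullet> b)\<^sup>2)"
    unfolding power2_norm_eq_inner by (subst euclidean_inner) (simp add: power2_eq_square)
  then show ?thesis
    by (simp add: exp_sum[symmetric] power_mult_distrib sum_negf sum_distrib_left sum_divide_distrib)
qed

lemma integral_gauss_cis:
  "(LINT \<xi>|gauss \<sigma>. cis (- (x \<bullet> \<xi>))) = of_real (exp (- (\<sigma> * norm (x :: 'a::euclidean_space))\<^sup>2 / 2))"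
proof -
  interpret product_sigma_finite "\<lambda>b::'a. std_normal_distribution"
    using prob_space_std_normal by (simp add: product_sigma_finite_def prob_space_imp_sigma_finite)
  interpret S: prob_space std_normal_distribution by (rule prob_space_std_normal)
  have "(LINT \<xi>|gauss \<sigma>. cis (- (x \<bullet> \<xi>))) =
    (LINT f|(\<Pi>\<^sub>M b\<in>Basis. std_normal_distribution). (\<Prod>b\<in>Basis. cis (- (\<sigma> * (x \<bullet> b)) * f b)))"
    unfolding gauss_def by (subst integral_distr) (auto simp: cis_inner_Basis)
  also have "\<dots> = (\<Prod>b\<in>Basis. LINT y|std_normal_distribution. cis (- (\<sigma> * (x \<bullet> b)) * y))"
    by (rule product_integral_prod) (auto intro!: S.integrable_const_bound[of _ 1])
  also have "\<dots> = of_real (\<Prod>b\<in>Basis. exp (- (\<sigma> * (x \<bullet> b))\<^sup>2 / 2))"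
    unfolding integral_std_normal_cis by simp
  finally show ?thesis unfolding exp_norm_Basis .
qed

text \<open>For q x = exp(-(\<sigma>|x|)^2/2) the right-hand side is minus the Laplacian of q.
  Finiteness of the second moment is what later makes the diffusion term integrable in
  \<xi>.\<close>

lemma integral_gauss_power2_cis:
  "integrable (gauss \<sigma>) (\<lambda>\<xi>::'a::euclidean_space. (norm \<xi>)\<^sup>2)"
  "(LINT \<xi>|gauss \<sigma>. of_real ((norm \<xi>)\<^sup>2) * cis (- (x \<bullet> \<xi>))) =
    of_real (\<sigma>\<^sup>2 * (real DIM('a) - (\<sigma> * norm (x :: 'a))\<^sup>2) * exp (- (\<sigma> * norm x)\<^sup>2 / 2))"
proof -
  interpret product_sigma_finite "\<lambda>b::'a. std_normal_distribution"
    using prob_space_std_normal by (simp add: product_sigma_finite_def prob_space_imp_sigma_finite)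
  interpret S: prob_space std_normal_distribution by (rule prob_space_std_normal)
  \<comment> \<open>Splits |\<xi>|^2 times the character into a sum over j of products over
    coordinates, the square sitting in the j-th factor only.\<close>
  define h where "h = (\<lambda>(x::'a) j b (y::real). (if b = j then of_real (y\<^sup>2) else 1) * cis (- (\<sigma> * (x \<bullet> b)) * y))"
  have hi: "integrable std_normal_distribution (h x j b)" for x j b
  proof (cases "b = j")
    case True
    then show ?thesis unfolding h_def
      by (intro Bochner_Integration.integrable_bound[OF integrable_std_normal_power2]) (auto simp: norm_mult norm_power)
  qed (auto simp: h_def intro!: S.integrable_const_bound[of _ 1])
  have prodh: "(\<Prod>b\<in>Basis. h x j b (f b)) = of_real ((f j)\<^sup>2) * (\<Prod>b\<in>Basis. cis (- (\<sigma> * (x \<bullet> b)) * f b))"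
    if "j \<in> Basis" for x j f
    using that unfolding h_def prod.distrib by (simp add: prod.delta)
  have pi: "integrable (\<Pi>\<^sub>M b\<in>Basis. std_normal_distribution) (\<lambda>f. \<Prod>b\<in>Basis. h x j b (f b))" for x j
    by (rule product_integrable_prod) (auto intro: hi)
  have rew: "of_real ((norm (\<Sum>b\<in>Basis. (\<sigma> * f b) *\<^sub>R b :: 'a))\<^sup>2) * cis (- (x \<bullet> (\<Sum>b\<in>Basis. (\<sigma> * f b) *\<^sub>R b)))
     = of_real (\<sigma>\<^sup>2) * (\<Sum>j\<in>Basis. \<Prod>b\<in>Basis. h x j b (f b))" for x and f :: "'a \<Rightarrow> real"
    unfolding norm_power2_Basis cis_inner_Basis
    by (simp add: prodh sum_distrib_right[symmetric] power_mult_distrib sum_distrib_left[symmetric] mult.assoc del: of_real_power)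
  have int: "integrable (\<Pi>\<^sub>M b\<in>(Basis::'a set). std_normal_distribution) (\<lambda>f. of_real (\<sigma>\<^sup>2) * (\<Sum>j\<in>Basis. \<Prod>b\<in>Basis. h x j b (f b)))" for x
    by (intro integrable_mult_right Bochner_Integration.integrable_sum pi)
  \<comment> \<open>At x = 0 the character is 1, which leaves the plain second moment.\<close>
  have "integrable (gauss \<sigma>) (\<lambda>\<xi>::'a. of_real ((norm \<xi>)\<^sup>2) * cis (- (0 \<bullet> \<xi>)))"
    unfolding gauss_def by (subst integrable_distr_eq) (use int[of 0] in \<open>simp_all only: rew, measurable\<close>)
  then have "integrable (gauss \<sigma>) (\<lambda>\<xi>::'a. (of_real ((norm \<xi>)\<^sup>2)::complex))" by simp
  then show "integrable (gauss \<sigma>) (\<lambda>\<xi>::'a. (norm \<xi>)\<^sup>2)" unfolding complex_of_real_integrable_eq .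
  have "(LINT \<xi>|gauss \<sigma>. of_real ((norm \<xi>)\<^sup>2) * cis (- (x \<bullet> \<xi>))) =
    (LINT f|(\<Pi>\<^sub>M b\<in>Basis. std_normal_distribution). of_real (\<sigma>\<^sup>2) * (\<Sum>j\<in>Basis. \<Prod>b\<in>Basis. h x j b (f b)))"
    unfolding gauss_def by (subst integral_distr) (simp_all only: rew, measurable)
  also have "\<dots> = of_real (\<sigma>\<^sup>2) * (\<Sum>j\<in>Basis. \<Prod>b\<in>Basis. LINT y|std_normal_distribution. h x j b y)"
    using pi hi by (simp add: product_integral_prod)
  also have "(\<Sum>j\<in>Basis. \<Prod>b\<in>Basis. LINT y|std_normal_distribution. h x j b y) =
     (\<Sum>j\<in>Basis. of_real ((1 - (\<sigma> * (x \<bullet> j))\<^sup>2) * exp (- (\<sigma> * norm x)\<^sup>2 / 2)))"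
  proof (rule sum.cong[OF refl])
    fix j :: 'a assume j: "j \<in> Basis"
    have "(LINT y|std_normal_distribution. h x j b y) = of_real ((if b = j then 1 - (\<sigma> * (x \<bullet> j))\<^sup>2 else 1) * exp (- (\<sigma> * (x \<bullet> b))\<^sup>2 / 2))" for b
      using integral_std_normal_power2_cis[of "- (\<sigma> * (x \<bullet> b))"] integral_std_normal_cis[of "- (\<sigma> * (x \<bullet> b))"]
      by (auto simp: h_def)
    then have "(\<Prod>b\<in>Basis. LINT y|std_normal_distribution. h x j b y) =
      of_real (\<Prod>b\<in>Basis. (if b = j then 1 - (\<sigma> * (x \<bullet> j))\<^sup>2 else 1) * exp (- (\<sigma> * (x \<bullet> b))\<^sup>2 / 2))"
      by (simp only: of_real_prod)
    also have "(\<Prod>b\<in>Basis. (if b = j then 1 - (\<sigma> * (x \<bullet> j))\<^sup>2 else 1) * exp (- (\<sigma> * (x \<bullet> b))\<^sup>2 / 2)) =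
       (1 - (\<sigma> * (x \<bullet> j))\<^sup>2) * exp (- (\<sigma> * norm x)\<^sup>2 / 2)"
      using j unfolding prod.distrib exp_norm_Basis by (simp add: prod.delta)
    finally show "(\<Prod>b\<in>Basis. LINT y|std_normal_distribution. h x j b y) =
      of_real ((1 - (\<sigma> * (x \<bullet> j))\<^sup>2) * exp (- (\<sigma> * norm x)\<^sup>2 / 2))" .
  qed
  also have "\<dots> = of_real ((real DIM('a) - (\<sigma> * norm x)\<^sup>2) * exp (- (\<sigma> * norm x)\<^sup>2 / 2))"
  proof -
    have "(norm x)\<^sup>2 = (\<Sum>b\<in>Basis. (x \<bullet> b)\<^sup>2)"
      unfolding power2_norm_eq_inner by (subst euclidean_inner) (simp add: power2_eq_square)
    then have "(\<Sum>j\<in>Basis. 1 - (\<sigma> * (x \<bullet> j))\<^sup>2) = real DIM('a) - (\<sigma> * norm x)\<^sup>2"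
      by (simp add: sum_subtractf power_mult_distrib sum_distrib_left)
    then show ?thesis by (simp only: of_real_sum[symmetric] sum_distrib_right[symmetric])
  qed
  finally show "(LINT \<xi>|gauss \<sigma>. of_real ((norm \<xi>)\<^sup>2) * cis (- (x \<bullet> \<xi>))) =
    of_real (\<sigma>\<^sup>2 * (real DIM('a) - (\<sigma> * norm (x :: 'a))\<^sup>2) * exp (- (\<sigma> * norm x)\<^sup>2 / 2))"
    by (simp only: of_real_mult mult.assoc)
qed

text \<open>The total mass of the test function, which enters the blow-up rate through Jensen's
  inequality.\<close>

lemma has_bochner_integral_gaussian:
  fixes \<sigma> :: real
  assumes "0 < \<sigma>"
  shows "has_bochner_integral lborel (\<lambda>x::'a::euclidean_space. exp (- (\<sigma> * norm x)\<^sup>2 / 2)) ((sqrt (2 * pi) / \<sigma>) ^ DIM('a))"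
proof (rule has_bochner_integral_nn_integral)
  have nd: "exp (- (\<sigma> * y)\<^sup>2 / 2) = (sqrt (2 * pi) / \<sigma>) * normal_density 0 (1 / \<sigma>) y" for y
    using assms by (simp add: normal_density_def real_sqrt_divide real_sqrt_mult power_mult_distrib power_divide field_simps)
  have 1: "(\<integral>\<^sup>+y. ennreal (exp (- (\<sigma> * y)\<^sup>2 / 2)) \<partial>lborel) = ennreal (sqrt (2 * pi) / \<sigma>)"
    using assms unfolding nd by (subst nn_integral_eq_integral) auto
  have "(\<integral>\<^sup>+x. ennreal (exp (- (\<sigma> * norm (x::'a))\<^sup>2 / 2)) \<partial>lborel) =
     (\<integral>\<^sup>+x. (\<Prod>b\<in>Basis. ennreal (exp (- (\<sigma> * ((x::'a) \<bullet> b))\<^sup>2 / 2))) \<partial>lborel)"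
    unfolding exp_norm_Basis[symmetric] by (simp add: prod_ennreal)
  also have "\<dots> = (\<Prod>b\<in>(Basis::'a set). (\<integral>\<^sup>+y. ennreal (exp (- (\<sigma> * y)\<^sup>2 / 2)) \<partial>lborel))"
    by (rule nn_integral_lborel_prod) auto
  also have "\<dots> = ennreal ((sqrt (2 * pi) / \<sigma>) ^ DIM('a))"
    unfolding 1 using assms by (simp add: ennreal_power)
  finally show "(\<integral>\<^sup>+x. ennreal (exp (- (\<sigma> * norm (x::'a))\<^sup>2 / 2)) \<partial>lborel) = ennreal ((sqrt (2 * pi) / \<sigma>) ^ DIM('a))" .
qed (use assms in auto)

section \<open>Fourier transforms of mild solutions\<close>

lemma lborel_translate:
  fixes g :: "'a::euclidean_space \<Rightarrow> 'b::{banach, second_countable_topology}"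
  assumes "integrable lborel g"
  shows "integrable lborel (\<lambda>x. g (x - y))" "(LINT x|lborel. g (x - y)) = (LINT x|lborel. g x)"
proof -
  have [measurable]: "g \<in> borel_measurable borel" using assms by auto
  have "distr lborel borel ((+) (- y)) = (lborel :: 'a measure)" by (rule lborel_distr_plus)
  then have "integrable (distr lborel borel ((+) (- y))) g"
    "integral\<^sup>L (distr lborel borel ((+) (- y))) g = (LINT x|lborel. g x)" using assms by auto
  then show "integrable lborel (\<lambda>x. g (x - y))" "(LINT x|lborel. g (x - y)) = (LINT x|lborel. g x)"
    by (auto simp: integrable_distr_eq integral_distr)
qed

lemma (in pair_sigma_finite) integrable_mult_pair:
  fixes f g :: "_ \<Rightarrow> real"
  assumes "integrable M1 f" "integrable M2 g"
  shows "integrable (M1 \<Otimes>\<^sub>M M2) (\<lambda>(x, y). f x * g y)"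
proof (rule Fubini_integrable)
  have [measurable]: "f \<in> borel_measurable M1" "g \<in> borel_measurable M2" using assms by auto
  show "(\<lambda>(x, y). f x * g y) \<in> borel_measurable (M1 \<Otimes>\<^sub>M M2)" by measurable
qed (use assms in \<open>auto simp: abs_mult\<close>)

definition fourier :: "('a::euclidean_space \<Rightarrow> real) \<Rightarrow> 'a \<Rightarrow> complex" where
  "fourier g \<xi> = (LINT x|lborel. of_real (g x) * cis (- (x \<bullet> \<xi>)))"

lemma integrable_fourier:
  assumes "integrable lborel g"
  shows "integrable lborel (\<lambda>x. of_real (g x) * cis (- (x \<bullet> \<xi>)))"
  using assms by (intro Bochner_Integration.integrable_bound[OF assms]) (auto simp: norm_mult)

lemma norm_fourier_le:
  assumes "integrable lborel g"
  shows "norm (fourier g \<xi>) \<le> (LINT x|lborel. \<bar>g x\<bar>)"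
  unfolding fourier_def
  by (rule order_trans[OF integral_norm_bound]) (simp add: norm_mult)

lemma fourier_cong_AE:
  assumes "AE x in lborel. g x = h x" "g \<in> borel_measurable borel" "h \<in> borel_measurable borel"
  shows "fourier g \<xi> = fourier h \<xi>"
  unfolding fourier_def using assms(2,3) by (intro integral_cong_AE) (use assms(1) in auto)

text \<open>Fubini over \<mu> and Lebesgue measure; translation by y multiplies the transform by
  \<open>cis (- (y \<bullet> \<xi>))\<close>.\<close>

lemma fourier_conv:
  fixes g :: "real ^ 'n \<Rightarrow> real"
  assumes \<mu>: "finite_measure \<mu>" "sets \<mu> = sets borel" and g: "integrable lborel g"
  shows "integrable lborel (conv \<mu> g)" "fourier (conv \<mu> g) \<xi> = fourier_measure \<mu> \<xi> * fourier g \<xi>"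
proof -
  interpret M: finite_measure \<mu> by fact
  interpret P: pair_sigma_finite \<mu> "lborel :: (real ^ 'n) measure" ..
  note [measurable_cong] = \<mu>(2)
  have [measurable]: "g \<in> borel_measurable borel" using g by auto
  have int: "integrable (\<mu> \<Otimes>\<^sub>M lborel) (\<lambda>(y, x). of_real (g (x - y)) * cis (- (x \<bullet> \<xi>)))" for \<xi>
  proof (rule P.Fubini_integrable)
    show "integrable \<mu> (\<lambda>y. LINT x|lborel. norm (case (y, x) of (y, x) \<Rightarrow> of_real (g (x - y)) * cis (- (x \<bullet> \<xi>))))"
      using lborel_translate(2)[of "\<lambda>x. \<bar>g x\<bar>"] g by (simp add: norm_mult)
    show "AE y in \<mu>. integrable lborel (\<lambda>x. case (y, x) of (y, x) \<Rightarrow> of_real (g (x - y)) * cis (- (x \<bullet> \<xi>)))"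
      using integrable_fourier[OF lborel_translate(1)[OF g]] by auto
  qed measurable
  \<comment> \<open>Frequency 0 removes the character, so the integrability is that of the
    convolution itself.\<close>
  have "integrable lborel (\<lambda>x. LINT y|\<mu>. (of_real (g (x - y)) * cis (- (x \<bullet> 0)) :: complex))"
    using P.integrable_snd[OF int[of 0]] by simp
  then have "integrable lborel (\<lambda>x. of_real (conv \<mu> g x) :: complex)"
    unfolding conv_def by simp
  then show "integrable lborel (conv \<mu> g)" unfolding complex_of_real_integrable_eq .
  have tr: "(LINT x|lborel. of_real (g (x - y)) * cis (- (x \<bullet> \<xi>))) = cis (- (y \<bullet> \<xi>)) * fourier g \<xi>" for y
  proof -
    have "(LINT x|lborel. of_real (g (x - y)) * cis (- (x \<bullet> \<xi>))) =
       (LINT x|lborel. cis (- (y \<bullet> \<xi>)) * (of_real (g (x - y)) * cis (- ((x - y) \<bullet> \<xi>))))"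
      by (intro Bochner_Integration.integral_cong) (auto simp: cis_mult mult.left_commute inner_diff_left)
    also have "\<dots> = cis (- (y \<bullet> \<xi>)) * (LINT x|lborel. of_real (g (x - y)) * cis (- ((x - y) \<bullet> \<xi>)))"
      by simp
    also have "(LINT x|lborel. of_real (g (x - y)) * cis (- ((x - y) \<bullet> \<xi>))) = fourier g \<xi>"
      unfolding fourier_def by (rule lborel_translate(2)[OF integrable_fourier[OF g]])
    finally show ?thesis .
  qed
  have "fourier (conv \<mu> g) \<xi> = (LINT x|lborel. LINT y|\<mu>. of_real (g (x - y)) * cis (- (x \<bullet> \<xi>)))"
    unfolding fourier_def conv_def by simp
  also have "\<dots> = (LINT y|\<mu>. LINT x|lborel. of_real (g (x - y)) * cis (- (x \<bullet> \<xi>)))"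
    using P.Fubini_integral[OF int] by simp
  finally show "fourier (conv \<mu> g) \<xi> = fourier_measure \<mu> \<xi> * fourier g \<xi>"
    unfolding tr fourier_measure_def by simp
qed

section \<open>From the mild formula to an integrated equation, one frequency at a time\<close>

text \<open>Here \<open>f\<close> stands for 1/Psi on the positive axis, where it is real. The
  exponents \<alpha>1, \<alpha>2 are abstracted away: what remains is linear growth of f and the
  transforms of the two families.\<close>

locale subdiffusion =
  fixes f :: "real \<Rightarrow> real" and Z Y :: "real \<Rightarrow> (real ^ 'n) measure"
  assumes f_pos: "\<And>z. 0 < z \<Longrightarrow> 0 < f z"
    and f_scale: "\<And>z l. 0 < z \<Longrightarrow> 1 \<le> l \<Longrightarrow> f (l * z) \<le> l * f z"
    and Z_prob: "\<And>t. 0 < t \<Longrightarrow> prob_space (Z t)" and Z_sets: "\<And>t. 0 < t \<Longrightarrow> sets (Z t) = sets borel"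
    and Y_finite: "\<And>t. 0 < t \<Longrightarrow> finite_measure (Y t)" and Y_sets: "\<And>t. 0 < t \<Longrightarrow> sets (Y t) = sets borel"
    and laplace_Z: "\<And>z \<xi>. 0 < z \<Longrightarrow> laplace (\<lambda>t. indicator {0<..} t *\<^sub>R fourier_measure (Z t) \<xi>) z
       (of_real (f z / (z * (f z + (norm \<xi>)\<^sup>2))))"
    and laplace_Y: "\<And>z \<xi>. 0 < z \<Longrightarrow> laplace (\<lambda>t. indicator {0<..} t *\<^sub>R fourier_measure (Y t) \<xi>) z
       (of_real (1 / (f z + (norm \<xi>)\<^sup>2)))"
begin

definition mass :: "real \<Rightarrow> real" where
  "mass t = indicator {0<..} t * measure (Y t) UNIV"

lemma mass_nonneg: "0 \<le> mass t" and mass_nonpos: "t \<le> 0 \<Longrightarrow> mass t = 0"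
  by (auto simp: mass_def indicator_def)

lemma laplace_mass: "0 < z \<Longrightarrow> laplace (\<lambda>t. of_real (mass t)) z (of_real (1 / f z))"
proof -
  assume z: "0 < z"
  have "(\<lambda>t. indicator {0<..} t *\<^sub>R fourier_measure (Y t) 0) = (\<lambda>t. of_real (mass t))"
  proof
    fix t :: real
    have "space (Y t) = UNIV" if "0 < t" using sets_eq_imp_space_eq[OF Y_sets[OF that]] by simp
    then show "indicator {0<..} t *\<^sub>R fourier_measure (Y t) 0 = of_real (mass t)"
      by (auto simp: mass_def fourier_measure_def indicator_def scaleR_conv_of_real)
  qed
  then show ?thesis using laplace_Y[OF z, of 0] by simp
qed

lemma measurable_mass [measurable]: "mass \<in> borel_measurable borel"
proof -
  have [measurable]: "(\<lambda>t. complex_of_real (mass t)) \<in> borel_measurable borel"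
    by (rule laplace_measurable[OF laplace_mass[of 1]]) simp
  have "(\<lambda>t. Re (complex_of_real (mass t))) \<in> borel_measurable borel" by measurable
  then show ?thesis by simp
qed

sublocale laplace_kernel mass f
proof
  fix z :: real assume z: "0 < z"
  have "has_bochner_integral lborel (\<lambda>t. Re (of_real (exp (- z * t)) * of_real (mass t))) (Re (of_real (1 / f z)))"
    using has_bochner_integral_Re laplace_mass[OF z] unfolding laplace_def by blast
  also have "(\<lambda>t. Re (of_real (exp (- z * t)) * of_real (mass t))) = (\<lambda>t. exp (- z * t) * (indicator {0<..} t * mass t))"
    by (auto simp: indicator_def mass_def fun_eq_iff)
  finally show "has_bochner_integral lborel (\<lambda>t. exp (- z * t) * (indicator {0<..} t * mass t)) (1 / f z)" by simp
qed (use f_pos f_scale mass_nonneg in auto)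

text \<open>Read off from \<open>Z\<close> at frequency 0: probability measures have transform 1
  there, and f(z)/(z f(z)) = 1/z.\<close>

lemma laplace_heaviside: "0 < z \<Longrightarrow> laplace (\<lambda>t. of_real (indicator {0<..} t)) z (of_real (1 / z))"
proof -
  assume z: "0 < z"
  have "(\<lambda>t. indicator {0<..} t *\<^sub>R fourier_measure (Z t) 0) = (\<lambda>t. of_real (indicator {0<..} t))"
  proof
    fix t :: real
    have "measure (Z t) (space (Z t)) = 1" if "0 < t" using Z_prob[OF that] by (rule prob_space.prob_space)
    then show "indicator {0<..} t *\<^sub>R fourier_measure (Z t) 0 = of_real (indicator {0<..} t)"
      by (auto simp: fourier_measure_def indicator_def)
  qed
  then show ?thesis using laplace_Z[OF z, of 0] f_pos[OF z] by simp
qed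

text \<open>With \<open>a\<close> the Fourier transform of the datum and \<open>N\<close> that of the source, the Fourier transform of
  the mild solution solves the integrated equation \<open>u = a + \<psi> * (N - |\<xi>|^2 u)\<close>.\<close>
lemma volterra_fourier:
  fixes N :: "real \<Rightarrow> complex" and a :: complex and \<xi> :: "real ^ 'n"
  defines "U \<equiv> \<lambda>t. (indicator {0<..} t *\<^sub>R fourier_measure (Z t) \<xi>) * a +
      convolve (\<lambda>t. indicator {0<..} t *\<^sub>R fourier_measure (Y t) \<xi>) N t"
  assumes N: "\<And>z. 0 < z \<Longrightarrow> \<exists>\<nu>. laplace N z \<nu>" and N0: "\<And>t. t \<le> 0 \<Longrightarrow> N t = 0"
  shows "AE t in lborel. 0 < t \<longrightarrow> U t + of_real ((norm \<xi>)\<^sup>2) * convolve (\<lambda>t. of_real (mass t)) U t =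
      a + convolve (\<lambda>t. of_real (mass t)) N t"
proof -
  \<comment> \<open>The datum is multiplied by the Heaviside function so that the defect vanishes
    for t \<le> 0 and has a Laplace transform.\<close>
  define E where "E = (\<lambda>t. (U t + of_real ((norm \<xi>)\<^sup>2) * convolve (\<lambda>t. of_real (mass t)) U t) -
      (a * of_real (indicator {0<..} t) + convolve (\<lambda>t. of_real (mass t)) N t))"
  have conv0: "convolve g h t = 0" if "t \<le> 0" "\<And>s. s \<le> 0 \<Longrightarrow> g s = 0" "\<And>s. s \<le> 0 \<Longrightarrow> h s = 0" for g h t
  proof -
    have "g (t - s) * h s = 0" for s using that by (cases "s \<le> 0") auto
    then have "(\<lambda>s. g (t - s) * h s) = (\<lambda>s. 0)" by (rule ext)
    then show ?thesis unfolding convolve_def by simp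
  qed
  have U0: "U t = 0" if "t \<le> 0" for t
    unfolding U_def using that by (simp add: conv0 N0)
  have "AE t in lborel. E t = 0"
  proof (rule laplace_unique_zero[where \<sigma> = 0])
    fix t :: real assume "t \<le> 0"
    then show "E t = 0" by (simp add: E_def U0 N0 conv0 mass_nonpos)
  next
    fix z :: real assume z: "0 < z"
    obtain \<nu> where \<nu>: "laplace N z \<nu>" using N[OF z] by auto
    define m where "m = (norm \<xi>)\<^sup>2"
    have fz: "0 < f z" "0 \<le> m" using f_pos z by (auto simp: m_def)
    let ?L = "a * of_real (f z / (z * (f z + m))) + of_real (1 / (f z + m)) * \<nu>"
    have "laplace U z ?L"
      unfolding U_def using laplace_add[OF laplace_cmult[OF laplace_Z[OF z, of \<xi>], of a] laplace_convolve[OF laplace_Y[OF z] \<nu>, of \<xi>]]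
      by (simp add: m_def mult.commute)
    from laplace_diff[OF laplace_add[OF this laplace_cmult[OF laplace_convolve[OF laplace_mass[OF z] this], of "of_real m"]]
        laplace_add[OF laplace_cmult[OF laplace_heaviside[OF z], of a] laplace_convolve[OF laplace_mass[OF z] \<nu>]]]
    have "laplace E z ((?L + of_real m * (of_real (1 / f z) * ?L)) - (a * of_real (1 / z) + of_real (1 / f z) * \<nu>))"
      unfolding E_def m_def .
    also have "(?L + of_real m * (of_real (1 / f z) * ?L)) - (a * of_real (1 / z) + of_real (1 / f z) * \<nu>) = 0"
    \<comment> \<open>With m = |\<xi>|^2, applying 1 + m/f(z) = (f(z)+m)/f(z) cancels the
      denominators of both families: f/(z(f+m)) becomes 1/z and 1/(f+m) becomes 1/f.\<close>
    proof -
      have "(a * of_real s + of_real y * \<nu>) + of_real m * (of_real k * (a * of_real s + of_real y * \<nu>)) =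
          a * of_real ((1 + m * k) * s) + of_real ((1 + m * k) * y) * \<nu>" for s y k :: real
        by (simp add: algebra_simps)
      note this[of "f z / (z * (f z + m))" "1 / (f z + m)" "1 / f z"]
      also have "1 + m * (1 / f z) = (f z + m) / f z" using fz by (simp add: field_simps)
      also have "(f z + m) / f z * (f z / (z * (f z + m))) = 1 / z" using fz z by simp
      also have "(f z + m) / f z * (1 / (f z + m)) = 1 / f z" using fz by simp
      finally show ?thesis by simp
    qed
    finally show "laplace E z 0" .
  qed
  then show ?thesis by eventually_elim (auto simp: E_def)
qed

end

text \<open>One finite horizon on which a nonnegative mild solution exists. The outcome is an upper
  bound for \<open>K mass T\<close> in terms of the datum alone.\<close>

locale mild = subdiffusion f Z Y for f and Z Y :: "real \<Rightarrow> (real ^ 'n) measure" +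
  fixes p T :: real and u0 :: "real ^ 'n \<Rightarrow> real" and u :: "real \<Rightarrow> real ^ 'n \<Rightarrow> real"
  assumes p: "1 < p" and T: "0 < T" and u0: "integrable lborel u0"
    and mild_solution: "mild_solution Z Y p u0 T u"
    and u_nonneg: "\<And>t. 0 \<le> t \<Longrightarrow> t \<le> T \<Longrightarrow> AE x in lborel. 0 \<le> u t x"
begin

text \<open>Clamping the time makes the solution a jointly Borel function on the whole space; on \<open>(0, T)\<close> it is
  \<open>u\<close> up to null sets.\<close>
definition V :: "real \<Rightarrow> real ^ 'n \<Rightarrow> real" where
  "V s x = indicator {0<..<T} s * max 0 (u (max 0 (min T s)) x)"

definition N :: "real \<Rightarrow> real ^ 'n \<Rightarrow> real" where
  "N s x = V s x powr p"

lemma measurable_V [measurable]: "(\<lambda>(s, x). V s x) \<in> borel_measurable (borel \<Otimes>\<^sub>M borel)"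
proof -
  have [measurable]: "(\<lambda>(t, x). u t x) \<in> borel_measurable (restrict_space borel {0..T} \<Otimes>\<^sub>M borel)"
    using mild_solution unfolding mild_solution_def by auto
  have [measurable]: "(\<lambda>s. max 0 (min T s)) \<in> borel \<rightarrow>\<^sub>M restrict_space borel {0..T}"
    using T by (intro measurable_restrict_space2) auto
  have "(\<lambda>z. case (max 0 (min T (fst z)), snd z) of (t, x) \<Rightarrow> u t x) \<in> borel_measurable (borel \<Otimes>\<^sub>M borel)"
    by measurable
  then have [measurable]: "(\<lambda>z. u (max 0 (min T (fst z))) (snd z)) \<in> borel_measurable (borel \<Otimes>\<^sub>M borel)" by simp
  have "(\<lambda>z. indicator {0<..<T} (fst z) * max 0 (u (max 0 (min T (fst z))) (snd z))) \<in> borel_measurable (borel \<Otimes>\<^sub>M borel)"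
    by measurable
  then show ?thesis by (simp add: V_def split_beta')
qed

lemma measurable_V' [measurable]: "V s \<in> borel_measurable borel"
  using measurable_Pair_compose_split[OF measurable_V, of "\<lambda>_. s" borel "\<lambda>x. x"] by simp

lemma measurable_N [measurable]: "(\<lambda>(s, x). N s x) \<in> borel_measurable (borel \<Otimes>\<^sub>M borel)"
proof -
  have "(\<lambda>z. (case z of (s, x) \<Rightarrow> V s x) powr p) \<in> borel_measurable (borel \<Otimes>\<^sub>M borel)" by measurable
  then show ?thesis by (simp add: N_def split_beta')
qed

lemma measurable_N' [measurable]: "N s \<in> borel_measurable borel"
  using measurable_Pair_compose_split[OF measurable_N, of "\<lambda>_. s" borel "\<lambda>x. x"] by simp

lemma V_nonneg: "0 \<le> V s x" and N_nonneg: "0 \<le> N s x"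
  by (auto simp: V_def N_def)

lemma V_outside: "s \<notin> {0<..<T} \<Longrightarrow> V s = (\<lambda>x. 0)" and N_outside: "s \<notin> {0<..<T} \<Longrightarrow> N s = (\<lambda>x. 0)"
  by (auto simp: V_def N_def)

lemma V_inside: "s \<in> {0<..<T} \<Longrightarrow> V s x = max 0 (u s x)"
  and N_inside: "s \<in> {0<..<T} \<Longrightarrow> N s x = max 0 (u s x) powr p"
  by (auto simp: V_def N_def)

lemma integrable_u: "t \<in> {0..T} \<Longrightarrow> integrable lborel (u t)"
  and tendsto_u: "t \<in> {0..T} \<Longrightarrow> ((\<lambda>s. LINT x|lborel. \<bar>u s x - u t x\<bar>) \<longlongrightarrow> 0) (at t within {0..T})"
  using mild_solution unfolding mild_solution_def C_L1_def by auto

lemma V_eq_u: "s \<in> {0<..<T} \<Longrightarrow> AE x in lborel. V s x = u s x"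
  using u_nonneg[of s] by (auto elim!: eventually_mono simp: V_inside)

lemma integrable_V: "integrable lborel (V s)"
proof (cases "s \<in> {0<..<T}")
  case True
  then have "integrable lborel (u s)" using integrable_u by simp
  then show ?thesis using V_eq_u[OF True] by (subst integrable_cong_AE) auto
qed (simp add: V_outside)

lemma fourier_V: "s \<in> {0<..<T} \<Longrightarrow> fourier (V s) \<xi> = fourier (u s) \<xi>"
  using integrable_u[of s] V_eq_u[of s] by (intro fourier_cong_AE) auto

lemma continuous_on_integral_u:
  assumes q: "q \<in> borel_measurable borel" "\<And>x. \<bar>q x\<bar> \<le> 1"
  shows "continuous_on {0..T} (\<lambda>t. LINT x|lborel. u t x * q x)"
  unfolding continuous_on_def
proof
  fix t assume t: "t \<in> {0..T}"
  note [measurable] = q(1)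
  have i: "integrable lborel (\<lambda>x. u s x * q x)" if "s \<in> {0..T}" for s
    using integrable_u[OF that] mult_left_le[OF q(2) abs_ge_zero]
    by (intro Bochner_Integration.integrable_bound[OF integrable_u[OF that]]) (auto simp: abs_mult)
  have "((\<lambda>s. (LINT x|lborel. u s x * q x) - (LINT x|lborel. u t x * q x)) \<longlongrightarrow> 0) (at t within {0..T})"
  proof (rule Lim_null_comparison[OF _ tendsto_u[OF t]])
    show "\<forall>\<^sub>F s in at t within {0..T}. norm ((LINT x|lborel. u s x * q x) - (LINT x|lborel. u t x * q x))
        \<le> (LINT x|lborel. \<bar>u s x - u t x\<bar>)"
      unfolding eventually_at_filter
    proof (intro always_eventually allI impI)
      fix s assume s: "s \<in> {0..T}"
      have "(LINT x|lborel. u s x * q x) - (LINT x|lborel. u t x * q x) = (LINT x|lborel. (u s x - u t x) * q x)"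
        using i[OF s] i[OF t] by (simp add: left_diff_distrib)
      also have "norm \<dots> \<le> (LINT x|lborel. \<bar>u s x - u t x\<bar>)"
      proof (rule Bochner_Integration.integral_norm_bound_integral)
        show "integrable lborel (\<lambda>x. (u s x - u t x) * q x)"
          using i[OF s] i[OF t] by (simp add: left_diff_distrib)
        show "norm ((u s x - u t x) * q x) \<le> \<bar>u s x - u t x\<bar>" for x
          using mult_left_le[OF q(2)[of x] abs_ge_zero[of "u s x - u t x"]] by (simp add: abs_mult)
      qed (use integrable_u[OF s] integrable_u[OF t] in auto)
      finally show "norm ((LINT x|lborel. u s x * q x) - (LINT x|lborel. u t x * q x))
        \<le> (LINT x|lborel. \<bar>u s x - u t x\<bar>)" .
    qed
  qed
  then show "((\<lambda>s. LINT x|lborel. u s x * q x) \<longlongrightarrow> (LINT x|lborel. u t x * q x)) (at t within {0..T})"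
    by (simp add: LIM_zero_iff)
qed

text \<open>By nonnegativity the L^1 norm is the plain integral, a continuous function of time on
  the compact interval [0,T].\<close>

lemma V_bounds:
  obtains C M where "0 \<le> C" "0 \<le> M" "\<And>s. (LINT x|lborel. V s x) \<le> C"
    "AE s in lborel. AE x in lborel. V s x \<le> M"
proof -
  have "continuous_on {0..T} (\<lambda>t. LINT x|lborel. u t x)"
    using continuous_on_integral_u[of "\<lambda>x. 1"] by simp
  then have "bounded ((\<lambda>t. LINT x|lborel. u t x) ` {0..T})"
    by (intro compact_imp_bounded compact_continuous_image) auto
  then obtain C where "\<forall>y\<in>(\<lambda>t. LINT x|lborel. u t x) ` {0..T}. norm y \<le> C"
    unfolding bounded_iff by blast
  then have C: "\<bar>LINT x|lborel. u t x\<bar> \<le> C" if "t \<in> {0..T}" for t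
    using that by auto
  have "0 \<le> C" using C[of T] T by (simp add: order_trans[OF abs_ge_zero])
  moreover have "(LINT x|lborel. V s x) \<le> C" for s
  proof (cases "s \<in> {0<..<T}")
    case True
    then have "(LINT x|lborel. V s x) = (LINT x|lborel. u s x)"
      using integrable_u[of s] V_eq_u[of s] by (intro integral_cong_AE) auto
    then show ?thesis using C[of s] True by auto
  qed (simp add: V_outside \<open>0 \<le> C\<close>)
  moreover obtain M where M: "AE t in lborel. t \<in> {0<..<T} \<longrightarrow> (AE x in lborel. \<bar>u t x\<bar> \<le> M)"
    using mild_solution unfolding mild_solution_def Linf_Linf_def by auto
  \<comment> \<open>The maximum with 0 lets the same bound hold outside (0,T), where
    \<open>V\<close> is zero.\<close>
  have "AE s in lborel. AE x in lborel. V s x \<le> max 0 M"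
    using M
  proof eventually_elim
    fix s assume *: "s \<in> {0<..<T} \<longrightarrow> (AE x in lborel. \<bar>u s x\<bar> \<le> M)"
    show "AE x in lborel. V s x \<le> max 0 M"
    proof (cases "s \<in> {0<..<T}")
      case True
      then show ?thesis using * by (auto elim!: eventually_mono simp: V_inside)
    qed (simp add: V_outside)
  qed
  ultimately show ?thesis using that[of C "max 0 M"] by auto
qed

text \<open>Interpolation between L^1 and L^\<infinity>: V^p \<le> M^(p-1) V. The L^\<infinity>
  bound holds for almost every time, and so does this one.\<close>

lemma N_bounds:
  obtains C where "0 \<le> C" "AE s in lborel. integrable lborel (N s) \<and> (LINT x|lborel. N s x) \<le> C"
proof -
  obtain C M where C: "0 \<le> C" "0 \<le> M" "\<And>s. (LINT x|lborel. V s x) \<le> C"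
    "AE s in lborel. AE x in lborel. V s x \<le> M" using V_bounds by metis
  have "AE s in lborel. integrable lborel (N s) \<and> (LINT x|lborel. N s x) \<le> M powr (p - 1) * C"
    using C(4)
  proof eventually_elim
    fix s assume *: "AE x in lborel. V s x \<le> M"
    have le: "AE x in lborel. N s x \<le> M powr (p - 1) * V s x"
      using *
    proof eventually_elim
      fix x assume "V s x \<le> M"
      then have "V s x powr (p - 1) * V s x \<le> M powr (p - 1) * V s x"
        using p V_nonneg by (intro mult_right_mono powr_mono2) auto
      moreover have "V s x powr (p - 1) * V s x = N s x"
      proof (cases "V s x = 0")
        case False
        then show ?thesis using V_nonneg[of s x] powr_add[of "V s x" "p - 1" 1] by (simp add: N_def)
      qed (simp add: N_def)
      ultimately show "N s x \<le> M powr (p - 1) * V s x" by simp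
    qed
    have i: "integrable lborel (N s)"
      by (rule Bochner_Integration.integrable_bound[of _ "\<lambda>x. M powr (p - 1) * V s x"])
         (use le integrable_V N_nonneg V_nonneg in \<open>auto elim!: eventually_mono\<close>)
    moreover have "(LINT x|lborel. N s x) \<le> (LINT x|lborel. M powr (p - 1) * V s x)"
      using le i integrable_V by (intro integral_mono_AE) auto
    moreover have "M powr (p - 1) * (LINT x|lborel. V s x) \<le> M powr (p - 1) * C"
      using C by (intro mult_left_mono) auto
    ultimately show "integrable lborel (N s) \<and> (LINT x|lborel. N s x) \<le> M powr (p - 1) * C" by simp
  qed
  then show ?thesis using that[of "M powr (p - 1) * C"] C by simp
qed

lemma measurable_fourier_V [measurable]: "(\<lambda>(s, \<xi>). fourier (V s) \<xi>) \<in> borel_measurable (borel \<Otimes>\<^sub>M borel)"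
  and measurable_fourier_N [measurable]: "(\<lambda>(s, \<xi>). fourier (N s) \<xi>) \<in> borel_measurable (borel \<Otimes>\<^sub>M borel)"
proof -
  have [measurable]: "(\<lambda>w. V (fst (fst w)) (snd w)) \<in> borel_measurable ((borel \<Otimes>\<^sub>M borel) \<Otimes>\<^sub>M lborel)"
    using measurable_compose[of "\<lambda>w. (fst (fst w), snd w)" "(borel \<Otimes>\<^sub>M borel) \<Otimes>\<^sub>M lborel" "borel \<Otimes>\<^sub>M borel", OF _ measurable_V]
    by simp
  have [measurable]: "(\<lambda>w. N (fst (fst w)) (snd w)) \<in> borel_measurable ((borel \<Otimes>\<^sub>M borel) \<Otimes>\<^sub>M lborel)"
    using measurable_compose[of "\<lambda>w. (fst (fst w), snd w)" "(borel \<Otimes>\<^sub>M borel) \<Otimes>\<^sub>M lborel" "borel \<Otimes>\<^sub>M borel", OF _ measurable_N]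
    by simp
  show "(\<lambda>(s, \<xi>). fourier (V s) \<xi>) \<in> borel_measurable (borel \<Otimes>\<^sub>M borel)"
    unfolding fourier_def split_beta' by measurable
  show "(\<lambda>(s, \<xi>). fourier (N s) \<xi>) \<in> borel_measurable (borel \<Otimes>\<^sub>M borel)"
    unfolding fourier_def split_beta' by measurable
qed

lemma measurable_fourier_N' [measurable]: "(\<lambda>s. fourier (N s) \<xi>) \<in> borel_measurable borel"
  using measurable_Pair_compose_split[OF measurable_fourier_N, of "\<lambda>s. s" borel "\<lambda>_. \<xi>"] by simp

lemma norm_fourier_N: "integrable lborel (N s) \<Longrightarrow> norm (fourier (N s) \<xi>) \<le> (LINT x|lborel. N s x)"
  and norm_fourier_V: "norm (fourier (V s) \<xi>) \<le> (LINT x|lborel. V s x)"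
  using norm_fourier_le[of "N s" \<xi>] norm_fourier_le[of "V s" \<xi>] integrable_V[of s]
  by (auto simp: N_nonneg V_nonneg)

text \<open>The joint integrability of the Duhamel integrand permits exchanging dx and ds; for fixed
  s the integrand is \<open>conv (Y (t - s)) (N s)\<close>, whose transform is a product.\<close>

lemma fourier_mild:
  assumes t: "t \<in> {0<..<T}"
  shows "fourier (V t) \<xi> = (indicator {0<..} t *\<^sub>R fourier_measure (Z t) \<xi>) * fourier u0 \<xi> +
     convolve (\<lambda>t. indicator {0<..} t *\<^sub>R fourier_measure (Y t) \<xi>) (\<lambda>s. fourier (N s) \<xi>) t"
proof -
  define D where "D = duhamel_integrand Y p u t"
  have 1: "L1_bochner_integrable {0<..<t} D" "eq_in_L1 (u t) (mild_rhs Z Y p u0 u t)"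
    using mild_solution t unfolding mild_solution_def D_def by auto
  have "(\<lambda>w. indicator ({0<..<t} \<times> UNIV) w *\<^sub>R (case w of (s, x) \<Rightarrow> D s x)) = (\<lambda>(s, x). indicator {0<..<t} s * D s x)"
    by (auto simp: indicator_def fun_eq_iff)
  then have intD: "integrable (lborel \<Otimes>\<^sub>M lborel) (\<lambda>(s, x). indicator {0<..<t} s * D s x)"
    using 1(1) unfolding L1_bochner_integrable_def set_integrable_def by simp
  have DC: "integrable (lborel \<Otimes>\<^sub>M lborel) (\<lambda>(s, x). of_real (indicator {0<..<t} s * D s x) * cis (- (x \<bullet> \<xi>)))"
  proof (rule Bochner_Integration.integrable_bound[OF intD])
    note [measurable] = borel_measurable_integrable[OF intD]
    have "(\<lambda>w. of_real (case w of (s, x) \<Rightarrow> indicator {0<..<t} s * D s x) * cis (- (snd w \<bullet> \<xi>)))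
      \<in> borel_measurable (lborel \<Otimes>\<^sub>M lborel)"
      by measurable
    then show "(\<lambda>(s, x). of_real (indicator {0<..<t} s * D s x) * cis (- (x \<bullet> \<xi>))) \<in> borel_measurable (lborel \<Otimes>\<^sub>M lborel)"
      by (simp add: split_beta')
  qed (auto simp: norm_mult)
  have zc: "finite_measure (Z t)" "sets (Z t) = sets borel"
    using Z_prob[of t] Z_sets[of t] t prob_space.axioms(1) by auto
  let ?J = "\<lambda>x. LINT s|lborel. indicator {0<..<t} s * D s x"
  have J: "integrable lborel ?J" using lborel_pair.integrable_snd[OF intD] .
  have "AE x in lborel. u t x = conv (Z t) u0 x + ?J x"
    using 1(2) t unfolding eq_in_L1_def mild_rhs_def S_op_def L1_bochner_integral_def D_def set_lebesgue_integral_def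
    by auto
  then have "fourier (u t) \<xi> = fourier (\<lambda>x. conv (Z t) u0 x + ?J x) \<xi>"
    using integrable_u[of t] t fourier_conv(1)[OF zc u0] J by (intro fourier_cong_AE) auto
  also have "\<dots> = fourier (conv (Z t) u0) \<xi> + fourier ?J \<xi>"
    using integrable_fourier[OF fourier_conv(1)[OF zc u0], of \<xi>] integrable_fourier[OF J, of \<xi>]
    unfolding fourier_def by (simp add: distrib_right)
  also have "fourier (conv (Z t) u0) \<xi> = fourier_measure (Z t) \<xi> * fourier u0 \<xi>"
    by (rule fourier_conv(2)[OF zc u0])
  also have "fourier ?J \<xi> = (LINT x|lborel. LINT s|lborel. of_real (indicator {0<..<t} s * D s x) * cis (- (x \<bullet> \<xi>)))"
    unfolding fourier_def by (simp del: of_real_mult)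
  also have "\<dots> = (LINT s|lborel. LINT x|lborel. of_real (indicator {0<..<t} s * D s x) * cis (- (x \<bullet> \<xi>)))"
    using lborel_pair.Fubini_integral[OF DC] .
  also have "\<dots> = convolve (\<lambda>t. indicator {0<..} t *\<^sub>R fourier_measure (Y t) \<xi>) (\<lambda>s. fourier (N s) \<xi>) t"
    unfolding convolve_def
  proof (rule integral_cong_AE)
    have "(\<lambda>t. indicator {0<..} t *\<^sub>R fourier_measure (Y t) \<xi>) \<in> borel_measurable borel"
      by (rule laplace_measurable[OF laplace_Y[of 1]]) simp
    from measurable_compose[OF _ this, of "\<lambda>s. t - s" borel]
    have "(\<lambda>s. indicator {0<..} (t - s) *\<^sub>R fourier_measure (Y (t - s)) \<xi>) \<in> borel_measurable borel"
      by simp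
    from borel_measurable_times[OF this measurable_fourier_N'[of \<xi>]]
    show "(\<lambda>s. indicator {0<..} (t - s) *\<^sub>R fourier_measure (Y (t - s)) \<xi> * fourier (N s) \<xi>) \<in> borel_measurable lborel"
      by simp
    show "(\<lambda>s. LINT x|lborel. of_real (indicator {0<..<t} s * D s x) * cis (- (x \<bullet> \<xi>))) \<in> borel_measurable lborel"
      using lborel_pair.integrable_fst[OF DC] by auto
    \<comment> \<open>\<open>N s\<close> is integrable for almost every s only, so the two
      s-integrands are compared almost everywhere.\<close>
    obtain C where "AE s in lborel. integrable lborel (N s) \<and> (LINT x|lborel. N s x) \<le> C" by (rule N_bounds)
    then show "AE s in lborel. (LINT x|lborel. of_real (indicator {0<..<t} s * D s x) * cis (- (x \<bullet> \<xi>))) =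
       indicator {0<..} (t - s) *\<^sub>R fourier_measure (Y (t - s)) \<xi> * fourier (N s) \<xi>"
    proof eventually_elim
      fix s assume Ns: "integrable lborel (N s) \<and> (LINT x|lborel. N s x) \<le> C"
      show "(LINT x|lborel. of_real (indicator {0<..<t} s * D s x) * cis (- (x \<bullet> \<xi>))) =
         indicator {0<..} (t - s) *\<^sub>R fourier_measure (Y (t - s)) \<xi> * fourier (N s) \<xi>"
      proof (cases "s \<in> {0<..<t}")
        case True
        then have "N s = (\<lambda>y. max 0 (u s y) powr p)" using t N_inside[of s] by auto
        then have "D s = conv (Y (t - s)) (N s)"
          by (simp add: D_def duhamel_integrand_def P_op_def)
        then show ?thesis
          using True fourier_conv(2)[of "Y (t - s)" "N s" \<xi>] Ns Y_finite[of "t - s"] Y_sets[of "t - s"]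
          by (simp add: fourier_def)
      next
        case False
        then have "s \<le> 0 \<or> t - s \<le> 0" by auto
        then show ?thesis using False by (auto simp: N_outside fourier_def)
      qed
    qed
  qed
  finally show ?thesis using t fourier_V[OF t] by simp
qed

text \<open>Laplace transforms need functions on the whole half-line. The source \<open>N\<close>,
  cut off at T, is bounded in L^1 with compact support in time, and U is the mild formula run with
  it for all t. U agrees with the transform of \<open>V\<close> on (0,T), which suffices because
  convolution with \<open>mass\<close> at time t sees only earlier times.\<close>

lemma fourier_equation:
  "AE t in lborel. t \<in> {0<..<T} \<longrightarrow>
     fourier (V t) \<xi> + of_real ((norm \<xi>)\<^sup>2) * convolve (\<lambda>t. of_real (mass t)) (\<lambda>s. fourier (V s) \<xi>) t =
     fourier u0 \<xi> + convolve (\<lambda>t. of_real (mass t)) (\<lambda>s. fourier (N s) \<xi>) t"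
proof -
  define U where "U = (\<lambda>t. (indicator {0<..} t *\<^sub>R fourier_measure (Z t) \<xi>) * fourier u0 \<xi> +
     convolve (\<lambda>t. indicator {0<..} t *\<^sub>R fourier_measure (Y t) \<xi>) (\<lambda>s. fourier (N s) \<xi>) t)"
  have lapN: "\<exists>\<nu>. laplace (\<lambda>s. fourier (N s) \<xi>) z \<nu>" if z: "0 < z" for z
  proof -
    obtain C where C: "0 \<le> C" "AE s in lborel. integrable lborel (N s) \<and> (LINT x|lborel. N s x) \<le> C" by (rule N_bounds)
    have measI: "(\<lambda>s. of_real (exp (- z * s)) * fourier (N s) \<xi>) \<in> borel_measurable lborel" by measurable
    have "integrable lborel (\<lambda>s. C * indicator {0<..<T} s :: real)"
      using T by (intro integrable_mult_right integrable_real_indicator) auto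
    moreover have "AE s in lborel. norm (of_real (exp (- z * s)) * fourier (N s) \<xi>) \<le> norm (C * indicator {0<..<T} s :: real)"
      using C(2)
    proof eventually_elim
      fix s assume Ns: "integrable lborel (N s) \<and> (LINT x|lborel. N s x) \<le> C"
      show "norm (of_real (exp (- z * s)) * fourier (N s) \<xi>) \<le> norm (C * indicator {0<..<T} s :: real)"
      proof (cases "s \<in> {0<..<T}")
        case True
        then have "norm (of_real (exp (- z * s)) * fourier (N s) \<xi>) \<le> 1 * C"
          unfolding norm_mult using Ns norm_fourier_N[of s \<xi>] z
          by (intro mult_mono) auto
        then show ?thesis using True C by simp
      qed (simp add: N_outside fourier_def)
    qed
    ultimately have "integrable lborel (\<lambda>s. of_real (exp (- z * s)) * fourier (N s) \<xi>)"
      using Bochner_Integration.integrable_bound measI by blast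
    then show ?thesis unfolding laplace_def by (auto simp: has_bochner_integral_iff)
  qed
  have UV: "U s = fourier (V s) \<xi>" if "s \<in> {0<..<T}" for s
    using fourier_mild[OF that] by (simp add: U_def)
  have U0: "U s = 0" if "s \<le> 0" for s
  proof -
    have "(\<lambda>r. indicator {0<..} (s - r) *\<^sub>R fourier_measure (Y (s - r)) \<xi> * fourier (N r) \<xi>) = (\<lambda>r. 0)"
    proof
      fix r
      show "indicator {0<..} (s - r) *\<^sub>R fourier_measure (Y (s - r)) \<xi> * fourier (N r) \<xi> = 0"
        using that by (cases "r \<le> 0") (auto simp: N_outside fourier_def)
    qed
    then show ?thesis using that by (simp add: U_def convolve_def)
  qed
  have convU: "convolve (\<lambda>t. of_real (mass t)) U t = convolve (\<lambda>t. of_real (mass t)) (\<lambda>s. fourier (V s) \<xi>) t"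
    if "t \<in> {0<..<T}" for t
    unfolding convolve_def
  proof (rule Bochner_Integration.integral_cong[OF refl])
    fix s
    show "of_real (mass (t - s)) * U s = of_real (mass (t - s)) * fourier (V s) \<xi>"
    proof (cases "s \<in> {0<..<t}")
      case True
      then show ?thesis using that UV[of s] by simp
    next
      case False
      then have "s \<le> 0 \<or> t - s \<le> 0" by auto
      then show ?thesis by (auto simp: U0 V_outside fourier_def mass_nonpos)
    qed
  qed
  have "AE t in lborel. 0 < t \<longrightarrow> U t + of_real ((norm \<xi>)\<^sup>2) * convolve (\<lambda>t. of_real (mass t)) U t =
      fourier u0 \<xi> + convolve (\<lambda>t. of_real (mass t)) (\<lambda>s. fourier (N s) \<xi>) t"
    unfolding U_def by (rule volterra_fourier[OF lapN]) (auto simp: N_outside fourier_def)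
  then show ?thesis
    by eventually_elim (use UV convU in auto)
qed

end

section \<open>Testing against a Gaussian\<close>

text \<open>Elementary Parseval: both sides are the double integral of m(\<xi>) g(x) e^(-i x
  \<bullet> \<xi>), absolutely convergent because m and g are integrable. The same argument gives
  integrability of g k without a bound on k.\<close>

lemma fourier_weight:
  assumes \<Gamma>: "finite_measure \<Gamma>" "sets \<Gamma> = sets borel" and g: "integrable lborel g"
    and m: "integrable \<Gamma> m" and k: "\<And>x. (LINT \<xi>|\<Gamma>. of_real (m \<xi>) * cis (- (x \<bullet> \<xi>))) = of_real (k x)"
  shows "(LINT \<xi>|\<Gamma>. of_real (m \<xi>) * fourier g \<xi>) = of_real (LINT x|lborel. g x * k x)"
    "integrable \<Gamma> (\<lambda>\<xi>. of_real (m \<xi>) * fourier g \<xi>)"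
    "integrable lborel (\<lambda>x. g x * k x)"
proof -
  interpret G: finite_measure \<Gamma> by fact
  interpret P: pair_sigma_finite "lborel :: 'a measure" \<Gamma> ..
  note [measurable_cong] = \<Gamma>(2)
  have [measurable]: "g \<in> borel_measurable borel" "m \<in> borel_measurable borel"
    using g m measurable_cong_sets[OF \<Gamma>(2) refl] by auto
  let ?F = "\<lambda>x \<xi>. of_real (m \<xi>) * (of_real (g x) * cis (- (x \<bullet> \<xi>))) :: complex"
  have "(\<lambda>(x, \<xi>). ?F x \<xi>) \<in> borel_measurable (lborel \<Otimes>\<^sub>M \<Gamma>)" by measurable
  then have int: "integrable (lborel \<Otimes>\<^sub>M \<Gamma>) (\<lambda>(x, \<xi>). ?F x \<xi>)"
    by (rule Bochner_Integration.integrable_bound[OF P.integrable_mult_pair[OF g m]]) (auto simp: norm_mult abs_mult)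
  have inner1: "(LINT x|lborel. ?F x \<xi>) = of_real (m \<xi>) * fourier g \<xi>" for \<xi>
    unfolding fourier_def by simp
  have inner2: "(LINT \<xi>|\<Gamma>. ?F x \<xi>) = of_real (g x * k x)" for x
  proof -
    have "(LINT \<xi>|\<Gamma>. ?F x \<xi>) = (LINT \<xi>|\<Gamma>. of_real (g x) * (of_real (m \<xi>) * cis (- (x \<bullet> \<xi>))))"
      by (simp add: mult.left_commute)
    then show ?thesis using k by simp
  qed
  have eq: "(LINT \<xi>|\<Gamma>. LINT x|lborel. ?F x \<xi>) = (LINT x|lborel. LINT \<xi>|\<Gamma>. ?F x \<xi>)"
    by (rule P.Fubini_integral[OF int])
  show "(LINT \<xi>|\<Gamma>. of_real (m \<xi>) * fourier g \<xi>) = of_real (LINT x|lborel. g x * k x)"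
    using eq unfolding inner1 inner2 by (simp del: of_real_mult)
  show "integrable \<Gamma> (\<lambda>\<xi>. of_real (m \<xi>) * fourier g \<xi>)"
    using P.integrable_snd[OF int] unfolding inner1 .
  show "integrable lborel (\<lambda>x. g x * k x)"
    using P.integrable_fst[OF int] unfolding inner2 complex_of_real_integrable_eq .
qed

text \<open>The tangent of v^p at m, as Young's inequality with exponents p and p/(p-1); this form
  also covers m = 0.\<close>

lemma powr_tangent:
  fixes v m p :: real
  assumes "0 \<le> v" "0 \<le> m" "1 < p"
  shows "p * m powr (p - 1) * v - (p - 1) * m powr p \<le> v powr p"
proof -
  have "v * m powr (p - 1) \<le> v powr p / p + (m powr (p - 1)) powr (p / (p - 1)) / (p / (p - 1))"
    using assms by (intro Youngs_inequality) (auto simp: field_simps)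
  moreover have "(m powr (p - 1)) powr (p / (p - 1)) = m powr p"
    using assms by (simp add: powr_powr)
  ultimately have "p * (v * m powr (p - 1)) \<le> p * (v powr p / p + m powr p / (p / (p - 1)))"
    using assms by (intro mult_left_mono) auto
  also have "\<dots> = v powr p + (p - 1) * m powr p" using assms by (simp add: field_simps)
  finally show ?thesis by (simp add: mult_ac)
qed

text \<open>The tangent at the weighted mean w/G is integrated against q. The weight has mass G
  instead of 1, hence the factor G^(1-p).\<close>

lemma jensen_powr_weight:
  fixes v q :: "'a \<Rightarrow> real"
  assumes "1 < p" and v: "\<And>x. 0 \<le> v x" and q: "\<And>x. 0 \<le> q x"
    and int: "integrable M (\<lambda>x. v x * q x)" "integrable M (\<lambda>x. v x powr p * q x)" "integrable M q"
    and pos: "0 < integral\<^sup>L M q"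
  shows "(integral\<^sup>L M q) powr (1 - p) * (LINT x|M. v x * q x) powr p \<le> (LINT x|M. v x powr p * q x)"
proof -
  define G where "G = integral\<^sup>L M q"
  define w where "w = (LINT x|M. v x * q x)"
  define m where "m = w / G"
  have w: "0 \<le> w" unfolding w_def using v q by simp
  have m: "0 \<le> m" using w pos by (simp add: m_def G_def)
  have "p * m powr (p - 1) * w - (p - 1) * m powr p * G =
     (LINT x|M. p * m powr (p - 1) * (v x * q x) - (p - 1) * m powr p * q x)"
    using int by (simp add: w_def G_def)
  also have "\<dots> \<le> (LINT x|M. v x powr p * q x)"
  proof (rule integral_mono)
    fix x
    have "(p * m powr (p - 1) * v x - (p - 1) * m powr p) * q x \<le> v x powr p * q x"
      using assms(1) v q m by (intro mult_right_mono powr_tangent) auto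
    then show "p * m powr (p - 1) * (v x * q x) - (p - 1) * m powr p * q x \<le> v x powr p * q x"
      by (simp add: algebra_simps)
  qed (use int in auto)
  also have "p * m powr (p - 1) * w - (p - 1) * m powr p * G = G powr (1 - p) * w powr p"
  proof (cases "w = 0")
    case False
    then have "0 < w" "0 < G" "0 < m" using w pos by (auto simp: m_def G_def)
    have "m powr (p - 1) * w = G * m powr p"
      using \<open>0 < w\<close> \<open>0 < m\<close> \<open>0 < G\<close> powr_add[of m "p - 1" 1] by (simp add: m_def)
    moreover have "G powr (1 - p) * w powr p = G * m powr p"
      using \<open>0 < w\<close> \<open>0 < G\<close> by (simp add: m_def powr_divide powr_diff)
    ultimately show ?thesis by (simp add: algebra_simps)
  qed (use assms(1) in \<open>simp add: m_def\<close>)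
  finally show ?thesis unfolding G_def w_def .
qed

section \<open>The tested equation and the resulting bound on the horizon\<close>

context mild
begin

lemma integrable_mass_reflect: "integrable lborel (\<lambda>s. mass (t - s) * indicator {0<..<T} s)"
proof -
  have "integrable lborel (\<lambda>s. indicator {0<..t} (t + (-1) * s) *\<^sub>R mass (t + (-1) * s))"
    using set_integrable_Ioc[of t] by (intro lborel_integrable_real_affine) (auto simp: set_integrable_def)
  then show ?thesis
  proof (rule Bochner_Integration.integrable_bound)
    show "AE s in lborel. norm (mass (t - s) * indicator {0<..<T} s) \<le> norm (indicator {0<..t} (t + (-1) * s) *\<^sub>R mass (t + (-1) * s))"
      by (auto simp: indicator_def mass_nonneg mass_nonpos)
  qed measurable
qed

text \<open>Moves the frequency integral inside the memory term; the majorant is C mass(t-s)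
  |m(\<xi>)| on 0 < s < T. It serves twice: for \<open>V\<close> with m = |\<xi>|^2 and for
  \<open>N\<close> with m = 1. In the second use r is identified for almost every s only.\<close>

lemma convolve_weight:
  fixes G :: "real \<Rightarrow> real ^ 'n \<Rightarrow> complex"
  assumes \<Gamma>: "finite_measure \<Gamma>" "sets \<Gamma> = sets borel" and m: "integrable \<Gamma> m"
    and G[measurable]: "(\<lambda>(s, \<xi>). G s \<xi>) \<in> borel_measurable (borel \<Otimes>\<^sub>M borel)"
    and bound: "AE s in lborel. \<forall>\<xi>. norm (G s \<xi>) \<le> C * indicator {0<..<T} s"
    and r: "AE s in lborel. (LINT \<xi>|\<Gamma>. of_real (m \<xi>) * G s \<xi>) = of_real (r s)"
    and r_meas[measurable]: "r \<in> borel_measurable borel"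
  shows "integrable \<Gamma> (\<lambda>\<xi>. of_real (m \<xi>) * convolve (\<lambda>t. of_real (mass t)) (\<lambda>s. G s \<xi>) t)"
    "(LINT \<xi>|\<Gamma>. of_real (m \<xi>) * convolve (\<lambda>t. of_real (mass t)) (\<lambda>s. G s \<xi>) t) =
      of_real (LINT s|lborel. mass (t - s) * r s)"
    "integrable lborel (\<lambda>s. mass (t - s) * r s)"
proof -
  interpret G: finite_measure \<Gamma> by fact
  interpret P: pair_sigma_finite "lborel :: real measure" \<Gamma> ..
  note [measurable_cong] = \<Gamma>(2)
  have [measurable]: "m \<in> borel_measurable borel"
    using m measurable_cong_sets[OF \<Gamma>(2) refl] by auto
  let ?F = "\<lambda>s \<xi>. of_real (mass (t - s)) * (of_real (m \<xi>) * G s \<xi>) :: complex"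
  have meas: "(\<lambda>(s, \<xi>). ?F s \<xi>) \<in> borel_measurable (lborel \<Otimes>\<^sub>M \<Gamma>)" by measurable
  have int: "integrable (lborel \<Otimes>\<^sub>M \<Gamma>) (\<lambda>(s, \<xi>). ?F s \<xi>)"
  proof (rule Bochner_Integration.integrable_bound[OF _ meas])
    show "integrable (lborel \<Otimes>\<^sub>M \<Gamma>) (\<lambda>(s, \<xi>). (C * (mass (t - s) * indicator {0<..<T} s)) * m \<xi>)"
      using integrable_mass_reflect[of t] m by (intro P.integrable_mult_pair integrable_mult_right) auto
    have "AE z in lborel \<Otimes>\<^sub>M \<Gamma>. norm (G (fst z) (snd z)) \<le> C * indicator {0<..<T} (fst z)"
    proof (rule P.AE_pair_measure)
      show "{z \<in> space (lborel \<Otimes>\<^sub>M \<Gamma>). norm (G (fst z) (snd z)) \<le> C * indicator {0<..<T} (fst z)} \<in> sets (lborel \<Otimes>\<^sub>M \<Gamma>)"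
        by measurable
      show "AE s in lborel. AE \<xi> in \<Gamma>. norm (G (fst (s, \<xi>)) (snd (s, \<xi>))) \<le> C * indicator {0<..<T} (fst (s, \<xi>))"
        using bound by (auto elim!: eventually_mono)
    qed
    then show "AE z in lborel \<Otimes>\<^sub>M \<Gamma>. norm (case z of (s, \<xi>) \<Rightarrow> ?F s \<xi>) \<le>
        norm (case z of (s, \<xi>) \<Rightarrow> (C * (mass (t - s) * indicator {0<..<T} s)) * m \<xi>)"
    proof eventually_elim
      fix z :: "real \<times> (real ^ 'n)"
      assume *: "norm (G (fst z) (snd z)) \<le> C * indicator {0<..<T} (fst z)"
      obtain s \<xi> where z: "z = (s, \<xi>)" by (cases z)
      have "norm (?F s \<xi>) = mass (t - s) * \<bar>m \<xi>\<bar> * norm (G s \<xi>)"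
        by (simp add: norm_mult mass_nonneg)
      also have "\<dots> \<le> mass (t - s) * \<bar>m \<xi>\<bar> * (C * indicator {0<..<T} s)"
        using * by (intro mult_left_mono) (auto simp: z mass_nonneg)
      also have "\<dots> = (C * indicator {0<..<T} s) * (mass (t - s) * \<bar>m \<xi>\<bar>)" by simp
      also have "\<dots> \<le> \<bar>C * indicator {0<..<T} s\<bar> * (mass (t - s) * \<bar>m \<xi>\<bar>)"
        by (intro mult_right_mono) (auto simp: mass_nonneg)
      finally show "norm (case z of (s, \<xi>) \<Rightarrow> ?F s \<xi>) \<le> norm (case z of (s, \<xi>) \<Rightarrow> (C * (mass (t - s) * indicator {0<..<T} s)) * m \<xi>)"
        by (simp add: z abs_mult mass_nonneg mult_ac)
    qed
  qed
  have inner1: "(LINT s|lborel. ?F s \<xi>) = of_real (m \<xi>) * convolve (\<lambda>t. of_real (mass t)) (\<lambda>s. G s \<xi>) t" for \<xi>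
  proof -
    have "(LINT s|lborel. ?F s \<xi>) = (LINT s|lborel. of_real (m \<xi>) * (of_real (mass (t - s)) * G s \<xi>))"
      by (simp add: mult.left_commute)
    then show ?thesis unfolding convolve_def by simp
  qed
  have inner2: "AE s in lborel. (LINT \<xi>|\<Gamma>. ?F s \<xi>) = of_real (mass (t - s) * r s)"
    using r by eventually_elim simp
  have meas2: "(\<lambda>s. LINT \<xi>|\<Gamma>. ?F s \<xi>) \<in> borel_measurable lborel"
    using P.integrable_fst[OF int] by auto
  have eq: "(LINT \<xi>|\<Gamma>. LINT s|lborel. ?F s \<xi>) = (LINT s|lborel. LINT \<xi>|\<Gamma>. ?F s \<xi>)"
    by (rule P.Fubini_integral[OF int])
  also have "\<dots> = (LINT s|lborel. of_real (mass (t - s) * r s))"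
    by (rule integral_cong_AE[OF meas2 _ inner2]) measurable
  finally show "(LINT \<xi>|\<Gamma>. of_real (m \<xi>) * convolve (\<lambda>t. of_real (mass t)) (\<lambda>s. G s \<xi>) t) =
      of_real (LINT s|lborel. mass (t - s) * r s)"
    unfolding inner1 by (simp del: of_real_mult)
  show "integrable \<Gamma> (\<lambda>\<xi>. of_real (m \<xi>) * convolve (\<lambda>t. of_real (mass t)) (\<lambda>s. G s \<xi>) t)"
    using P.integrable_snd[OF int] unfolding inner1 .
  have "integrable lborel (\<lambda>s. of_real (mass (t - s) * r s) :: complex)"
    by (rule integrable_cong_AE_imp[OF P.integrable_fst[OF int] _ inner2]) measurable
  then show "integrable lborel (\<lambda>s. mass (t - s) * r s)" unfolding complex_of_real_integrable_eq .
qed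

lemma measurable_integral_V:
  assumes [measurable]: "k \<in> borel_measurable borel"
  shows "(\<lambda>s. LINT x|lborel. V s x * k x) \<in> borel_measurable borel"
    "(\<lambda>s. LINT x|lborel. N s x * k x) \<in> borel_measurable borel"
  by measurable

text \<open>\<open>fourier_equation\<close> has a null set of times depending on \<xi>. Fubini for
  null sets turns it, for almost every t, into an identity for \<Gamma>-almost every \<xi>, which
  can be integrated. For the Gaussian measure q is the test function and \<eta> is minus its
  Laplacian.\<close>

lemma weak_equation:
  assumes \<Gamma>: "prob_space \<Gamma>" "sets \<Gamma> = sets borel" and m: "integrable \<Gamma> (\<lambda>\<xi>. (norm \<xi>)\<^sup>2)"
    and q: "\<And>x. (LINT \<xi>|\<Gamma>. cis (- (x \<bullet> \<xi>))) = of_real (q x)" "q \<in> borel_measurable borel"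
    and \<eta>: "\<And>x. (LINT \<xi>|\<Gamma>. of_real ((norm \<xi>)\<^sup>2) * cis (- (x \<bullet> \<xi>))) = of_real (\<eta> x)" "\<eta> \<in> borel_measurable borel"
  shows "AE t in lborel. t \<in> {0<..<T} \<longrightarrow>
      (LINT x|lborel. V t x * q x) + (LINT s|lborel. mass (t - s) * (LINT x|lborel. V s x * \<eta> x)) =
      (LINT x|lborel. u0 x * q x) + (LINT s|lborel. mass (t - s) * (LINT x|lborel. N s x * q x))" (is ?A)
    "integrable lborel (\<lambda>s. mass (t - s) * (LINT x|lborel. V s x * \<eta> x))" (is ?B)
    "integrable lborel (\<lambda>s. mass (t - s) * (LINT x|lborel. N s x * q x))" (is ?C)
proof -
  interpret G: prob_space \<Gamma> by fact
  interpret P: pair_sigma_finite "lborel :: real measure" \<Gamma> ..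
  have fin: "finite_measure \<Gamma>" by (rule G.finite_measure_axioms)
  note [measurable_cong] = \<Gamma>(2)
  have one: "integrable \<Gamma> (\<lambda>\<xi>. 1::real)" by simp
  have q1: "(LINT \<xi>|\<Gamma>. of_real 1 * cis (- (x \<bullet> \<xi>))) = of_real (q x)" for x using q by simp
  obtain C M where V: "0 \<le> C" "0 \<le> M" "\<And>s. (LINT x|lborel. V s x) \<le> C"
    "AE s in lborel. AE x in lborel. V s x \<le> M" using V_bounds by metis
  obtain C' where C': "0 \<le> C'" "AE s in lborel. integrable lborel (N s) \<and> (LINT x|lborel. N s x) \<le> C'"
    using N_bounds by metis
  have bV: "AE s in lborel. \<forall>\<xi>. norm (fourier (V s) \<xi>) \<le> C * indicator {0<..<T} s"
  proof (intro AE_I2 allI)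
    fix s \<xi> show "norm (fourier (V s) \<xi>) \<le> C * indicator {0<..<T} s"
      using order_trans[OF norm_fourier_V V(3), of s \<xi>] by (cases "s \<in> {0<..<T}") (auto simp: V_outside fourier_def)
  qed
  have bN: "AE s in lborel. \<forall>\<xi>. norm (fourier (N s) \<xi>) \<le> C' * indicator {0<..<T} s"
    using C'(2)
  proof (eventually_elim, intro allI)
    fix s \<xi> assume "integrable lborel (N s) \<and> (LINT x|lborel. N s x) \<le> C'"
    then show "norm (fourier (N s) \<xi>) \<le> C' * indicator {0<..<T} s"
      using norm_fourier_N[of s \<xi>] by (cases "s \<in> {0<..<T}") (auto simp: N_outside fourier_def)
  qed
  have rV: "AE s in lborel. (LINT \<xi>|\<Gamma>. of_real ((norm \<xi>)\<^sup>2) * fourier (V s) \<xi>) = of_real (LINT x|lborel. V s x * \<eta> x)"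
    using fourier_weight(1)[OF fin \<Gamma>(2) integrable_V m \<eta>(1)] by (intro AE_I2)
  have rN: "AE s in lborel. (LINT \<xi>|\<Gamma>. of_real 1 * fourier (N s) \<xi>) = of_real (LINT x|lborel. N s x * q x)"
    using C'(2) by eventually_elim (rule fourier_weight(1)[OF fin \<Gamma>(2) _ one q1], auto)
  note cV = convolve_weight[OF fin \<Gamma>(2) m measurable_fourier_V bV rV measurable_integral_V(1)[OF \<eta>(2)]]
  note cN = convolve_weight[OF fin \<Gamma>(2) one measurable_fourier_N bN rN measurable_integral_V(2)[OF q(2)]]
  show ?B ?C by (rule cV(3), rule cN(3))
  let ?P = "\<lambda>t \<xi>. t \<in> {0<..<T} \<longrightarrow>
     fourier (V t) \<xi> + of_real ((norm \<xi>)\<^sup>2) * convolve (\<lambda>t. of_real (mass t)) (\<lambda>s. fourier (V s) \<xi>) t =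
     fourier u0 \<xi> + convolve (\<lambda>t. of_real (mass t)) (\<lambda>s. fourier (N s) \<xi>) t"
  have [measurable]: "fourier u0 \<in> borel_measurable borel"
    using u0 unfolding fourier_def[abs_def] by measurable
  have [measurable]: "(\<lambda>z. convolve (\<lambda>t. of_real (mass t)) (\<lambda>s. fourier (V s) (snd z)) (fst z)) \<in> borel_measurable (lborel \<Otimes>\<^sub>M \<Gamma>)"
    "(\<lambda>z. convolve (\<lambda>t. of_real (mass t)) (\<lambda>s. fourier (N s) (snd z)) (fst z)) \<in> borel_measurable (lborel \<Otimes>\<^sub>M \<Gamma>)"
    unfolding convolve_def by measurable
  have "(AE t in lborel. AE \<xi> in \<Gamma>. ?P t \<xi>) \<longleftrightarrow> (AE \<xi> in \<Gamma>. AE t in lborel. ?P t \<xi>)"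
  proof (rule P.AE_commute)
    show "{z \<in> space (lborel \<Otimes>\<^sub>M \<Gamma>). ?P (fst z) (snd z)} \<in> sets (lborel \<Otimes>\<^sub>M \<Gamma>)" by measurable
  qed
  then have "AE t in lborel. AE \<xi> in \<Gamma>. ?P t \<xi>" using fourier_equation by simp
  then show ?A
  proof eventually_elim
    fix t assume *: "AE \<xi> in \<Gamma>. ?P t \<xi>"
    show "t \<in> {0<..<T} \<longrightarrow>
      (LINT x|lborel. V t x * q x) + (LINT s|lborel. mass (t - s) * (LINT x|lborel. V s x * \<eta> x)) =
      (LINT x|lborel. u0 x * q x) + (LINT s|lborel. mass (t - s) * (LINT x|lborel. N s x * q x))"
    proof
      assume t: "t \<in> {0<..<T}"
      let ?cV = "\<lambda>\<xi>. of_real ((norm \<xi>)\<^sup>2) * convolve (\<lambda>t. of_real (mass t)) (\<lambda>s. fourier (V s) \<xi>) t"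
      let ?cN = "\<lambda>\<xi>. of_real 1 * convolve (\<lambda>t. of_real (mass t)) (\<lambda>s. fourier (N s) \<xi>) t"
      note fV = fourier_weight[OF fin \<Gamma>(2) integrable_V one q1, of t]
      note f0 = fourier_weight[OF fin \<Gamma>(2) u0 one q1]
      have "(LINT \<xi>|\<Gamma>. of_real 1 * fourier (V t) \<xi> + ?cV \<xi>) = (LINT \<xi>|\<Gamma>. of_real 1 * fourier u0 \<xi> + ?cN \<xi>)"
      proof (rule integral_cong_AE)
        show "AE \<xi> in \<Gamma>. of_real 1 * fourier (V t) \<xi> + ?cV \<xi> = of_real 1 * fourier u0 \<xi> + ?cN \<xi>"
          using * t by auto
      qed (use fV(2) f0(2) cV(1)[of t] cN(1)[of t] in \<open>auto intro!: borel_measurable_add\<close>)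
      also have "(LINT \<xi>|\<Gamma>. of_real 1 * fourier (V t) \<xi> + ?cV \<xi>) =
          of_real ((LINT x|lborel. V t x * q x) + (LINT s|lborel. mass (t - s) * (LINT x|lborel. V s x * \<eta> x)))"
        using fV(1,2) cV(1,2)[of t] by simp
      also have "(LINT \<xi>|\<Gamma>. of_real 1 * fourier u0 \<xi> + ?cN \<xi>) =
          of_real ((LINT x|lborel. u0 x * q x) + (LINT s|lborel. mass (t - s) * (LINT x|lborel. N s x * q x)))"
        using f0(1,2) cN(1,2)[of t] by simp
      finally show "(LINT x|lborel. V t x * q x) + (LINT s|lborel. mass (t - s) * (LINT x|lborel. V s x * \<eta> x)) =
      (LINT x|lborel. u0 x * q x) + (LINT s|lborel. mass (t - s) * (LINT x|lborel. N s x * q x))"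
        unfolding of_real_eq_iff .
    qed
  qed
qed

lemma initial_value: "AE x in lborel. u 0 x = u0 x"
proof -
  have "eq_in_L1 (u 0) (mild_rhs Z Y p u0 u 0)"
    using mild_solution T unfolding mild_solution_def by auto
  then show ?thesis
    unfolding eq_in_L1_def mild_rhs_def S_op_def L1_bochner_integral_def set_lebesgue_integral_def by simp
qed

text \<open>\<open>large\<close> makes the diffusive loss at most half of b x^p for all x \<ge> a/2,
  which leaves \<beta> = b/2; the factor 1/(8e) comes from \<open>K_scale\<close>. In the
  application \<sigma> = 1/R, and b is the Jensen factor of the Gaussian.\<close>

lemma mild_K_bound:
  assumes \<sigma>: "0 < \<sigma>" and a: "0 < a" "a \<le> (LINT x|lborel. u0 x * exp (- (\<sigma> * norm x)\<^sup>2 / 2))"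
    and b: "b = ((sqrt (2 * pi) / \<sigma>) ^ CARD('n)) powr (1 - p)"
    and large: "2 * (real CARD('n) * \<sigma>\<^sup>2) \<le> b * (a / 2) powr (p - 1)"
  shows "K mass T < 2 / (1 / (8 * exp 1) * (1 - 2 powr (1 - p))) * (a powr (1 - p) / (b / 2))"
proof -
  define q where "q = (\<lambda>x::real ^ 'n. exp (- (\<sigma> * norm x)\<^sup>2 / 2))"
  define \<eta> where "\<eta> = (\<lambda>x::real ^ 'n. \<sigma>\<^sup>2 * (real CARD('n) - (\<sigma> * norm x)\<^sup>2) * q x)"
  define l where "l = real CARD('n) * \<sigma>\<^sup>2"
  have [measurable]: "q \<in> borel_measurable borel" "\<eta> \<in> borel_measurable borel"
    unfolding q_def \<eta>_def by measurable
  have q01: "0 < q x" "q x \<le> 1" "\<bar>q x\<bar> \<le> 1" for x by (auto simp: q_def)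
  have q_int: "integrable lborel q" "integral\<^sup>L lborel q = (sqrt (2 * pi) / \<sigma>) ^ CARD('n)"
    using has_bochner_integral_gaussian[OF \<sigma>, where 'a = "real ^ 'n"] unfolding q_def by (auto simp: has_bochner_integral_iff)
  have q_pos: "0 < integral\<^sup>L lborel q" unfolding q_int using \<sigma> by simp
  have bpos: "0 < b" unfolding b using \<sigma> by simp
  have lpos: "0 < l" unfolding l_def using \<sigma> by simp
  \<comment> \<open>The discarded part of \<eta>, with the factor -(\<sigma>|x|)^2, is nonpositive;
    as \<open>V\<close> is nonnegative, dropping it only strengthens the loss.\<close>
  have \<eta>_le: "\<eta> x \<le> l * q x" for x
  proof -
    have "\<sigma>\<^sup>2 * (real CARD('n) - (\<sigma> * norm x)\<^sup>2) \<le> \<sigma>\<^sup>2 * real CARD('n)"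
      by (intro mult_left_mono) auto
    then show ?thesis unfolding \<eta>_def l_def using q01(1)[of x]
      by (intro mult_right_mono) (auto simp: mult.commute)
  qed
  have weak: "AE t in lborel. t \<in> {0<..<T} \<longrightarrow>
      (LINT x|lborel. V t x * q x) + (LINT s|lborel. mass (t - s) * (LINT x|lborel. V s x * \<eta> x)) =
      (LINT x|lborel. u0 x * q x) + (LINT s|lborel. mass (t - s) * (LINT x|lborel. N s x * q x))"
    "integrable lborel (\<lambda>s. mass (t - s) * (LINT x|lborel. V s x * \<eta> x))"
    "integrable lborel (\<lambda>s. mass (t - s) * (LINT x|lborel. N s x * q x))" for t
    using weak_equation[of "gauss \<sigma>" q \<eta>] prob_space_gauss[of \<sigma>, where 'a = "real ^ 'n"]
      integral_gauss_power2_cis[of \<sigma>, where 'a = "real ^ 'n"] integral_gauss_cis[of \<sigma>, where 'a = "real ^ 'n"]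
    by (auto simp: q_def \<eta>_def)
  have Vq: "integrable lborel (\<lambda>x. V s x * q x)" for s
    using mult_left_le[OF q01(2) V_nonneg] q01(1)
    by (intro Bochner_Integration.integrable_bound[OF integrable_V[of s]]) (auto simp: abs_mult V_nonneg less_imp_le)
  have V\<eta>: "integrable lborel (\<lambda>x. V s x * \<eta> x)" for s
  proof (rule fourier_weight(3)[of "gauss \<sigma>"])
    show "(LINT \<xi>|gauss \<sigma>. of_real ((norm \<xi>)\<^sup>2) * cis (- (x \<bullet> \<xi>))) = of_real (\<eta> x)" for x
      unfolding integral_gauss_power2_cis(2) by (simp add: \<eta>_def q_def)
  qed (use prob_space_gauss[of \<sigma>, where 'a = "real ^ 'n"] integral_gauss_power2_cis(1)[of \<sigma>, where 'a = "real ^ 'n"] integrable_V[of s]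
      in \<open>auto simp: prob_space.axioms(1) intro: prob_space.finite_measure\<close>)
  \<comment> \<open>w is continuous up to both endpoints because u is, while w' is measurable on the
    whole line; they agree on (0,T).\<close>
  define w where "w = (\<lambda>t. LINT x|lborel. u t x * q x)"
  define w' where "w' = (\<lambda>s. LINT x|lborel. V s x * q x)"
  have w'_meas [measurable]: "w' \<in> borel_measurable borel" unfolding w'_def by (rule measurable_integral_V) simp
  have ww': "w s = w' s" if "s \<in> {0<..<T}" for s
    unfolding w_def w'_def using V_eq_u[OF that] integrable_u[of s] that
    by (intro integral_cong_AE) (auto elim!: eventually_mono)
  obtain C M where V: "0 \<le> C" "0 \<le> M" "\<And>s. (LINT x|lborel. V s x) \<le> C"
    "AE s in lborel. AE x in lborel. V s x \<le> M" using V_bounds by metis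
  obtain C' where C': "0 \<le> C'" "AE s in lborel. integrable lborel (N s) \<and> (LINT x|lborel. N s x) \<le> C'"
    using N_bounds by metis
  have w'_bound: "0 \<le> w' s" "w' s \<le> C" for s
  proof -
    show "0 \<le> w' s" unfolding w'_def by (intro integral_nonneg_AE AE_I2 mult_nonneg_nonneg V_nonneg less_imp_le[OF q01(1)])
    have "w' s \<le> (LINT x|lborel. V s x)" unfolding w'_def
      using mult_left_le[OF q01(2) V_nonneg] by (intro integral_mono Vq integrable_V)
    then show "w' s \<le> C" using V(3)[of s] by simp
  qed
  \<comment> \<open>Reaction minus diffusion; the maximum gives continuity on the whole line and is
    inactive at the nonnegative values of w'.\<close>
  define F where "F = (\<lambda>x::real. b * (max 0 x) powr p - l * x)"
  have Fcont: "continuous_on UNIV F"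
    unfolding F_def using p by (intro continuous_intros continuous_on_powr') auto
  then have [measurable]: "F \<in> borel_measurable borel" by (rule borel_measurable_continuous_onI)
  have F_lower: "b / 2 * x powr p \<le> F x" if x: "a / 2 \<le> x" for x
  proof -
    have x0: "0 < x" using x a by simp
    have "2 * l \<le> b * (a / 2) powr (p - 1)" using large by (simp add: l_def)
    also have "\<dots> \<le> b * x powr (p - 1)"
      using x a p bpos by (intro mult_left_mono powr_mono2) auto
    finally have "2 * l * x \<le> b * x powr (p - 1) * x" using x0 by (intro mult_right_mono) auto
    also have "\<dots> = b * x powr p" using x0 powr_add[of x "p - 1" 1] by simp
    finally show ?thesis using x0 by (simp add: F_def)
  qed
  have key: "AE s in lborel. F (w' s) \<le> (LINT x|lborel. N s x * q x) - (LINT x|lborel. V s x * \<eta> x)"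
    using C'(2)
  proof eventually_elim
    fix s assume Ns: "integrable lborel (N s) \<and> (LINT x|lborel. N s x) \<le> C'"
    have "integrable lborel (\<lambda>x. N s x * q x)"
      using mult_left_le[OF q01(2) N_nonneg] q01(1)
      by (intro Bochner_Integration.integrable_bound[OF conjunct1[OF Ns]]) (auto simp: abs_mult N_nonneg less_imp_le)
    then have "b * w' s powr p \<le> (LINT x|lborel. N s x * q x)"
      using jensen_powr_weight[OF p V_nonneg[of s] less_imp_le[OF q01(1)] Vq _ q_int(1) q_pos]
      unfolding b N_def w'_def q_int(2) by simp
    moreover have "(LINT x|lborel. V s x * \<eta> x) \<le> (LINT x|lborel. l * (V s x * q x))"
      using V\<eta> Vq mult_left_mono[OF \<eta>_le V_nonneg] by (intro integral_mono) (auto simp: mult_ac)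
    ultimately show "F (w' s) \<le> (LINT x|lborel. N s x * q x) - (LINT x|lborel. V s x * \<eta> x)"
      using w'_bound[of s] by (simp add: F_def w'_def)
  qed
  show ?thesis
  proof (rule volterra_blowup[where w = w and F = F])
    show "continuous_on {0..T} w" unfolding w_def using q01(3) by (intro continuous_on_integral_u) auto
    have w0: "w 0 = (LINT x|lborel. u0 x * q x)"
      unfolding w_def using initial_value integrable_u[of 0] u0 T
      by (intro integral_cong_AE) (auto elim!: eventually_mono)
    then show "a \<le> w 0" using a(2) by (simp add: q_def)
    show "AE t in lborel. t \<in> {0<..<T} \<longrightarrow> a + (LINT s:{0<..<t}|lborel. mass (t - s) * F (w s)) \<le> w t"
      using weak(1)
    proof eventually_elim
      fix t
      assume *: "t \<in> {0<..<T} \<longrightarrow>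
        (LINT x|lborel. V t x * q x) + (LINT s|lborel. mass (t - s) * (LINT x|lborel. V s x * \<eta> x)) =
        (LINT x|lborel. u0 x * q x) + (LINT s|lborel. mass (t - s) * (LINT x|lborel. N s x * q x))"
      show "t \<in> {0<..<T} \<longrightarrow> a + (LINT s:{0<..<t}|lborel. mass (t - s) * F (w s)) \<le> w t"
      proof
        assume t: "t \<in> {0<..<T}"
        have Fb: "\<bar>F (w' s)\<bar> \<le> b * C powr p + l * C" for s
        proof -
          have "0 \<le> b * w' s powr p" "b * w' s powr p \<le> b * C powr p" "0 \<le> l * w' s" "l * w' s \<le> l * C"
            using w'_bound[of s] bpos lpos p by (auto intro!: mult_left_mono powr_mono2)
          then show ?thesis using w'_bound[of s] by (simp add: F_def)
        qed
        have Fi: "integrable lborel (\<lambda>s. indicator {0<..<t} s *\<^sub>R (mass (t - s) * F (w' s)))"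
        proof (rule Bochner_Integration.integrable_bound)
          show "integrable lborel (\<lambda>s. (b * C powr p + l * C) * (mass (t - s) * indicator {0<..<T} s))"
            using integrable_mass_reflect[of t] by simp
          show "AE s in lborel. norm (indicator {0<..<t} s *\<^sub>R (mass (t - s) * F (w' s))) \<le>
             norm ((b * C powr p + l * C) * (mass (t - s) * indicator {0<..<T} s))"
          proof (intro AE_I2)
            fix s
            have "\<bar>F (w' s)\<bar> * mass (t - s) \<le> \<bar>b * C powr p + l * C\<bar> * mass (t - s)"
              using order_trans[OF Fb abs_ge_self] by (intro mult_right_mono mass_nonneg)
            then show "norm (indicator {0<..<t} s *\<^sub>R (mass (t - s) * F (w' s))) \<le>
             norm ((b * C powr p + l * C) * (mass (t - s) * indicator {0<..<T} s))"
              using t by (auto simp: indicator_def abs_mult mass_nonneg mult_ac)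
          qed
        qed measurable
        have "(LINT s:{0<..<t}|lborel. mass (t - s) * F (w s)) = (LINT s|lborel. indicator {0<..<t} s *\<^sub>R (mass (t - s) * F (w' s)))"
          unfolding set_lebesgue_integral_def using t ww'
          by (intro Bochner_Integration.integral_cong) (auto simp: indicator_def)
        also have "\<dots> \<le> (LINT s|lborel. mass (t - s) * (LINT x|lborel. N s x * q x) - mass (t - s) * (LINT x|lborel. V s x * \<eta> x))"
        proof (rule integral_mono_AE[OF Fi Bochner_Integration.integrable_diff[OF weak(3) weak(2)]])
          show "AE s in lborel. indicator {0<..<t} s *\<^sub>R (mass (t - s) * F (w' s)) \<le>
            mass (t - s) * (LINT x|lborel. N s x * q x) - mass (t - s) * (LINT x|lborel. V s x * \<eta> x)"
            using key
          proof eventually_elim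
            fix s assume k: "F (w' s) \<le> (LINT x|lborel. N s x * q x) - (LINT x|lborel. V s x * \<eta> x)"
            show "indicator {0<..<t} s *\<^sub>R (mass (t - s) * F (w' s)) \<le>
              mass (t - s) * (LINT x|lborel. N s x * q x) - mass (t - s) * (LINT x|lborel. V s x * \<eta> x)"
            proof (cases "s \<in> {0<..<t}")
              case True
              then show ?thesis using mult_left_mono[OF k mass_nonneg[of "t - s"]] by (simp add: right_diff_distrib)
            next
              case False
              then have "s \<le> 0 \<or> t - s \<le> 0" by auto
              then show ?thesis by (auto simp: mass_nonpos V_outside N_outside)
            qed
          qed
        qed
        also have "\<dots> = w' t - w 0"
          using * t w0 weak(2)[of t] weak(3)[of t] by (simp add: w'_def)
        finally show "a + (LINT s:{0<..<t}|lborel. mass (t - s) * F (w s)) \<le> w t"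
          using ww'[OF t] \<open>a \<le> w 0\<close> by simp
      qed
    qed
    show "1 / (8 * exp 1) * r * K mass T \<le> K mass (r * T)" if "0 < r" "r \<le> 1" for r
      using K_scale[OF T that] by simp
  qed (use p T a bpos Fcont F_lower mass_nonneg set_integrable_Ioc in auto)
qed

end

section \<open>Lifespan bound\<close>

lemma (in laplace_kernel) K_continuous: "continuous_on {0..b} (K \<kappa>)"
proof -
  let ?k = "\<lambda>s. indicator {0<..} s * \<kappa> s"
  have int: "set_integrable lborel {0..t} ?k" and K_eq: "K \<kappa> t = integral {0..t} ?k" for t
  proof -
    have "(\<lambda>s. indicator {0..t} s *\<^sub>R ?k s) = (\<lambda>s. indicator {0<..t} s *\<^sub>R \<kappa> s)"
      by (auto simp: indicator_def fun_eq_iff)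
    then have "set_integrable lborel {0..t} ?k \<and> K \<kappa> t = (LINT s:{0..t}|lborel. ?k s)"
      using set_integrable_Ioc[of t] unfolding set_integrable_def K_def set_lebesgue_integral_def by simp
    then show "set_integrable lborel {0..t} ?k" "K \<kappa> t = integral {0..t} ?k"
      using set_borel_integral_eq_integral(2) by auto
  qed
  have "continuous_on {0..b} (\<lambda>t. integral {0..t} ?k)"
    by (rule indefinite_integral_continuous_1) (rule set_borel_integral_eq_integral(1)[OF int])
  then show ?thesis unfolding K_eq[abs_def] .
qed

text \<open>The intermediate value theorem puts y into the range, so \<open>inv_into\<close> returns
  a genuine preimage; monotonicity of K then yields the comparison of times.\<close>

lemma (in laplace_kernel) K_inv_into:
  assumes unbdd: "0 \<le> b" "y \<le> K \<kappa> b" and y: "0 \<le> y"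
  shows "0 \<le> inv_into {0..} (K \<kappa>) y" "K \<kappa> (inv_into {0..} (K \<kappa>) y) = y"
proof -
  have "K \<kappa> 0 = 0" by (simp add: K_def set_lebesgue_integral_def)
  then obtain s where "0 \<le> s" "s \<le> b" "K \<kappa> s = y"
    using IVT'[of "K \<kappa>" 0 y b] unbdd y K_continuous by auto
  then have "y \<in> K \<kappa> ` {0..}" by auto
  then show "0 \<le> inv_into {0..} (K \<kappa>) y" "K \<kappa> (inv_into {0..} (K \<kappa>) y) = y"
    using inv_into_into[of y "K \<kappa>" "{0..}"] f_inv_into_f[of y "K \<kappa>" "{0..}"] by auto
qed

text \<open>The exponent at 1/t is \<alpha>2 + (\<alpha>1 - \<alpha>2)/(ct + 1). The correction is
  harmless: ln t \<le> t \<le> (ct + 1)/c bounds the remaining power by e^(1/c).\<close>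

lemma symbol_upper_bound:
  fixes \<alpha>1 \<alpha>2 c t :: real
  assumes \<alpha>: "0 < \<alpha>1" "\<alpha>2 < 1" and c: "0 < c" and t: "1 \<le> t"
  shows "(1 / t) powr ((\<alpha>2 * c + \<alpha>1 * (1 / t)) / (c + 1 / t)) \<le> exp (1 / c) * t powr - \<alpha>2"
proof -
  have D: "0 < c * t + 1" "0 < c + 1 / t" using c t by (auto intro: add_pos_pos)
  have "(\<alpha>2 * c + \<alpha>1 * (1 / t)) / (c + 1 / t) = ((\<alpha>2 * c + \<alpha>1 * (1 / t)) * t) / ((c + 1 / t) * t)"
    using t by simp
  also have "\<dots> = (\<alpha>2 * (c * t + 1) + (\<alpha>1 - \<alpha>2)) / (c * t + 1)"
    using t by (simp add: algebra_simps)
  also have "\<dots> = \<alpha>2 + (\<alpha>1 - \<alpha>2) / (c * t + 1)" using D by (simp add: add_divide_distrib)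
  finally have e: "- ((\<alpha>2 * c + \<alpha>1 * (1 / t)) / (c + 1 / t)) = - \<alpha>2 + (\<alpha>2 - \<alpha>1) / (c * t + 1)"
    by (simp add: diff_divide_distrib)
  have "(1 / t) powr ((\<alpha>2 * c + \<alpha>1 * (1 / t)) / (c + 1 / t)) = t powr - \<alpha>2 * t powr ((\<alpha>2 - \<alpha>1) / (c * t + 1))"
    using t unfolding powr_add[symmetric] e[symmetric] by (simp add: powr_divide powr_minus_divide)
  also have "\<dots> \<le> t powr - \<alpha>2 * exp (1 / c)"
  proof (rule mult_left_mono)
    have "(\<alpha>2 - \<alpha>1) * ln t \<le> 1 * t" using \<alpha> t ln_le_minus_one[of t] by (intro mult_mono) auto
    also have "\<dots> \<le> (c * t + 1) / c" using c by (simp add: field_simps)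
    finally have "(\<alpha>2 - \<alpha>1) * ln t / (c * t + 1) \<le> 1 / c"
      using D c by (simp add: field_simps)
    then show "t powr ((\<alpha>2 - \<alpha>1) / (c * t + 1)) \<le> exp (1 / c)" using t by (simp add: powr_def)
  qed simp
  finally show ?thesis by (simp add: mult.commute)
qed

text \<open>The width \<open>R\<close> of the Gaussian test function is chosen so that at the datum the reaction term
  dominates the diffusion term; this forces \<open>R powr d\<close> to be of the order of \<open>A powr (1 - p)\<close>.\<close>
lemma test_function_width:
  fixes \<nu> p d g m :: real
  assumes \<nu>: "0 < \<nu>" and p: "1 < p" and d: "d = 2 - \<nu> * (p - 1)" "0 < d" and g: "0 < g" and m: "0 < m"
  obtains A0 C where "0 < A0" "0 < C"
    "\<And>A. 0 < A \<Longrightarrow> A \<le> A0 \<Longrightarrow> \<exists>R\<ge>1.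
       2 * (\<nu> * (1 / R)\<^sup>2) \<le> (g * R powr \<nu>) powr (1 - p) * (A * m / 2) powr (p - 1) \<and>
       (A * m) powr (1 - p) / ((g * R powr \<nu>) powr (1 - p) / 2) = C * A powr (- 2 * (p - 1) / d)"
proof -
  \<comment> \<open>Putting R^d = D A^(1-p) into 2 \<nu>/R^2 = (g R^\<nu>)^(1-p) (A m/2)^(p-1)
    cancels R and A and leaves this D, so the largeness condition holds with equality.\<close>
  define D where "D = 2 * \<nu> * g powr (p - 1) * (m / 2) powr (1 - p)"
  have D: "0 < D" using assms by (simp add: D_def)
  \<comment> \<open>A \<le> A0 means A^(p-1) \<le> D, that is D A^(1-p) \<ge> 1 and hence R \<ge>
    1.\<close>
  define A0 where "A0 = D powr (1 / (p - 1))"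
  define C where "C = 2 * g powr (p - 1) * m powr (1 - p) / D * D powr (2 / d)"
  have "0 < A0" "0 < C" using D g m by (auto simp: A0_def C_def)
  moreover have "\<exists>R\<ge>1.
       2 * (\<nu> * (1 / R)\<^sup>2) \<le> (g * R powr \<nu>) powr (1 - p) * (A * m / 2) powr (p - 1) \<and>
       (A * m) powr (1 - p) / ((g * R powr \<nu>) powr (1 - p) / 2) = C * A powr (- 2 * (p - 1) / d)"
    if A: "0 < A" "A \<le> A0" for A
  proof -
    define R where "R = (D * A powr (1 - p)) powr (1 / d)"
    have "A powr (p - 1) \<le> A0 powr (p - 1)" using A p by (intro powr_mono2) auto
    also have "\<dots> = D" using D p by (simp add: A0_def powr_powr)
    finally have "1 \<le> D / A powr (p - 1)" using A by simp
    also have "\<dots> = D * A powr (1 - p)" using powr_minus_divide[of A "p - 1"] by simp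
    finally have big: "1 \<le> D * A powr (1 - p)" .
    have R1: "1 \<le> R" unfolding R_def using big d by (intro ge_one_powr_ge_zero) auto
    have Rd: "R powr d = D * A powr (1 - p)" using d D A by (simp add: R_def powr_powr)
    have R0: "0 < R" using R1 by simp
    have e: "(g * R powr \<nu>) powr (1 - p) = g powr (1 - p) * R powr (\<nu> * (1 - p))"
      using g R0 by (simp add: powr_mult powr_powr)
    have inv: "g powr (1 - p) * g powr (p - 1) = 1" "A powr (1 - p) * A powr (p - 1) = 1"
      "(m / 2) powr (1 - p) * (m / 2) powr (p - 1) = 1" "R powr (\<nu> * (1 - p)) * R powr (\<nu> * (p - 1)) = 1"
      using g A m R0 by (auto simp: powr_add[symmetric] algebra_simps)
    have R2: "R powr d = R\<^sup>2 * R powr (\<nu> * (1 - p))"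
    proof -
      have "R\<^sup>2 = R powr 2" using R0 by simp
      then have "R\<^sup>2 * R powr (\<nu> * (1 - p)) = R powr (2 + \<nu> * (1 - p))" by (simp only: powr_add)
      then show ?thesis by (simp add: d(1) algebra_simps)
    qed
    have 1: "2 * (\<nu> * (1 / R)\<^sup>2) = (g * R powr \<nu>) powr (1 - p) * (A * m / 2) powr (p - 1)"
    proof -
      have "R\<^sup>2 * ((g * R powr \<nu>) powr (1 - p) * (A * m / 2) powr (p - 1)) =
         (R\<^sup>2 * R powr (\<nu> * (1 - p))) * g powr (1 - p) * (A powr (p - 1) * (m / 2) powr (p - 1))"
        unfolding e using A m powr_mult[of A "m / 2" "p - 1"] by simp
      also have "\<dots> = 2 * \<nu> * (g powr (1 - p) * g powr (p - 1)) * (A powr (1 - p) * A powr (p - 1)) *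
         ((m / 2) powr (1 - p) * (m / 2) powr (p - 1))"
        unfolding R2[symmetric] Rd D_def by (simp only: mult_ac)
      finally have "R\<^sup>2 * ((g * R powr \<nu>) powr (1 - p) * (A * m / 2) powr (p - 1)) = 2 * \<nu>"
        unfolding inv by simp
      then show ?thesis using R0 by (simp add: field_simps)
    qed
    \<comment> \<open>Replacing A^(1-p) by R^d/D, the power R^(\<nu>(1-p)) contained in R^d cancels
      against the Gaussian mass and only R^2 survives.\<close>
    have 2: "(A * m) powr (1 - p) / ((g * R powr \<nu>) powr (1 - p) / 2) = C * A powr (- 2 * (p - 1) / d)"
    proof -
      have recip: "1 / (g * R powr \<nu>) powr (1 - p) = g powr (p - 1) * R powr (\<nu> * (p - 1))"
      proof -
        have "(g * R powr \<nu>) powr (1 - p) * (g powr (p - 1) * R powr (\<nu> * (p - 1))) =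
           (g powr (1 - p) * g powr (p - 1)) * (R powr (\<nu> * (1 - p)) * R powr (\<nu> * (p - 1)))"
          unfolding e by (simp only: mult_ac)
        then have "(g * R powr \<nu>) powr (1 - p) * (g powr (p - 1) * R powr (\<nu> * (p - 1))) = 1"
          unfolding inv by simp
        then show ?thesis by (metis divide_eq_eq mult.commute mult_zero_left zero_neq_one)
      qed
      have "(A * m) powr (1 - p) / ((g * R powr \<nu>) powr (1 - p) / 2) =
          2 * (A * m) powr (1 - p) * (1 / (g * R powr \<nu>) powr (1 - p))" by simp
      also have "\<dots> = 2 * (A powr (1 - p) * m powr (1 - p)) * (1 / (g * R powr \<nu>) powr (1 - p))"
        using A m by (simp add: powr_mult)
      finally have "(A * m) powr (1 - p) / ((g * R powr \<nu>) powr (1 - p) / 2) =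
          2 * (R\<^sup>2 * R powr (\<nu> * (1 - p)) / D * m powr (1 - p)) * (g powr (p - 1) * R powr (\<nu> * (p - 1)))"
        using Rd D by (simp add: recip R2)
      also have "\<dots> = 2 * g powr (p - 1) * m powr (1 - p) / D * R\<^sup>2 * (R powr (\<nu> * (1 - p)) * R powr (\<nu> * (p - 1)))"
        by simp
      also have "\<dots> = 2 * g powr (p - 1) * m powr (1 - p) / D * R\<^sup>2" unfolding inv by simp
      also have "R\<^sup>2 = D powr (2 / d) * A powr (- 2 * (p - 1) / d)"
      proof -
        have "R\<^sup>2 = R powr 2" using R0 by simp
        also have "\<dots> = (D * A powr (1 - p)) powr (2 / d)" by (simp add: R_def powr_powr)
        also have "\<dots> = D powr (2 / d) * A powr ((1 - p) * (2 / d))"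
          using D A by (simp add: powr_mult powr_powr)
        also have "(1 - p) * (2 / d) = - 2 * (p - 1) / d" by (simp add: field_simps)
        finally show ?thesis .
      qed
      finally show ?thesis unfolding C_def by (simp only: mult.assoc)
    qed
    show ?thesis using R1 1 2 by (intro exI[of _ R]) auto
  qed
  ultimately show thesis using that by blast
qed

lemma ereal_le_if_all_less:
  fixes \<tau> :: ereal
  assumes s: "0 \<le> s" and "\<And>t. 0 < t \<Longrightarrow> ereal t < \<tau> \<Longrightarrow> t < s"
  shows "\<tau> \<le> ereal s"
proof (rule ccontr)
  assume "\<not> \<tau> \<le> ereal s"
  then obtain t where "ereal s < ereal t" "ereal t < \<tau>" using ereal_dense2[of "ereal s" \<tau>] by (auto simp: not_le)
  then show False using assms(2)[of t] s by auto
qed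

theorem theorem5p3:
  fixes \<alpha>1 \<alpha>2 c p d :: real
    and \<psi> :: "real \<Rightarrow> real"
    and Z Y :: "real \<Rightarrow> (real ^ 'n) measure"
    and \<phi> :: "real ^ 'n \<Rightarrow> real"
    and T :: "real \<Rightarrow> ereal"
    and u :: "real \<Rightarrow> real \<Rightarrow> real ^ 'n \<Rightarrow> real"
  assumes "0 < \<alpha>1" "\<alpha>1 < 1" "0 < \<alpha>2" "\<alpha>2 < 1" "0 < c"
    and "bernstein_function (\<lambda>s. s powr ((\<alpha>2 * c + \<alpha>1 * s) / (c + s)))"
    and "1 < p" "p < 1 + 2 / real CARD('n)"
    and "d = 2 - real CARD('n) * (p - 1)"
    and "kernel_of_Psi \<alpha>1 \<alpha>2 c \<psi>"
    and "S_measures \<alpha>1 \<alpha>2 c Z"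
    and "P_measures \<alpha>1 \<alpha>2 c Y"
    and "integrable lborel \<phi>" "in_Linf \<phi>"
    and "AE x in lborel. 0 \<le> \<phi> x"
    and "\<not> (AE x in lborel. \<phi> x = 0)"
    and "\<And>A. 0 < A \<Longrightarrow> nonneg_maximal_mild_solution Z Y p (\<lambda>x. A * \<phi> x) (T A) (u A)"
  shows "(\<exists>A0>0. \<exists>C>0. \<forall>A. 0 < A \<and> A \<le> A0 \<longrightarrow>
            T A \<le> ereal (inv_into {0..} (K \<psi>) (C * A powr (- 2 * (p - 1) / d)))) \<and>
         lesssim_at_0 T (\<lambda>A. A powr (- 1 / (\<alpha>2 * (1 / (p - 1) - real CARD('n) / 2))))"
proof -
  define n where "n = real CARD('n)"
  have n: "0 < n" by (simp add: n_def)
  have dpos: "0 < d"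
    using assms(7,8) n unfolding assms(9) n_def[symmetric] by (simp add: field_simps)
  define f where "f = (\<lambda>s::real. s powr ((\<alpha>2 * c + \<alpha>1 * s) / (c + s)))"
  have invPsi: "inverse (Psi \<alpha>1 \<alpha>2 c (of_real z)) = of_real (f z)" if "0 < z" for z
    unfolding f_def by (rule inverse_Psi_of_real[OF that])
  have f_pos: "0 < f z" if "0 < z" for z using that by (simp add: f_def)
  interpret subdiffusion f Z Y
  proof (rule subdiffusion.intro)
    show "f (l * z) \<le> l * f z" if "0 < z" "1 \<le> l" for z l
      unfolding f_def using bernstein_function_scale[OF assms(6) that] .
    show "laplace (\<lambda>t. indicator {0<..} t *\<^sub>R fourier_measure (Z t) \<xi>) z
       (of_real (f z / (z * (f z + (norm \<xi>)\<^sup>2))))" if z: "0 < z" for z \<xi>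
    proof -
      have "has_bochner_integral lborel
          (\<lambda>t. indicator {0<..} t *\<^sub>R (of_real (exp (- z * t)) * fourier_measure (Z t) \<xi>))
          (inverse (Psi \<alpha>1 \<alpha>2 c (of_real z)) /
             (of_real z * (inverse (Psi \<alpha>1 \<alpha>2 c (of_real z)) + of_real ((norm \<xi>)\<^sup>2))))"
        using assms(11) z unfolding S_measures_def by blast
      then show ?thesis unfolding laplace_def invPsi[OF z] by simp
    qed
    show "laplace (\<lambda>t. indicator {0<..} t *\<^sub>R fourier_measure (Y t) \<xi>) z
       (of_real (1 / (f z + (norm \<xi>)\<^sup>2)))" if z: "0 < z" for z \<xi>
    proof -
      have "has_bochner_integral lborel
          (\<lambda>t. indicator {0<..} t *\<^sub>R (of_real (exp (- z * t)) * fourier_measure (Y t) \<xi>))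
          (1 / (inverse (Psi \<alpha>1 \<alpha>2 c (of_real z)) + of_real ((norm \<xi>)\<^sup>2)))"
        using assms(12) z unfolding P_measures_def by blast
      then show ?thesis unfolding laplace_def invPsi[OF z] by simp
    qed
    show "prob_space (Z t)" "sets (Z t) = sets borel" if "0 < t" for t
      using assms(11) that unfolding S_measures_def by blast+
    show "finite_measure (Y t)" "sets (Y t) = sets borel" if "0 < t" for t
      using assms(12) that unfolding P_measures_def by blast+
  qed (rule f_pos)
  \<comment> \<open>Both kernels have transform Psi at every z > \<sigma>, and a half-line of real
    arguments is enough for uniqueness.\<close>
  have K_psi: "K \<psi> = K mass"
  proof
    fix t
    obtain \<sigma> where \<sigma>: "0 \<le> \<sigma>" and si: "set_integrable lborel {0<..t} \<psi>" and
      lap: "\<And>z. Re z > \<sigma> \<Longrightarrow> has_bochner_integral lborel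
             (\<lambda>t. indicator {0<..} t *\<^sub>R (exp (- (z * of_real t)) * of_real (\<psi> t))) (Psi \<alpha>1 \<alpha>2 c z)"
    proof -
      have "set_integrable lborel {0<..t} \<psi>"
      proof (cases "0 < t")
        case True
        then show ?thesis using assms(10) unfolding kernel_of_Psi_def by blast
      qed (simp add: set_integrable_def)
      then show ?thesis using assms(10) that unfolding kernel_of_Psi_def by blast
    qed
    have "AE t in lborel. of_real (indicator {0<..} t * \<psi> t) - complex_of_real (mass t) = 0"
    proof (rule laplace_unique_zero[where \<sigma> = \<sigma>])
      fix z assume z: "\<sigma> < z"
      have "0 < z" using z \<sigma> by simp
      have "Psi \<alpha>1 \<alpha>2 c (of_real z) = of_real (1 / f z)"
        using invPsi[OF \<open>0 < z\<close>] by (metis inverse_eq_divide inverse_inverse_eq of_real_inverse)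
      moreover have "(\<lambda>t. indicator {0<..} t *\<^sub>R (exp (- (of_real z * of_real t)) * of_real (\<psi> t))) =
         (\<lambda>t. of_real (exp (- z * t)) * complex_of_real (indicator {0<..} t * \<psi> t))"
        by (auto simp: indicator_def fun_eq_iff exp_of_real[symmetric])
      ultimately have "laplace (\<lambda>t. complex_of_real (indicator {0<..} t * \<psi> t)) z (of_real (1 / f z))"
        using lap[of "of_real z"] z unfolding laplace_def by simp
      from laplace_diff[OF this laplace_mass[OF \<open>0 < z\<close>]]
      show "laplace (\<lambda>t. of_real (indicator {0<..} t * \<psi> t) - complex_of_real (mass t)) z 0" by simp
    qed (simp add: mass_nonpos)
    then have "AE s in lborel. indicator {0<..t} s *\<^sub>R \<psi> s = indicator {0<..t} s *\<^sub>R mass s"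
      by eventually_elim (auto simp: indicator_def split: if_splits)
    moreover have "(\<lambda>s. indicator {0<..t} s *\<^sub>R \<psi> s) \<in> borel_measurable lborel"
      using si unfolding set_integrable_def by auto
    ultimately show "K \<psi> t = K mass t"
      unfolding K_def set_lebesgue_integral_def by (intro integral_cong_AE) auto
  qed
  \<comment> \<open>Growth of order t^\<alpha>2 makes K unbounded, hence invertible at every level,
    and later converts the bound through the inverse of K into a power of A.\<close>
  have K_growth: "1 / (8 * exp (1 / c)) * t powr \<alpha>2 \<le> K mass t" if t: "1 \<le> t" for t
  proof -
    have "f (1 / t) \<le> exp (1 / c) * t powr - \<alpha>2"
      unfolding f_def using symbol_upper_bound[OF assms(1,4,5) t] .
    then have "1 / (8 * (exp (1 / c) * t powr - \<alpha>2)) \<le> 1 / (8 * f (1 / t))"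
      using f_pos[of "1 / t"] t by (intro divide_left_mono) auto
    also have "\<dots> \<le> K mass t" using K_lower t by simp
    finally show ?thesis using t by (simp add: powr_minus_divide)
  qed
  have K_inv: "0 \<le> inv_into {0..} (K mass) y" "K mass (inv_into {0..} (K mass) y) = y" if y: "0 \<le> y" for y
  proof -
    \<comment> \<open>Inverts the lower bound t^\<alpha>2/(8 e^(1/c)) at y; the maximum with 1 is
      there because \<open>K_growth\<close> starts at t = 1.\<close>
    define b where "b = max 1 ((8 * exp (1 / c) * y) powr (1 / \<alpha>2))"
    have "8 * exp (1 / c) * y = ((8 * exp (1 / c) * y) powr (1 / \<alpha>2)) powr \<alpha>2"
      using y assms(3) by (simp add: powr_powr)
    also have "\<dots> \<le> b powr \<alpha>2" using assms(3) by (intro powr_mono2) (auto simp: b_def)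
    finally have "y \<le> 1 / (8 * exp (1 / c)) * b powr \<alpha>2" by (simp add: field_simps)
    also have "\<dots> \<le> K mass b" by (rule K_growth) (simp add: b_def)
    finally show "0 \<le> inv_into {0..} (K mass) y" "K mass (inv_into {0..} (K mass) y) = y"
      using K_inv_into[of b y] y by (auto simp: b_def)
  qed
  \<comment> \<open>The tested profile for R = 1. A wider Gaussian is pointwise larger, so A m
    bounds the tested datum from below for every R \<ge> 1.\<close>
  define m where "m = (LINT x|lborel. \<phi> x * exp (- (norm x)\<^sup>2 / 2))"
  have \<phi>_int: "integrable lborel (\<lambda>x. \<phi> x * exp (- (\<sigma> * norm x)\<^sup>2 / 2))" for \<sigma>
    using assms(13) by (intro Bochner_Integration.integrable_bound[OF assms(13)])
      (auto simp: abs_mult intro!: mult_left_le)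
  have m: "0 < m"
  proof -
    have nn: "AE x in lborel. 0 \<le> \<phi> x * exp (- (norm x)\<^sup>2 / 2)" using assms(15) by eventually_elim simp
    have "m \<noteq> 0"
    proof
      assume "m = 0"
      then have "AE x in lborel. \<phi> x * exp (- (norm x)\<^sup>2 / 2) = 0"
        using integral_nonneg_eq_0_iff_AE[of lborel "\<lambda>x. \<phi> x * exp (- (norm x)\<^sup>2 / 2)"] nn \<phi>_int[of 1]
        by (simp add: m_def)
      then show False using assms(16) by simp
    qed
    moreover have "0 \<le> m" unfolding m_def by (rule integral_nonneg_AE[OF nn])
    ultimately show ?thesis by simp
  qed
  define g where "g = sqrt (2 * pi) ^ CARD('n)"
  have g: "0 < g" by (simp add: g_def)
  obtain A0 C1 where A0: "0 < A0" and C1: "0 < C1" and width: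
    "\<And>A. 0 < A \<Longrightarrow> A \<le> A0 \<Longrightarrow> \<exists>R\<ge>1.
       2 * (n * (1 / R)\<^sup>2) \<le> (g * R powr n) powr (1 - p) * (A * m / 2) powr (p - 1) \<and>
       (A * m) powr (1 - p) / ((g * R powr n) powr (1 - p) / 2) = C1 * A powr (- 2 * (p - 1) / d)"
    using test_function_width[OF n assms(7) _ dpos g m] assms(9) unfolding n_def by metis
  \<comment> \<open>The first factor is the constant of \<open>mild_K_bound\<close>.\<close>
  define C where "C = 2 / (1 / (8 * exp 1) * (1 - 2 powr (1 - p))) * C1"
  have "(2::real) powr (1 - p) < 1" using assms(7) by (simp add: powr_less_one)
  then have C: "0 < C" using C1 by (simp add: C_def)
  define life where "life = (\<lambda>A. inv_into {0..} (K mass) (C * A powr (- 2 * (p - 1) / d)))"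
  have life: "0 \<le> life A" "K mass (life A) = C * A powr (- 2 * (p - 1) / d)" for A
    unfolding life_def using C K_inv by auto
  have bound: "T A \<le> ereal (life A)" if A: "0 < A" "A \<le> A0" for A
  proof (rule ereal_le_if_all_less[OF life(1)])
    \<comment> \<open>Any positive time below the possibly infinite maximal time is a horizon for
      the solution, so the blow-up bound applies to it.\<close>
    fix t assume t: "0 < t" "ereal t < T A"
    note max = assms(17)[OF A(1), unfolded nonneg_maximal_mild_solution_def]
    interpret mild f Z Y p t "\<lambda>x. A * \<phi> x" "u A"
    proof
      show "mild_solution Z Y p (\<lambda>x. A * \<phi> x) t (u A)" using max t by auto
      show "AE x in lborel. 0 \<le> u A s x" if "0 \<le> s" "s \<le> t" for s
      proof -
        have "ereal s < T A" using that t(2) by (meson ereal_less_eq(3) le_less_trans)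
        then show ?thesis using max that by auto
      qed
    qed (use assms(7,13) t in auto)
    obtain R where R: "1 \<le> R" and
      large: "2 * (n * (1 / R)\<^sup>2) \<le> (g * R powr n) powr (1 - p) * (A * m / 2) powr (p - 1)" and
      size: "(A * m) powr (1 - p) / ((g * R powr n) powr (1 - p) / 2) = C1 * A powr (- 2 * (p - 1) / d)"
      using width[OF A] by auto
    have gR: "g * R powr n = (sqrt (2 * pi) / (1 / R)) ^ CARD('n)"
      using R by (simp add: g_def n_def power_mult_distrib powr_realpow)
    have "m \<le> (LINT x|lborel. \<phi> x * exp (- (1 / R * norm x)\<^sup>2 / 2))"
      unfolding m_def
    proof (rule integral_mono_AE)
      show "AE x in lborel. \<phi> x * exp (- (norm x)\<^sup>2 / 2) \<le> \<phi> x * exp (- (1 / R * norm x)\<^sup>2 / 2)"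
        using assms(15)
      proof eventually_elim
        fix x assume "0 \<le> \<phi> x"
        moreover have "1 / R * norm x \<le> 1 * norm x" using R by (intro mult_right_mono) auto
        then have "(1 / R * norm x)\<^sup>2 \<le> (norm x)\<^sup>2" using R by (intro power_mono) auto
        ultimately show "\<phi> x * exp (- (norm x)\<^sup>2 / 2) \<le> \<phi> x * exp (- (1 / R * norm x)\<^sup>2 / 2)"
          by (intro mult_left_mono) auto
      qed
    qed (use \<phi>_int[of 1] \<phi>_int[of "1 / R"] in auto)
    then have le: "A * m \<le> (LINT x|lborel. A * \<phi> x * exp (- (1 / R * norm x)\<^sup>2 / 2))"
      using A by (simp add: mult.assoc)
    have "K mass t < 2 / (1 / (8 * exp 1) * (1 - 2 powr (1 - p))) * ((A * m) powr (1 - p) / ((g * R powr n) powr (1 - p) / 2))"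
      unfolding gR by (rule mild_K_bound[OF _ _ le refl large[unfolded gR, unfolded n_def]]) (use R A m in auto)
    also have "\<dots> = K mass (life A)" unfolding size life C_def by (simp only: mult.assoc)
    finally show "t < life A" using K_mono[of "life A" t] by (meson leD leI)
  qed
  define e where "e = - 1 / (\<alpha>2 * (1 / (p - 1) - n / 2))"
  have e: "- 2 * (p - 1) / d / \<alpha>2 = e"
  proof -
    have "1 / (p - 1) - n / 2 = d / (2 * (p - 1))"
      using assms(7) unfolding assms(9) n_def by (simp add: field_simps)
    then show ?thesis by (simp add: e_def)
  qed
  have eneg: "e < 0"
    using dpos assms(3,7) unfolding e[symmetric] by (simp add: divide_neg_pos)
  \<comment> \<open>The summand 1 covers \<open>life A\<close> < 1, where \<open>K_growth\<close>
    says nothing: for A \<le> 1 and e < 0 one has A^e \<ge> 1.\<close>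
  define C' where "C' = 1 + (8 * exp (1 / c) * C) powr (1 / \<alpha>2)"
  have "life A \<le> C' * A powr e" if A: "0 < A" "A \<le> 1" for A
  proof -
    have one: "1 \<le> A powr e" using powr_mono2'[of e A 1] A eneg by simp
    have "life A \<le> 1 \<or> life A \<le> (8 * exp (1 / c) * C) powr (1 / \<alpha>2) * A powr e"
    proof (cases "1 \<le> life A")
      case True
      have "life A powr \<alpha>2 \<le> 8 * exp (1 / c) * (C * A powr (- 2 * (p - 1) / d))"
        using K_growth[OF True] unfolding life by (simp add: field_simps)
      then have "(life A powr \<alpha>2) powr (1 / \<alpha>2) \<le> (8 * exp (1 / c) * C * A powr (- 2 * (p - 1) / d)) powr (1 / \<alpha>2)"
        using assms(3) by (intro powr_mono2) (auto simp: mult.assoc)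
      also have "\<dots> = (8 * exp (1 / c) * C) powr (1 / \<alpha>2) * A powr e"
        using C A by (simp add: powr_mult powr_powr e[symmetric])
      finally show ?thesis using True assms(3) by (simp add: powr_powr)
    qed simp
    moreover have "0 \<le> (8 * exp (1 / c) * C) powr (1 / \<alpha>2) * A powr e" by simp
    ultimately show ?thesis using one unfolding C'_def distrib_right by linarith
  qed
  then have "eventually (\<lambda>A. T A \<le> ereal (C' * A powr e)) (at_right 0)"
    using A0 order_trans[OF bound] by (intro eventually_at_rightI[of 0 "min A0 1"]) auto
  then have "lesssim_at_0 T (\<lambda>A. A powr e)" unfolding lesssim_at_0_def by blast
  then show ?thesis
    using A0 C bound unfolding K_psi life_def e_def n_def by blast
qed

end
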